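(* Let $N\ge 2$ be such that $\Gamma_0(N)$ has genus zero and let $\pi_N(\tau)$ be a Hauptmodul for $\Gamma_0(N)$. For each $d\mid N$ define numbers $A(\ell,d)$ by $$\sum_{\ell=-1}^{\infty}A(\ell,d)q^{\ell}=\frac{2}{\lambda_{2,N}\,|\Gamma_0(N):\Gamma_1(N)|}\Bigg\{\sum_{\substack{s\in\mathcal C(\Gamma_1(N))\\ s\text{ regular}\\ m_s=d}}\Big[(\pi_N|M_s)_0-A_s(0)\Big]+\sum_{\substack{s\in\mathcal C(\Gamma_1(N))\\ s\text{ irregular}\\ m_s=d}}\frac1{h_s}\Big[\pi_N|M_s-A_s(0)\Big]\Bigg\},$$ where $\lambda_{2,N}=2$ if $N=2$ and $\lambda_{2,N}=1$ otherwise. Then, as a product representation for the Fourier expansion at the cusp $(i\infty,i\infty)$, $$\pi_N(z_1)-\pi_N(z_2)=(q_1^{-1}-q_2^{-1})\prod_{m,n>0}\ \prod_{d\mid N}\Big(1-(q_1^mq_2^n)^{N/d}\Big)^{A(mn,d)},\qquad q_j=\exp(2\pi i z_j).$$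
   Context: Hauptmodul: a generator $\pi_N$ of the function field of the genus zero curve $X_0(N)$, a modular function for $\Gamma_0(N)$ holomorphic on the upper half plane whose only pole is a simple pole at $i\infty$, with expansion $q^{-1}+c(0)+c(1)q+\cdots$, $q=\exp(2\pi i\tau)$. $\mathcal C(\Gamma_1(N))$ is a set of representatives $s=a_s/c_s\in\mathbb Q$ with $\gcd(a_s,c_s)=1$ of the inequivalent cusps of $\Gamma_1(N)$ (so $i\infty$ is represented e.g. by $1/N$). Fix $M_s=\begin{pmatrix}a_s&b_s\\c_s&d_s\end{pmatrix}\in\mathrm{SL}_2(\mathbb Z)$; put $m_s=\gcd(c_s,N)$ and $h_s=N/m_s$. For $N\ne4$ all cusps of $\Gamma_1(N)$ are regular and $h_s$ is the width of $s$; for $N=4$ the only irregular cusp is that of $1/2$. $f|M_s(\tau)=f\big(\frac{a_s\tau+b_s}{c_s\tau+d_s}\big)$. Write $\pi_N|M_s=\sum_{n\gg-\infty}A_s(n)q^{n/h_s}$; so $A_s(0)$ is the constant term. For $s$ regular and $0\le t<h_s$, $(\pi_N|M_s)_t=\sum_{n\gg-\infty}A_s(nh_s+t)q^{(nh_s+t)/h_s}$; in particular $(\pi_N|M_s)_0$ is the part of the expansion with integral exponents. *)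

theory Defs
  imports
    "HOL-Complex_Analysis.Complex_Analysis"
    "HOL-Homology.Homology"
    "HOL-Number_Theory.Cong"
begin

section \<open>Congruence subgroups\<close>

definition SL2Z :: "(int^2^2) monoid" where
  "SL2Z = \<lparr>carrier = {M. det M = 1}, monoid.mult = (**), one = mat 1\<rparr>"

definition Gamma0 :: "nat \<Rightarrow> (int^2^2) set" where
  "Gamma0 N = {M \<in> carrier SL2Z. int N dvd M $ 2 $ 1}"

definition Gamma1 :: "nat \<Rightarrow> (int^2^2) set" where
  "Gamma1 N = {M \<in> Gamma0 N. [M $ 1 $ 1 = 1] (mod int N) \<and> [M $ 2 $ 2 = 1] (mod int N)}"

definition Gamma_index :: "nat \<Rightarrow> nat" where
  "Gamma_index N = card (rcosets\<^bsub>SL2Z\<lparr>carrier := Gamma0 N\<rparr>\<^esub> (Gamma1 N))"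

definition translation :: "int \<Rightarrow> int^2^2" where
  "translation w = vector [vector [1, w], vector [0, 1]]"

definition upper_half_plane :: "complex set" where
  "upper_half_plane = {\<tau>. Im \<tau> > 0}"

definition moebius_map :: "int^2^2 \<Rightarrow> complex \<Rightarrow> complex" where
  "moebius_map M \<tau> = (of_int (M$1$1) * \<tau> + of_int (M$1$2)) / (of_int (M$2$1) * \<tau> + of_int (M$2$2))"

definition slash :: "(complex \<Rightarrow> complex) \<Rightarrow> int^2^2 \<Rightarrow> complex \<Rightarrow> complex" where
  "slash f M \<tau> = f (moebius_map M \<tau>)"


section \<open>Cusps and modular curves\<close>

text \<open>
  Points of the Riemann sphere have type \<open>complex option\<close>, with \<open>None\<close> the point at infinity.
\<close>

definition moebius_pt :: "int^2^2 \<Rightarrow> complex option \<Rightarrow> complex option" where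
  "moebius_pt M x = (case x of
      None \<Rightarrow> if M$2$1 = 0 then None else Some (of_int (M$1$1) / of_int (M$2$1))
    | Some z \<Rightarrow> if of_int (M$2$1) * z + of_int (M$2$2) = 0 then None else Some (moebius_map M z))"

definition cusps :: "complex option set" where
  "cusps = insert None (Some ` \<rat>)"

definition equivalent_pts :: "(int^2^2) set \<Rightarrow> complex option \<Rightarrow> complex option \<Rightarrow> bool" where
  "equivalent_pts \<Gamma> x y \<longleftrightarrow> (\<exists>\<gamma>\<in>\<Gamma>. moebius_pt \<gamma> x = y)"

text \<open>
  The extended upper half plane: a neighbourhood of a cusp \<open>\<gamma>\<infinity>\<close> has to contain the
  image under \<open>\<gamma>\<close> of some half plane \<open>Im z > Y\<close>.
\<close>

definition ext_open :: "complex option set \<Rightarrow> bool" where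
  "ext_open U \<longleftrightarrow> U \<subseteq> Some ` upper_half_plane \<union> cusps \<and>
     open {z \<in> upper_half_plane. Some z \<in> U} \<and>
     (\<forall>\<gamma>\<in>carrier SL2Z. moebius_pt \<gamma> None \<in> U \<longrightarrow>
        (\<exists>Y>0. \<forall>z. Im z > Y \<longrightarrow> Some (moebius_map \<gamma> z) \<in> U))"

definition ext_upper_half_plane :: "complex option topology" where
  "ext_upper_half_plane = topology ext_open"

lemma istopology_ext_open: "istopology ext_open"
  unfolding istopology_def
proof (intro conjI allI impI)
  fix S T assume S: "ext_open S" and T: "ext_open T"
  have "{z \<in> upper_half_plane. Some z \<in> S \<inter> T} =
        {z \<in> upper_half_plane. Some z \<in> S} \<inter> {z \<in> upper_half_plane. Some z \<in> T}" by auto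
  then have "open {z \<in> upper_half_plane. Some z \<in> S \<inter> T}"
    using S T unfolding ext_open_def by auto
  moreover have "\<exists>Y>0. \<forall>z. Im z > Y \<longrightarrow> Some (moebius_map \<gamma> z) \<in> S \<inter> T"
    if \<gamma>: "\<gamma> \<in> carrier SL2Z" "moebius_pt \<gamma> None \<in> S \<inter> T" for \<gamma>
  proof -
    obtain Y1 where "Y1 > 0" "\<And>z. Im z > Y1 \<Longrightarrow> Some (moebius_map \<gamma> z) \<in> S"
      using S \<gamma> unfolding ext_open_def by blast
    moreover obtain Y2 where "Y2 > 0" "\<And>z. Im z > Y2 \<Longrightarrow> Some (moebius_map \<gamma> z) \<in> T"
      using T \<gamma> unfolding ext_open_def by blast
    ultimately show ?thesis by (intro exI[of _ "max Y1 Y2"]) auto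
  qed
  ultimately show "ext_open (S \<inter> T)" using S unfolding ext_open_def by auto
next
  fix \<K> assume K: "\<forall>K\<in>\<K>. ext_open K"
  have "{z \<in> upper_half_plane. Some z \<in> \<Union>\<K>} = (\<Union>K\<in>\<K>. {z \<in> upper_half_plane. Some z \<in> K})"
    by auto
  then have "open {z \<in> upper_half_plane. Some z \<in> \<Union>\<K>}"
    using K unfolding ext_open_def by auto
  moreover have "\<exists>Y>0. \<forall>z. Im z > Y \<longrightarrow> Some (moebius_map \<gamma> z) \<in> \<Union>\<K>"
    if \<gamma>: "\<gamma> \<in> carrier SL2Z" "moebius_pt \<gamma> None \<in> \<Union>\<K>" for \<gamma>
  proof -
    obtain K where "K \<in> \<K>" "moebius_pt \<gamma> None \<in> K" using \<gamma> by blast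
    moreover then obtain Y where "Y > 0" "\<And>z. Im z > Y \<Longrightarrow> Some (moebius_map \<gamma> z) \<in> K"
      using K \<gamma>(1) unfolding ext_open_def by blast
    ultimately show ?thesis by blast
  qed
  moreover have "\<Union>\<K> \<subseteq> Some ` upper_half_plane \<union> cusps"
    using K unfolding ext_open_def by blast
  ultimately show "ext_open (\<Union>\<K>)" unfolding ext_open_def by blast
qed

lemma openin_ext_upper_half_plane: "openin ext_upper_half_plane = ext_open"
  unfolding ext_upper_half_plane_def using istopology_ext_open by (rule topology_inverse')

definition orbit_pt :: "(int^2^2) set \<Rightarrow> complex option \<Rightarrow> complex option set" where
  "orbit_pt \<Gamma> x = (\<lambda>\<gamma>. moebius_pt \<gamma> x) ` \<Gamma>"

definition quotient_open :: "(int^2^2) set \<Rightarrow> complex option set set \<Rightarrow> bool" where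
  "quotient_open \<Gamma> V \<longleftrightarrow> V \<subseteq> orbit_pt \<Gamma> ` topspace ext_upper_half_plane \<and>
     openin ext_upper_half_plane {x \<in> topspace ext_upper_half_plane. orbit_pt \<Gamma> x \<in> V}"

definition modular_curve :: "(int^2^2) set \<Rightarrow> complex option set topology" where
  "modular_curve \<Gamma> = topology (quotient_open \<Gamma>)"

lemma istopology_quotient_open: "istopology (quotient_open \<Gamma>)"
  unfolding istopology_def
proof (intro conjI allI impI)
  fix S T assume S: "quotient_open \<Gamma> S" and T: "quotient_open \<Gamma> T"
  let ?p = "\<lambda>V. {x \<in> topspace ext_upper_half_plane. orbit_pt \<Gamma> x \<in> V}"
  have "?p (S \<inter> T) = ?p S \<inter> ?p T" by auto
  then show "quotient_open \<Gamma> (S \<inter> T)"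
    using S T unfolding quotient_open_def by auto
next
  fix \<K> assume K: "\<forall>K\<in>\<K>. quotient_open \<Gamma> K"
  let ?p = "\<lambda>V. {x \<in> topspace ext_upper_half_plane. orbit_pt \<Gamma> x \<in> V}"
  have "?p (\<Union>\<K>) = (\<Union>K\<in>\<K>. ?p K)" by auto
  moreover have "openin ext_upper_half_plane (\<Union>K\<in>\<K>. ?p K)"
    using K unfolding quotient_open_def by blast
  ultimately have "openin ext_upper_half_plane (?p (\<Union>\<K>))" by simp
  moreover have "\<Union>\<K> \<subseteq> orbit_pt \<Gamma> ` topspace ext_upper_half_plane"
    using K unfolding quotient_open_def by blast
  ultimately show "quotient_open \<Gamma> (\<Union>\<K>)" unfolding quotient_open_def by blast
qed

lemma openin_modular_curve: "openin (modular_curve \<Gamma>) = quotient_open \<Gamma>"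
  unfolding modular_curve_def using istopology_quotient_open by (rule topology_inverse')

text \<open>
  Genus of a compact connected orientable surface: the first integral homology group is free
  abelian of rank \<open>2 * g\<close>.
\<close>

definition surface_has_genus :: "'a topology \<Rightarrow> nat \<Rightarrow> bool" where
  "surface_has_genus X g \<longleftrightarrow> homology_group 1 X \<cong> free_Abelian_group {..<2 * g}"

definition cusp_representatives :: "(int^2^2) set \<Rightarrow> rat set \<Rightarrow> bool" where
  "cusp_representatives \<Gamma> C \<longleftrightarrow>
     (\<forall>x\<in>cusps. \<exists>!s. s \<in> C \<and> equivalent_pts \<Gamma> (Some (of_rat s)) x)"

text \<open>
  The matrix has determinant 1, so its first column is a representation of \<open>s\<close> as a reduced
  fraction (up to a common sign of numerator and denominator).
\<close>

definition cusp_matrix :: "int^2^2 \<Rightarrow> rat \<Rightarrow> bool" where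
  "cusp_matrix M s \<longleftrightarrow> M \<in> carrier SL2Z \<and> M$2$1 \<noteq> 0 \<and> of_int (M$1$1) / of_int (M$2$1) = s"

text \<open>
  The stabiliser in \<open>\<Gamma>\<close> of the cusp \<open>M\<infinity>\<close> consists of the elements \<open>\<plusminus> M T\<^sup>w M\<^sup>-\<^sup>1\<close> of \<open>\<Gamma>\<close>, where \<open>T\<^sup>w\<close> is
  translation by \<open>w\<close>. The width is the least \<open>w > 0\<close> that occurs with some sign, and the cusp is
  regular if that \<open>w\<close> occurs with the positive sign.
\<close>

definition cusp_width :: "(int^2^2) set \<Rightarrow> int^2^2 \<Rightarrow> nat" where
  "cusp_width \<Gamma> M = (LEAST w. w > 0 \<and>
     (\<exists>\<gamma>\<in>\<Gamma>. \<gamma> ** M = M ** translation (int w) \<or> \<gamma> ** M = - (M ** translation (int w))))"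

definition regular_cusp :: "(int^2^2) set \<Rightarrow> int^2^2 \<Rightarrow> bool" where
  "regular_cusp \<Gamma> M \<longleftrightarrow> (\<exists>\<gamma>\<in>\<Gamma>. \<gamma> ** M = M ** translation (int (cusp_width \<Gamma> M)))"


section \<open>Expansions at cusps, modular functions, Hauptmoduln\<close>

text \<open>
  An \<open>h\<close>-periodic function of \<open>\<tau>\<close>, as a function of \<open>q\<^sup>1\<^sup>/\<^sup>h = exp (2 * pi * \<i> * \<tau> / h)\<close>; for such a function
  the choice of the branch of the logarithm does not matter. The coefficient of index \<open>n\<close> in its
  expansion belongs to \<open>q\<^sup>n\<^sup>/\<^sup>h\<close>.
\<close>

definition cusp_chart :: "nat \<Rightarrow> (complex \<Rightarrow> complex) \<Rightarrow> complex \<Rightarrow> complex" where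
  "cusp_chart h f w = f (of_nat h / (2 * of_real pi * \<i>) * Ln w)"

definition q_expansion :: "nat \<Rightarrow> (complex \<Rightarrow> complex) \<Rightarrow> complex fls" where
  "q_expansion h f = laurent_expansion (cusp_chart h f) 0"

text \<open>
  At poles in the upper half plane modular functions are given the value \<open>0\<close>; this is what
  \<open>nicely_meromorphic_on\<close> imposes. Every width of a cusp of \<open>Gamma0 N\<close> divides \<open>N\<close>, so \<open>q\<^sup>1\<^sup>/\<^sup>N\<close> may
  be used at each of them.
\<close>

definition modular_function :: "nat \<Rightarrow> (complex \<Rightarrow> complex) \<Rightarrow> bool" where
  "modular_function N f \<longleftrightarrow> f nicely_meromorphic_on upper_half_plane \<and>
     (\<forall>\<gamma>\<in>Gamma0 N. \<forall>\<tau>\<in>upper_half_plane. f (moebius_map \<gamma> \<tau>) = f \<tau>) \<and>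
     (\<forall>\<gamma>\<in>carrier SL2Z. cusp_chart N (slash f \<gamma>) meromorphic_on {0})"

definition generates_function_field :: "nat \<Rightarrow> (complex \<Rightarrow> complex) \<Rightarrow> bool" where
  "generates_function_field N f \<longleftrightarrow> (\<forall>g. modular_function N g \<longrightarrow>
     (\<exists>P Q :: complex poly. Q \<noteq> 0 \<and>
        (\<forall>\<tau>\<in>upper_half_plane. poly Q (f \<tau>) \<noteq> 0 \<longrightarrow> g \<tau> = poly P (f \<tau>) / poly Q (f \<tau>))))"

definition Hauptmodul :: "nat \<Rightarrow> (complex \<Rightarrow> complex) \<Rightarrow> bool" where
  "Hauptmodul N f \<longleftrightarrow> modular_function N f \<and> generates_function_field N f \<and>
     f holomorphic_on upper_half_plane \<and>
     fls_subdegree (q_expansion 1 f) = -1 \<and> fls_nth (q_expansion 1 f) (-1) = 1 \<and>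
     (\<forall>\<gamma>\<in>carrier SL2Z. \<not> equivalent_pts (Gamma0 N) None (moebius_pt \<gamma> None) \<longrightarrow>
        (\<forall>n<0. fls_nth (q_expansion N (slash f \<gamma>)) n = 0))"


section \<open>The exponents of the product\<close>

definition cusp_m :: "nat \<Rightarrow> int^2^2 \<Rightarrow> nat" where
  "cusp_m N M = nat (gcd (M$2$1) (int N))"

definition cusp_h :: "nat \<Rightarrow> int^2^2 \<Rightarrow> nat" where
  "cusp_h N M = N div cusp_m N M"

definition cusp_expansion :: "nat \<Rightarrow> (complex \<Rightarrow> complex) \<Rightarrow> int^2^2 \<Rightarrow> complex fls" where
  "cusp_expansion N f M = q_expansion (cusp_h N M) (slash f M)"

definition progression_part :: "nat \<Rightarrow> nat \<Rightarrow> complex fls \<Rightarrow> complex fls" where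
  "progression_part h t F = Abs_fls (\<lambda>n. if n mod int h = int t then fls_nth F n else 0)"

lemma progression_part_nth:
  "fls_nth (progression_part h t F) n = (if n mod int h = int t then fls_nth F n else 0)"
  unfolding progression_part_def
  by (rule nth_Abs_fls_lower_bound[where N = "fls_subdegree F"])
     (auto simp: fls_eq0_below_subdegree)

definition lambda2 :: "nat \<Rightarrow> nat" where
  "lambda2 N = (if N = 2 then 2 else 1)"

text \<open>
  All cusps with \<open>m\<^sub>s = d\<close> have \<open>h\<^sub>s = N / d\<close>, so both sums below are Laurent series in the one variable
  \<open>q\<^sup>1\<^sup>/\<^sup>h\<close> with \<open>h = N / d\<close>, and the coefficient of \<open>q\<^sup>l\<close> is the one of index \<open>l * h\<close>.
\<close>

definition exponent_series ::
    "nat \<Rightarrow> (complex \<Rightarrow> complex) \<Rightarrow> rat set \<Rightarrow> (rat \<Rightarrow> int^2^2) \<Rightarrow> nat \<Rightarrow> complex fls" where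
  "exponent_series N f C M d =
     fls_const (2 / (of_nat (lambda2 N) * of_nat (Gamma_index N))) *
     ((\<Sum>s | s \<in> C \<and> regular_cusp (Gamma1 N) (M s) \<and> cusp_m N (M s) = d.
         progression_part (cusp_h N (M s)) 0 (cusp_expansion N f (M s))
           - fls_const (fls_nth (cusp_expansion N f (M s)) 0)) +
      (\<Sum>s | s \<in> C \<and> \<not> regular_cusp (Gamma1 N) (M s) \<and> cusp_m N (M s) = d.
         fls_const (1 / of_nat (cusp_h N (M s))) *
           (cusp_expansion N f (M s) - fls_const (fls_nth (cusp_expansion N f (M s)) 0))))"

definition exponent ::
    "nat \<Rightarrow> (complex \<Rightarrow> complex) \<Rightarrow> rat set \<Rightarrow> (rat \<Rightarrow> int^2^2) \<Rightarrow> int \<Rightarrow> nat \<Rightarrow> complex" where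
  "exponent N f C M l d = fls_nth (exponent_series N f C M d) (l * int (N div d))"

text \<open>
  Unordered, absolutely convergent infinite products; the limit is nonzero unless a factor
  vanishes.
\<close>

definition has_abs_prod :: "('a \<Rightarrow> complex) \<Rightarrow> complex \<Rightarrow> 'a set \<Rightarrow> bool" where
  "has_abs_prod f P S \<longleftrightarrow> (\<lambda>x. norm (f x - 1)) summable_on S \<and>
     ((\<lambda>F. \<Prod>x\<in>F. f x) \<longlongrightarrow> P) (finite_subsets_at_top S)"

end

theory Submission
  imports Defs
begin

text \<open>
  Let \<open>f = 1/q + c\<^sub>0 + c\<^sub>1q + \<dots>\<close> be the Hauptmodul. As a power series in \<open>q\<^sub>1\<close>, the function
  \<open>q\<^sub>1(f(z\<^sub>1) - f(z\<^sub>2))\<close> has a logarithmic derivative whose \<open>m\<close>-th coefficient is, up to sign, the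
  \<open>m\<close>-th Faber polynomial in \<open>f(z\<^sub>2)\<close>: a modular function with expansion \<open>q\<^sup>-\<^sup>m + O(q)\<close> that is bounded
  at the cusps not equivalent to \<open>\<infinity>\<close>. The sum of \<open>f(Az)\<close> over the cosets \<open>\<Gamma>\<^sub>1(N)A\<close> of integral matrices
  of determinant \<open>m\<close> with \<open>N\<close> dividing the lower left entry has the same poles up to the factor
  \<open>[\<Gamma>\<^sub>0(N):\<Gamma>\<^sub>1(N)]\<close>: at every other cusp the polar parts cancel in the sum over the translates
  \<open>(az + b)/d\<close>, \<open>b mod d\<close>. By Liouville's theorem the two agree up to a constant. Its coefficients are
  divisor sums over the expansions of \<open>f\<close> at all cusps, hence those of the logarithm of the product.
  Convergence comes from a bound \<open>exp (O(sqrt l))\<close> on the \<open>l\<close>-th coefficient.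
\<close>

text \<open>Cusps of \<open>Gamma1 N\<close> are awkward to sum over, so all counting is done on the
  finite set of bottom rows modulo \<open>N\<close>, which labels the cosets \<open>Gamma1 N\<close>
  A in SL2(Z) and carries a right action of SL2(Z). A cusp is an orbit of rows under translations
  and sign. Its length is 2h for a regular cusp; for N = 2 the sign acts trivially and halves it,
  which \<open>lambda2\<close> repairs; an irregular cusp has h = 2 and an orbit of length 2, whence
  the factor 1/h in the second sum. A sum over all rows with a given gcd with \<open>N\<close> is
  invariant under z -> z + 1, so only integral exponents survive in it: this is the origin of the
  parts with index 0. The difference f(z1) - f(z2) vanishes for q1 = q2, so no logarithm of it is
  taken; formal logarithmic derivatives are compared and the resulting identity of power series in
  q1 is evaluated. At l = mn the coefficient bound has size exp(4 pi sqrt(mn)) <= exp(2 pi (m + n)).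
  The threshold Im z > 3 spends one unit of height on this growth, one on the sum over m, n and one
  on the logarithmic series.\<close>

no_notation fps_nth (infixl "$" 75)

section \<open>Matrices\<close>

abbreviation SL2 :: "(int^2^2) set" where "SL2 \<equiv> carrier SL2Z"

definition mat2 :: "int \<Rightarrow> int \<Rightarrow> int \<Rightarrow> int \<Rightarrow> int^2^2" where
  "mat2 a b c d = vector [vector [a, b], vector [c, d]]"

lemma mat2_nth [simp]:
  "mat2 a b c d $ 1 $ 1 = a" "mat2 a b c d $ 1 $ 2 = b"
  "mat2 a b c d $ 2 $ 1 = c" "mat2 a b c d $ 2 $ 2 = d"
  by (simp_all add: mat2_def)

lemma mat2_eq_iff: "A = B \<longleftrightarrow> A$1$1 = B$1$1 \<and> A$1$2 = B$1$2 \<and> A$2$1 = B$2$1 \<and> A$2$2 = B$2$2"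
  for A B :: "int^2^2"
  by (auto simp: vec_eq_iff forall_2)

lemma mat2_mult_nth [simp]:
  fixes A B :: "int^2^2"
  shows "(A ** B) $ 1 $ 1 = A$1$1 * B$1$1 + A$1$2 * B$2$1"
    "(A ** B) $ 1 $ 2 = A$1$1 * B$1$2 + A$1$2 * B$2$2"
    "(A ** B) $ 2 $ 1 = A$2$1 * B$1$1 + A$2$2 * B$2$1"
    "(A ** B) $ 2 $ 2 = A$2$1 * B$1$2 + A$2$2 * B$2$2"
  by (simp_all add: matrix_matrix_mult_def sum_2)

lemma mat_1_nth [simp]:
  "(mat 1 :: int^2^2) $ 1 $ 1 = 1" "(mat 1 :: int^2^2) $ 1 $ 2 = 0"
  "(mat 1 :: int^2^2) $ 2 $ 1 = 0" "(mat 1 :: int^2^2) $ 2 $ 2 = 1"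
  by (simp_all add: mat_def)

lemma translation_eq: "translation w = mat2 1 w 0 1"
  by (simp add: translation_def mat2_def)

lemma translation_0: "translation 0 = mat 1"
  by (simp add: translation_eq mat2_eq_iff)

lemma translation_add: "translation (i + j) = translation i ** translation j"
  by (simp add: translation_eq mat2_eq_iff)

lemma mem_SL2: "A \<in> SL2 \<longleftrightarrow> det A = 1"
  by (simp add: SL2Z_def)

lemma SL2_mult: "A \<in> SL2 \<Longrightarrow> B \<in> SL2 \<Longrightarrow> A ** B \<in> SL2"
  by (simp add: mem_SL2 det_mul)

lemma SL2_translation [simp]: "translation w \<in> SL2"
  by (simp add: mem_SL2 det_2 translation_eq)

lemma SL2_one [simp]: "mat 1 \<in> SL2"
  by (simp add: mem_SL2)

lemma SL2_uminus: "A \<in> SL2 \<Longrightarrow> - A \<in> SL2"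
  by (simp add: mem_SL2 det_2)

lemma SL2_row_coprime:
  assumes "A \<in> SL2" shows "coprime (A$2$1) (A$2$2)"
proof (rule coprimeI)
  fix k assume k: "k dvd A$2$1" "k dvd A$2$2"
  have "k dvd A$1$1 * A$2$2 - A$1$2 * A$2$1" using k by (intro dvd_diff dvd_mult)
  thus "k dvd 1" using assms by (simp add: mem_SL2 det_2)
qed

lemma SL2_col_coprime:
  assumes "A \<in> SL2" shows "coprime (A$1$1) (A$2$1)"
proof (rule coprimeI)
  fix k assume k: "k dvd A$1$1" "k dvd A$2$1"
  have "k dvd A$2$2 * A$1$1 - A$1$2 * A$2$1" using k by (intro dvd_diff dvd_mult)
  thus "k dvd 1" using assms by (simp add: mem_SL2 det_2 mult.commute)
qed

definition adj2 :: "int^2^2 \<Rightarrow> int^2^2" where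
  "adj2 A = mat2 (A$2$2) (- (A$1$2)) (- (A$2$1)) (A$1$1)"

lemma SL2_adj2: "A \<in> SL2 \<Longrightarrow> adj2 A \<in> SL2"
  by (simp add: mem_SL2 det_2 adj2_def mult.commute)

lemma adj2_inverse:
  assumes "A \<in> SL2" shows "A ** adj2 A = mat 1" "adj2 A ** A = mat 1"
  using assms by (auto simp: mem_SL2 det_2 adj2_def mat2_eq_iff algebra_simps)

lemma mult_adj2_cancel:
  assumes "A \<in> SL2" shows "B ** A ** adj2 A = B" "B ** adj2 A ** A = B"
    "adj2 A ** (A ** B) = B" "A ** (adj2 A ** B) = B"
  using adj2_inverse[OF assms]
  by (simp_all add: matrix_mul_assoc[symmetric]) (simp_all add: matrix_mul_assoc)

lemma Gamma0_SL2: "A \<in> Gamma0 N \<Longrightarrow> A \<in> SL2"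
  by (simp add: Gamma0_def)

lemma Gamma1_Gamma0: "A \<in> Gamma1 N \<Longrightarrow> A \<in> Gamma0 N"
  by (simp add: Gamma1_def)

lemma Gamma1_SL2: "A \<in> Gamma1 N \<Longrightarrow> A \<in> SL2"
  by (simp add: Gamma1_def Gamma0_def)

lemma Gamma0_adj2: "A \<in> Gamma0 N \<Longrightarrow> adj2 A \<in> Gamma0 N"
  by (auto simp: Gamma0_def SL2_adj2) (simp add: adj2_def)

section \<open>Bottom rows modulo \<open>N\<close>\<close>

text \<open>A complete invariant of the coset \<open>Gamma1 N\<close> A: left multiplication by
  \<open>Gamma1 N\<close> preserves it, and by \<open>bottom_row_eqD\<close> it separates cosets.
  Taking finitely many values, it replaces cosets as an index.\<close>

definition bottom_row :: "nat \<Rightarrow> int^2^2 \<Rightarrow> int \<times> int" where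
  "bottom_row N A = (A$2$1 mod int N, A$2$2 mod int N)"

lemma bottom_row_Gamma1_mult:
  assumes "g \<in> Gamma1 N" shows "bottom_row N (g ** A) = bottom_row N A"
proof -
  have 1: "[g$2$1 = 0] (mod int N)" "[g$2$2 = 1] (mod int N)"
    using assms by (auto simp: Gamma1_def Gamma0_def cong_0_iff)
  have "[g$2$1 * x + g$2$2 * y = 0 * x + 1 * y] (mod int N)" for x y
    using 1 by (intro cong_add cong_mult) auto
  thus ?thesis by (simp add: bottom_row_def cong_def)
qed

text \<open>Modulo \<open>N\<close> the lower row of B in B A^-1 may be replaced by that of A, which
  turns its lower entries into 0 and det A = 1. The upper left entry is then 1 because the
  determinant is.\<close>

lemma bottom_row_eqD:
  assumes "A \<in> SL2" "B \<in> SL2" "bottom_row N A = bottom_row N B"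
  shows "B ** adj2 A \<in> Gamma1 N"
proof -
  let ?g = "B ** adj2 A"
  have g: "?g \<in> SL2" using assms by (simp add: SL2_mult SL2_adj2)
  have c: "[B$2$1 = A$2$1] (mod int N)" "[B$2$2 = A$2$2] (mod int N)"
    using assms by (auto simp: bottom_row_def cong_def)
  have dA: "A$1$1 * A$2$2 - A$1$2 * A$2$1 = 1" using assms by (simp add: mem_SL2 det_2)
  have "[B$2$1 * A$2$2 - B$2$2 * A$2$1 = A$2$1 * A$2$2 - A$2$2 * A$2$1] (mod int N)"
    using c by (intro cong_diff cong_mult) auto
  hence 1: "[?g$2$1 = 0] (mod int N)" by (simp add: adj2_def mult.commute)
  have "[B$2$2 * A$1$1 - B$2$1 * A$1$2 = A$2$2 * A$1$1 - A$2$1 * A$1$2] (mod int N)"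
    using c by (intro cong_diff cong_mult) auto
  hence 2: "[?g$2$2 = 1] (mod int N)" using dA by (simp add: adj2_def mult.commute)
  have "[?g$1$1 * 1 - ?g$1$2 * 0 = ?g$1$1 * ?g$2$2 - ?g$1$2 * ?g$2$1] (mod int N)"
    using 1 2 by (intro cong_diff cong_mult) (auto simp: cong_sym_eq)
  also have "?g$1$1 * ?g$2$2 - ?g$1$2 * ?g$2$1 = 1" using g by (simp add: mem_SL2 det_2)
  finally have 3: "[?g$1$1 = 1] (mod int N)" by simp
  show ?thesis using g 1 2 3 by (auto simp: Gamma1_def Gamma0_def cong_0_iff)
qed

text \<open>As an image of SL2(Z) this set comes with lifts (\<open>row_rep\<close>), so no lifting
  theorem for pairs that are primitive modulo \<open>N\<close> enters.\<close>

definition bottom_rows :: "nat \<Rightarrow> (int \<times> int) set" where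
  "bottom_rows N = bottom_row N ` SL2"

definition row_rep :: "nat \<Rightarrow> int \<times> int \<Rightarrow> int^2^2" where
  "row_rep N v = (SOME A. A \<in> SL2 \<and> bottom_row N A = v)"

lemma row_rep:
  assumes "v \<in> bottom_rows N" shows "row_rep N v \<in> SL2" "bottom_row N (row_rep N v) = v"
  using someI_ex[of "\<lambda>A. A \<in> SL2 \<and> bottom_row N A = v"] assms
  unfolding bottom_rows_def row_rep_def by auto

lemma bottom_row_mem: "A \<in> SL2 \<Longrightarrow> bottom_row N A \<in> bottom_rows N"
  by (simp add: bottom_rows_def)

lemma finite_bottom_rows: assumes "N > 0" shows "finite (bottom_rows N)"
  by (rule finite_subset[of _ "{0..<int N} \<times> {0..<int N}"])
     (use assms in \<open>auto simp: bottom_rows_def bottom_row_def\<close>)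

lemma Gamma0_iff_row: "A \<in> SL2 \<Longrightarrow> A \<in> Gamma0 N \<longleftrightarrow> fst (bottom_row N A) = 0"
  by (auto simp: Gamma0_def bottom_row_def)

text \<open>Each coset inside \<open>Gamma0 N\<close> is a full fibre of \<open>bottom_row\<close>
  over a pair with first entry 0. The same count is later the number of rows that carry the pole of
  f.\<close>

lemma Gamma_index_eq: "Gamma_index N = card {v \<in> bottom_rows N. fst v = 0}"
proof -
  let ?G = "SL2Z\<lparr>carrier := Gamma0 N\<rparr>"
  have coset: "Gamma1 N #>\<^bsub>?G\<^esub> a = (\<lambda>h. h ** a) ` Gamma1 N" for a
    by (auto simp: r_coset_def SL2Z_def)
  have row: "bottom_row N ` ((\<lambda>h. h ** a) ` Gamma1 N) = {bottom_row N a}" for a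
  proof -
    have "mat 1 \<in> Gamma1 N" by (simp add: Gamma1_def Gamma0_def)
    thus ?thesis by (auto simp: bottom_row_Gamma1_mult image_image)
  qed
  have set: "(\<lambda>h. h ** a) ` Gamma1 N = {B \<in> SL2. bottom_row N B = bottom_row N a}" if "a \<in> SL2" for a
  proof (intro equalityI subsetI)
    fix B assume "B \<in> {B \<in> SL2. bottom_row N B = bottom_row N a}"
    hence "B ** adj2 a \<in> Gamma1 N" using bottom_row_eqD[OF that, of B N] by auto
    moreover have "B = B ** adj2 a ** a" by (simp add: mult_adj2_cancel that)
    ultimately show "B \<in> (\<lambda>h. h ** a) ` Gamma1 N" by blast
  qed (auto simp: bottom_row_Gamma1_mult SL2_mult that Gamma1_SL2)
  have "rcosets\<^bsub>?G\<^esub> (Gamma1 N) = (\<lambda>a. (\<lambda>h. h ** a) ` Gamma1 N) ` Gamma0 N"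
    unfolding RCOSETS_def coset by auto
  also have "\<dots> = (\<lambda>v. {B \<in> SL2. bottom_row N B = v}) ` {v \<in> bottom_rows N. fst v = 0}"
  proof (intro equalityI subsetI)
    fix X assume "X \<in> (\<lambda>a. (\<lambda>h. h ** a) ` Gamma1 N) ` Gamma0 N"
    then obtain a where "a \<in> Gamma0 N" "X = (\<lambda>h. h ** a) ` Gamma1 N" by auto
    thus "X \<in> (\<lambda>v. {B \<in> SL2. bottom_row N B = v}) ` {v \<in> bottom_rows N. fst v = 0}"
      using set[of a] Gamma0_SL2[of a N] Gamma0_iff_row[of a N] bottom_row_mem[of a N] by blast
  next
    fix X assume "X \<in> (\<lambda>v. {B \<in> SL2. bottom_row N B = v}) ` {v \<in> bottom_rows N. fst v = 0}"
    then obtain v where v: "v \<in> bottom_rows N" "fst v = 0" "X = {B \<in> SL2. bottom_row N B = v}" by auto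
    then have "row_rep N v \<in> Gamma0 N" "X = (\<lambda>h. h ** row_rep N v) ` Gamma1 N"
      using set[of "row_rep N v"] row_rep[of v N] by (auto simp: Gamma0_iff_row)
    thus "X \<in> (\<lambda>a. (\<lambda>h. h ** a) ` Gamma1 N) ` Gamma0 N" by blast
  qed
  also have "card \<dots> = card {v \<in> bottom_rows N. fst v = 0}"
  proof (intro card_image inj_onI)
    fix v w assume v: "v \<in> {v \<in> bottom_rows N. fst v = 0}" "w \<in> {v \<in> bottom_rows N. fst v = 0}"
      and eq: "{B \<in> SL2. bottom_row N B = v} = {B \<in> SL2. bottom_row N B = w}"
    have "row_rep N v \<in> {B \<in> SL2. bottom_row N B = v}" using v row_rep[of v N] by simp
    thus "v = w" unfolding eq using v row_rep[of v N] by simp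
  qed
  finally show ?thesis unfolding Gamma_index_def .
qed

lemma Gamma_index_pos: assumes "N > 0" shows "Gamma_index N > 0"
proof -
  have "bottom_row N (mat 1) \<in> {v \<in> bottom_rows N. fst v = 0}"
    by (auto simp: bottom_row_mem) (simp add: bottom_row_def)
  thus ?thesis unfolding Gamma_index_eq using finite_bottom_rows[OF assms]
    by (subst card_gt_0_iff, intro conjI finite_subset[OF _ finite_bottom_rows[OF assms]]) blast+
qed

section \<open>Hermite normal forms\<close>

definition hermite :: "nat \<Rightarrow> nat \<times> nat \<Rightarrow> int^2^2" where
  "hermite m = (\<lambda>(d, b). mat2 (int (m div d)) (int b) 0 (int d))"

definition hermites :: "nat \<Rightarrow> (nat \<times> nat) set" where
  "hermites m = Sigma {d. d dvd m} (\<lambda>d. {..<d})"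

lemma finite_hermites: "m > 0 \<Longrightarrow> finite (hermites m)"
  by (auto simp: hermites_def)

lemma det_hermite:
  assumes "u \<in> hermites m" shows "det (hermite m u) = int m"
proof -
  obtain d b where u: "u = (d, b)" by (cases u)
  hence "int (m div d) * int d = int m" using assms
    by (auto simp: hermites_def simp flip: of_nat_mult)
  thus ?thesis by (simp add: hermite_def u det_2)
qed

text \<open>The first column of the product is m/d times a primitive vector, so its gcd recovers
  m/d. The second column then fixes b modulo d, as the determinant of g is 1.\<close>

lemma hermite_unique:
  assumes "m > 0" "g \<in> SL2" "g' \<in> SL2" "u \<in> hermites m" "u' \<in> hermites m"
    and eq: "g ** hermite m u = g' ** hermite m u'"
  shows "u = u'" "g = g'"
proof -
  obtain d b d' b' where u: "u = (d, b)" "u' = (d', b')" by (cases u, cases u') auto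
  define a a' where "a = m div d" and "a' = m div d'"
  have ad: "a * d = m" "a' * d' = m" and bd: "b < d" "b' < d'"
    using assms(4,5) by (auto simp: u hermites_def a_def a'_def)
  have pos: "a > 0" "a' > 0" using ad assms(1) by (auto intro!: Nat.gr0I)
  have e: "g$1$1 * int a = g'$1$1 * int a'" "g$2$1 * int a = g'$2$1 * int a'"
    "g$1$1 * int b + g$1$2 * int d = g'$1$1 * int b' + g'$1$2 * int d'"
    "g$2$1 * int b + g$2$2 * int d = g'$2$1 * int b' + g'$2$2 * int d'"
    using eq by (auto simp: mat2_eq_iff hermite_def u a_def a'_def)
  have "gcd (g$1$1 * int a) (g$2$1 * int a) = int a"
    using SL2_col_coprime[OF assms(2)] by (simp add: gcd_mult_right coprime_iff_gcd_eq_1 gcd.commute)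
  moreover have "gcd (g'$1$1 * int a') (g'$2$1 * int a') = int a'"
    using SL2_col_coprime[OF assms(3)] by (simp add: gcd_mult_right coprime_iff_gcd_eq_1 gcd.commute)
  ultimately have aa: "a = a'" using e by simp
  hence dd: "d = d'" using ad pos by (metis nonzero_mult_div_cancel_left not_gr_zero)
  have g1: "g$1$1 = g'$1$1" "g$2$1 = g'$2$1" using e aa pos by auto
  have "int d dvd g$1$1 * (int b - int b')" "int d dvd g$2$1 * (int b - int b')"
    using e(3,4) g1 dd by (auto simp: algebra_simps intro: dvdI[of _ _ "g'$1$2 - g$1$2"] dvdI[of _ _ "g'$2$2 - g$2$2"])
  hence dv: "int d dvd g$2$2 * (g$1$1 * (int b - int b')) - g$1$2 * (g$2$1 * (int b - int b'))"
    by (intro dvd_diff[OF dvd_mult dvd_mult])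
  have "g$2$2 * (g$1$1 * (int b - int b')) - g$1$2 * (g$2$1 * (int b - int b'))
     = (g$1$1 * g$2$2 - g$1$2 * g$2$1) * (int b - int b')" by (simp add: algebra_simps)
  also have "\<dots> = int b - int b'" using assms(2) by (simp add: mem_SL2 det_2)
  finally have "[int b = int b'] (mod int d)" using dv by (metis cong_iff_dvd_diff)
  hence bb: "b = b'" using bd dd by (simp add: cong_int_iff cong_def)
  show "u = u'" using u dd bb by simp
  have "d > 0" using bd by simp
  hence "g$1$2 = g'$1$2" "g$2$2 = g'$2$2" using e g1 dd bb by auto
  thus "g = g'" using g1 by (simp add: mat2_eq_iff)
qed

lemma hermite_exists:
  assumes "m > 0" "det A = int m"
  shows "\<exists>g\<in>SL2. \<exists>u\<in>hermites m. A = g ** hermite m u"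
proof -
  define x y where "x = A$1$1" and "y = A$2$1"
  define a where "a = gcd x y"
  have dt: "x * A$2$2 - A$1$2 * y = int m" using assms by (simp add: det_2 x_def y_def)
  have "x \<noteq> 0 \<or> y \<noteq> 0" using dt assms by auto
  hence a0: "a > 0" by (auto simp: a_def)
  obtain p r where pr: "x = a * p" "y = a * r" by (metis a_def dvd_def gcd_dvd1 gcd_dvd2)
  obtain s t where st: "s * x + t * y = a" using bezout_int a_def by metis
  hence "a * (s * p + t * r) = a" using pr by (simp add: algebra_simps)
  hence st1: "s * p + t * r = 1" using a0 by auto
  define D where "D = p * A$2$2 - r * A$1$2"
  have aD: "a * D = int m" using dt pr by (simp add: D_def algebra_simps)
  hence D0: "D > 0" using a0 assms(1) by (metis of_nat_0_less_iff zero_less_mult_pos)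
  \<comment> \<open>Since s p + t r = 1, the matrix with rows (s, t) and (-r, p) lies in SL2(Z) and
    carries A to the triangular matrix with rows (a, \<beta>) and (0, D). A translation by k =
    \<beta> div D then reduces the corner entry modulo D.\<close>
  define \<beta> where "\<beta> = s * A$1$2 + t * A$2$2"
  define d b where "d = nat D" and "b = nat (\<beta> mod D)"
  define k where "k = \<beta> div D"
  have id: "int d = D" "int b = \<beta> mod D" using D0 by (auto simp: d_def b_def)
  have "int d dvd int m" using aD id by (metis dvd_triv_right)
  hence dm: "d dvd m" by simp
  have a: "int (m div d) = a" using aD id D0 by (metis less_irrefl nonzero_mult_div_cancel_right of_nat_div)
  moreover have "b < d" using D0 by (simp add: d_def b_def nat_less_iff)
  moreover define g where "g = mat2 p (p * k - t) r (r * k + s)"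
  have "g \<in> SL2" using st1 by (simp add: g_def mem_SL2 det_2 algebra_simps)
  moreover have "A = g ** hermite m (d, b)"
  proof -
    have bk: "\<beta> mod D + k * D = \<beta>" by (simp add: k_def)
    have "p * (\<beta> mod D) + (p * k - t) * D = p * (\<beta> mod D + k * D) - t * D" by (simp add: algebra_simps)
    also have "\<dots> = (s * p + t * r) * A$1$2" unfolding bk by (simp add: \<beta>_def D_def algebra_simps)
    finally have 1: "p * (\<beta> mod D) + (p * k - t) * D = A$1$2" using st1 by simp
    have "r * (\<beta> mod D) + (r * k + s) * D = r * (\<beta> mod D + k * D) + s * D" by (simp add: algebra_simps)
    also have "\<dots> = (s * p + t * r) * A$2$2" unfolding bk by (simp add: \<beta>_def D_def algebra_simps)
    finally have 2: "r * (\<beta> mod D) + (r * k + s) * D = A$2$2" using st1 by simp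
    show ?thesis using 1 2 a pr
      by (auto simp: mat2_eq_iff hermite_def g_def id x_def y_def mult.commute)
  qed
  ultimately show ?thesis using dm by (auto simp: hermites_def intro!: bexI[of _ g] bexI[of _ "(d,b)"])
qed

section \<open>Moebius transformations\<close>

lemma moebius_denom_nonzero:
  assumes "Im z > 0" "c \<noteq> 0 \<or> d \<noteq> (0::int)" shows "of_int c * z + of_int d \<noteq> (0::complex)"
  using assms by (auto simp: complex_eq_iff)

lemma det_pos_row_nonzero: "det A > 0 \<Longrightarrow> A$2$1 \<noteq> 0 \<or> A$2$2 \<noteq> 0" for A :: "int^2^2"
  by (auto simp: det_2)

lemma Im_moebius:
  assumes "Im z > 0" "det A > 0"
  shows "Im (moebius_map A z) = of_int (det A) * Im z / (cmod (of_int (A$2$1) * z + of_int (A$2$2)))\<^sup>2"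
  by (simp add: moebius_map_def Im_divide' det_2 cmod_power2 algebra_simps)

lemma Im_moebius_pos:
  assumes "Im z > 0" "det A > 0" shows "Im (moebius_map A z) > 0"
  using moebius_denom_nonzero[OF assms(1) det_pos_row_nonzero[OF assms(2)]] assms
  by (simp add: Im_moebius)

lemma moebius_mult:
  assumes "Im z > 0" "det A > 0" "det B > 0"
  shows "moebius_map (A ** B) z = moebius_map A (moebius_map B z)"
proof -
  define p w where "p = of_int (B$1$1) * z + of_int (B$1$2)" and "w = of_int (B$2$1) * z + of_int (B$2$2)"
  have w: "w \<noteq> 0"
    using moebius_denom_nonzero[OF assms(1) det_pos_row_nonzero[OF assms(3)]] by (simp add: w_def)
  have "moebius_map A (moebius_map B z) = (of_int (A$1$1) * (p / w) + of_int (A$1$2)) / (of_int (A$2$1) * (p / w) + of_int (A$2$2))"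
    by (simp add: moebius_map_def p_def w_def)
  also have "\<dots> = ((of_int (A$1$1) * (p / w) + of_int (A$1$2)) * w) / ((of_int (A$2$1) * (p / w) + of_int (A$2$2)) * w)"
    using w by simp
  also have "\<dots> = (of_int (A$1$1) * p + of_int (A$1$2) * w) / (of_int (A$2$1) * p + of_int (A$2$2) * w)"
    using w by (simp add: distrib_right)
  also have "\<dots> = moebius_map (A ** B) z"
    by (simp add: moebius_map_def p_def w_def algebra_simps)
  finally show ?thesis ..
qed

lemma moebius_uminus: "moebius_map (- A) z = moebius_map A z"
proof -
  have "moebius_map (- A) z = (- (of_int (A$1$1) * z + of_int (A$1$2))) / (- (of_int (A$2$1) * z + of_int (A$2$2)))"
    by (simp add: moebius_map_def)
  thus ?thesis by (simp only: minus_divide_divide moebius_map_def)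
qed

lemma moebius_translation: "moebius_map (translation w) z = z + of_int w"
  by (simp add: moebius_map_def translation_eq)

lemma moebius_hermite:
  "moebius_map (hermite m (d, b)) z = (of_nat (m div d) * z + of_nat b) / of_nat d"
  by (simp add: moebius_map_def hermite_def)

lemma moebius_one: "moebius_map (mat 1) z = z"
  by (simp add: moebius_map_def)

lemma moebius_holomorphic:
  assumes "det A > 0" shows "moebius_map A holomorphic_on upper_half_plane"
  unfolding moebius_map_def using moebius_denom_nonzero[OF _ det_pos_row_nonzero[OF assms]]
  by (intro holomorphic_intros) (auto simp: upper_half_plane_def)

text \<open>
  As long as \<open>Im z < 1/2\<close>, a translation followed by \<open>z \<mapsto> -1/z\<close> doubles the imaginary part.
\<close>

lemma SL2_reduce:
  assumes "Im z > 0" shows "\<exists>\<sigma>\<in>SL2. Im (moebius_map \<sigma> z) \<ge> 1/2"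
proof -
  have "\<exists>\<sigma>\<in>SL2. Im (moebius_map \<sigma> z) \<ge> 1/2" if "Im z * 2 ^ n \<ge> 1/2" "Im z > 0" for n :: nat and z
    using that
  proof (induction n arbitrary: z)
    case 0
    then show ?case by (intro bexI[of _ "mat 1"]) (auto simp: moebius_one)
  next
    case (Suc n)
    show ?case
    proof (cases "Im z \<ge> 1/2")
      case True
      then show ?thesis by (intro bexI[of _ "mat 1"]) (auto simp: moebius_one)
    next
      case False
      define k where "k = round (Re z)"
      define A where "A = mat2 0 (-1) 1 (- k)"
      have A: "A \<in> SL2" by (simp add: A_def mem_SL2 det_2)
      define p where "p = z - of_int k"
      have "\<bar>Re p\<bar> \<le> 1/2" using of_int_round_abs_le[of "Re z"] by (simp add: p_def k_def abs_minus_commute)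
      hence "(Re p)\<^sup>2 \<le> (1/2)\<^sup>2" by (rule abs_le_square_iff[THEN iffD1, OF order_trans]) simp
      moreover have "(Im p)\<^sup>2 < (1/2)\<^sup>2"
        using False Suc.prems(2) by (intro power_strict_mono) (auto simp: p_def)
      moreover have "(1/2)\<^sup>2 = (1/4 :: real)" by (simp add: power2_eq_square)
      ultimately have p: "(cmod p)\<^sup>2 < 1/2" unfolding cmod_power2 by linarith
      have "p \<noteq> 0" using Suc.prems(2) by (auto simp: p_def complex_eq_iff)
      hence z0: "(cmod p)\<^sup>2 > 0" by simp
      have "Im (moebius_map A z) = Im z / (cmod p)\<^sup>2"
        using A Suc.prems(2) by (subst Im_moebius) (auto simp: mem_SL2 A_def p_def)
      also have "\<dots> \<ge> Im z / (1/2)"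
        using p z0 Suc.prems(2) by (intro divide_left_mono) auto
      finally have ge: "Im (moebius_map A z) \<ge> 2 * Im z" by simp
      hence "Im (moebius_map A z) * 2 ^ n \<ge> 2 * Im z * 2 ^ n" by (intro mult_right_mono) auto
      moreover have "2 * Im z * 2 ^ n = Im z * 2 ^ Suc n" by simp
      ultimately have "Im (moebius_map A z) * 2 ^ n \<ge> 1/2" using Suc.prems(1) by linarith
      then obtain \<sigma> where s: "\<sigma> \<in> SL2" "Im (moebius_map \<sigma> (moebius_map A z)) \<ge> 1/2"
        using Suc.IH[of "moebius_map A z"] ge Suc.prems(2) by auto
      have "moebius_map (\<sigma> ** A) z = moebius_map \<sigma> (moebius_map A z)"
        using s A Suc.prems(2) by (intro moebius_mult) (auto simp: mem_SL2)
      thus ?thesis using s A by (intro bexI[of _ "\<sigma> ** A"]) (auto simp: SL2_mult)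
    qed
  qed
  moreover obtain n where "1 / (2 * Im z) < 2 ^ n" using real_arch_pow[of 2] by auto
  hence "Im z * 2 ^ n \<ge> 1/2" using assms by (simp add: field_simps)
  ultimately show ?thesis using assms by blast
qed

text \<open>If the lower left entry c is 0, the imaginary part is unchanged. Otherwise |cz + d| >=
  |c| Im z >= Im z, which leaves at most 1 / Im z. This controls the height reached by
  \<open>SL2_reduce\<close>.\<close>

lemma Im_moebius_le:
  assumes "\<sigma> \<in> SL2" "Im z > 0"
  shows "Im (moebius_map \<sigma> z) \<le> max (Im z) (1 / Im z)"
proof (cases "\<sigma>$2$1 = 0")
  case True
  hence "\<bar>\<sigma>$2$2\<bar> = 1" using assms(1) by (auto simp: mem_SL2 det_2 zmult_eq_1_iff)
  hence "cmod (of_int (\<sigma>$2$2)) = 1" by (metis norm_of_int of_int_1 of_int_abs)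
  thus ?thesis using assms True by (subst Im_moebius) (auto simp: mem_SL2)
next
  case False
  let ?w = "of_int (\<sigma>$2$1) * z + of_int (\<sigma>$2$2)"
  have "Im z = 1 * Im z" by simp
  also have "\<dots> \<le> real_of_int \<bar>\<sigma>$2$1\<bar> * Im z"
    using False assms(2) by (intro mult_right_mono) auto
  also have "\<dots> = \<bar>Im ?w\<bar>" using assms(2) by (simp add: abs_mult)
  also have "\<dots> \<le> cmod ?w" by (rule abs_Im_le_cmod)
  finally have "(Im z)\<^sup>2 \<le> (cmod ?w)\<^sup>2" using assms(2) by (intro power_mono) auto
  hence "Im z / (cmod ?w)\<^sup>2 \<le> Im z / (Im z)\<^sup>2"
    using assms(2) by (intro divide_left_mono mult_pos_pos) (auto intro: less_le_trans[of 0 "(Im z)\<^sup>2"])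
  also have "\<dots> = 1 / Im z" by (simp add: power2_eq_square)
  finally show ?thesis using assms by (subst Im_moebius) (auto simp: mem_SL2)
qed

section \<open>Hecke sums\<close>

definition row_act :: "nat \<Rightarrow> int \<times> int \<Rightarrow> int^2^2 \<Rightarrow> int \<times> int" where
  "row_act N v \<sigma> = ((fst v * \<sigma>$1$1 + snd v * \<sigma>$2$1) mod int N, (fst v * \<sigma>$1$2 + snd v * \<sigma>$2$2) mod int N)"

lemma bottom_row_mult: "bottom_row N (A ** \<sigma>) = row_act N (bottom_row N A) \<sigma>"
  unfolding row_act_def bottom_row_def by (auto intro!: mod_add_cong mod_mult_cong)

lemma row_act_eq: "v \<in> bottom_rows N \<Longrightarrow> row_act N v \<sigma> = bottom_row N (row_rep N v ** \<sigma>)"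
  using row_rep(2)[of v N] by (simp add: bottom_row_mult)

lemma row_act_mem: "v \<in> bottom_rows N \<Longrightarrow> \<sigma> \<in> SL2 \<Longrightarrow> row_act N v \<sigma> \<in> bottom_rows N"
  by (simp add: row_act_eq bottom_row_mem SL2_mult row_rep)

lemma row_act_mult:
  assumes "v \<in> bottom_rows N" shows "row_act N (row_act N v \<sigma>) \<rho> = row_act N v (\<sigma> ** \<rho>)"
  unfolding row_act_eq[OF assms] by (simp add: bottom_row_mult[symmetric] matrix_mul_assoc)

lemma row_act_one: "v \<in> bottom_rows N \<Longrightarrow> row_act N v (mat 1) = v"
  by (simp add: row_act_eq row_rep)

lemma Gamma1_adj2: "A \<in> Gamma1 N \<Longrightarrow> adj2 A \<in> Gamma1 N"
  using Gamma0_adj2[of A N] by (auto simp: Gamma1_def) (simp_all add: adj2_def)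

definition hecke_rep :: "nat \<Rightarrow> nat \<Rightarrow> (int \<times> int) \<times> (nat \<times> nat) \<Rightarrow> int^2^2" where
  "hecke_rep N m x = row_rep N (fst x) ** hermite m (snd x)"

text \<open>Pairs (row, Hermite form) label the cosets \<open>Gamma1 N\<close> A with det A = m. For
  \<sigma> = \<open>mat 1\<close> the condition is \<open>N\<close> | A_21, the index set of the
  Hecke sum; for general \<sigma> it is the index set of the same sum after z is replaced by
  \<sigma> z.\<close>

definition hecke_index :: "nat \<Rightarrow> nat \<Rightarrow> int^2^2 \<Rightarrow> ((int \<times> int) \<times> (nat \<times> nat)) set" where
  "hecke_index N m \<sigma> =
     {x \<in> bottom_rows N \<times> hermites m. int N dvd (hecke_rep N m x ** adj2 \<sigma>) $ 2 $ 1}"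

definition hecke_form :: "nat \<Rightarrow> nat \<Rightarrow> int^2^2 \<Rightarrow> (int \<times> int) \<times> (nat \<times> nat) \<Rightarrow> bool" where
  "hecke_form N m A x \<longleftrightarrow>
     (\<exists>g\<in>SL2. A = g ** hermite m (snd x) \<and> bottom_row N g = fst x \<and> snd x \<in> hermites m)"

definition hecke_class :: "nat \<Rightarrow> nat \<Rightarrow> int^2^2 \<Rightarrow> (int \<times> int) \<times> (nat \<times> nat)" where
  "hecke_class N m A = (SOME x. hecke_form N m A x)"

lemma finite_hecke_index: "N > 0 \<Longrightarrow> m > 0 \<Longrightarrow> finite (hecke_index N m \<sigma>)"
  by (rule finite_subset[of _ "bottom_rows N \<times> hermites m"])
     (auto simp: hecke_index_def finite_bottom_rows finite_hermites)

lemma hecke_class: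
  assumes "m > 0" "det A = int m"
  shows "hecke_class N m A \<in> bottom_rows N \<times> hermites m"
    "\<exists>g\<in>Gamma1 N. A = g ** hecke_rep N m (hecke_class N m A)"
proof -
  let ?x = "hecke_class N m A"
  obtain g0 u where "g0 \<in> SL2" "u \<in> hermites m" "A = g0 ** hermite m u"
    using hermite_exists[OF assms] by blast
  hence "hecke_form N m A (bottom_row N g0, u)"
    unfolding hecke_form_def by auto
  hence "hecke_form N m A ?x" unfolding hecke_class_def by (rule someI)
  then obtain g where g: "g \<in> SL2" "A = g ** hermite m (snd ?x)" "bottom_row N g = fst ?x" "snd ?x \<in> hermites m"
    unfolding hecke_form_def by blast
  have v: "fst ?x \<in> bottom_rows N" unfolding g(3)[symmetric] by (rule bottom_row_mem[OF g(1)])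
  thus "?x \<in> bottom_rows N \<times> hermites m" using g by (simp add: mem_Times_iff)
  have "g ** adj2 (row_rep N (fst ?x)) \<in> Gamma1 N"
    using g row_rep[OF v] by (intro bottom_row_eqD) auto
  moreover have "A = g ** adj2 (row_rep N (fst ?x)) ** hecke_rep N m ?x"
    unfolding hecke_rep_def matrix_mul_assoc mult_adj2_cancel[OF row_rep(1)[OF v]] by (rule g(2))
  ultimately show "\<exists>g\<in>Gamma1 N. A = g ** hecke_rep N m ?x" by blast
qed

lemma det_hecke_rep: "x \<in> bottom_rows N \<times> hermites m \<Longrightarrow> det (hecke_rep N m x) = int m"
  using row_rep(1)[of "fst x" N] det_hermite[of "snd x" m]
  by (auto simp: hecke_rep_def det_mul mem_SL2)

lemma hecke_class_rep:
  assumes "m > 0" "x \<in> bottom_rows N \<times> hermites m" "g \<in> Gamma1 N"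
  shows "hecke_class N m (g ** hecke_rep N m x) = x"
proof -
  let ?A = "g ** hecke_rep N m x"
  have g: "g \<in> SL2" using assms by (simp add: Gamma1_SL2)
  have v: "fst x \<in> bottom_rows N" "snd x \<in> hermites m" using assms by auto
  have "hecke_form N m ?A x" unfolding hecke_form_def
    using v g row_rep[OF v(1)] assms(3)
    by (intro bexI[of _ "g ** row_rep N (fst x)"])
       (auto simp: hecke_rep_def matrix_mul_assoc bottom_row_Gamma1_mult SL2_mult)
  hence "hecke_form N m ?A (hecke_class N m ?A)" unfolding hecke_class_def by (rule someI)
  then obtain h where h: "h \<in> SL2" "?A = h ** hermite m (snd (hecke_class N m ?A))"
    "bottom_row N h = fst (hecke_class N m ?A)" "snd (hecke_class N m ?A) \<in> hermites m"
    unfolding hecke_form_def by blast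
  have eq: "g ** row_rep N (fst x) ** hermite m (snd x) = h ** hermite m (snd (hecke_class N m ?A))"
    using h(2) by (simp only: hecke_rep_def matrix_mul_assoc)
  have "snd x = snd (hecke_class N m ?A)" "g ** row_rep N (fst x) = h"
    using hermite_unique[OF assms(1) SL2_mult[OF g row_rep(1)[OF v(1)]] h(1) v(2) h(4) eq] by auto
  moreover have "bottom_row N (g ** row_rep N (fst x)) = fst x"
    using row_rep[OF v(1)] assms(3) by (simp add: bottom_row_Gamma1_mult)
  ultimately show ?thesis using h(3) by (simp add: prod_eq_iff)
qed

lemma Gamma1_mult_dvd:
  fixes A :: "int^2^2"
  assumes "g \<in> Gamma1 N" shows "int N dvd (g ** A)$2$1 \<longleftrightarrow> int N dvd A$2$1"
  using bottom_row_Gamma1_mult[OF assms, of A] by (auto simp: bottom_row_def dvd_eq_mod_eq_0)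

lemma adj2_one: "adj2 (mat 1) = mat 1"
  by (simp add: adj2_def mat2_eq_iff)

lemma adj2_adj2: "adj2 (adj2 A) = A"
  by (simp add: adj2_def mat2_eq_iff)

text \<open>Right multiplication by \<sigma> permutes the cosets of determinant m, with inverse the
  action of \<sigma>^-1. The last claim moves the divisibility condition along, since (A
  \<sigma>)(\<rho> \<sigma>)^-1 = A \<rho>^-1.\<close>

lemma hecke_act:
  assumes "m > 0" "x \<in> bottom_rows N \<times> hermites m" "\<sigma> \<in> SL2"
  defines "y \<equiv> hecke_class N m (hecke_rep N m x ** \<sigma>)"
  shows "y \<in> bottom_rows N \<times> hermites m"
    "\<exists>g\<in>Gamma1 N. hecke_rep N m x ** \<sigma> = g ** hecke_rep N m y"
    "hecke_class N m (hecke_rep N m y ** adj2 \<sigma>) = x"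
    "x \<in> hecke_index N m \<rho> \<longleftrightarrow> y \<in> hecke_index N m (\<rho> ** \<sigma>)"
proof -
  have "det (hecke_rep N m x ** \<sigma>) = int m" using assms det_hecke_rep by (simp add: det_mul mem_SL2)
  note hc = hecke_class[OF assms(1) this, of N, folded y_def]
  thus y: "y \<in> bottom_rows N \<times> hermites m"
    and "\<exists>g\<in>Gamma1 N. hecke_rep N m x ** \<sigma> = g ** hecke_rep N m y" by auto
  then obtain g where g: "g \<in> Gamma1 N" "hecke_rep N m x ** \<sigma> = g ** hecke_rep N m y" by auto
  have gs: "g \<in> SL2" using g by (simp add: Gamma1_SL2)
  have eq: "hecke_rep N m y ** adj2 \<sigma> = adj2 g ** hecke_rep N m x"
  proof -
    have "adj2 g ** (hecke_rep N m x ** \<sigma>) = hecke_rep N m y"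
      unfolding g(2) by (rule mult_adj2_cancel[OF gs])
    hence "hecke_rep N m y ** adj2 \<sigma> = adj2 g ** hecke_rep N m x ** \<sigma> ** adj2 \<sigma>"
      by (simp add: matrix_mul_assoc)
    thus ?thesis by (simp add: mult_adj2_cancel assms)
  qed
  show "hecke_class N m (hecke_rep N m y ** adj2 \<sigma>) = x"
    unfolding eq using g assms by (intro hecke_class_rep Gamma1_adj2)
  have "adj2 (\<rho> ** \<sigma>) = adj2 \<sigma> ** adj2 \<rho>" by (simp add: adj2_def mat2_eq_iff algebra_simps)
  hence "hecke_rep N m y ** adj2 (\<rho> ** \<sigma>) = adj2 g ** (hecke_rep N m x ** adj2 \<rho>)"
    using eq by (simp add: matrix_mul_assoc)
  thus "x \<in> hecke_index N m \<rho> \<longleftrightarrow> y \<in> hecke_index N m (\<rho> ** \<sigma>)"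
    using y assms(2) Gamma1_mult_dvd[OF Gamma1_adj2[OF g(1)]]
    by (simp add: hecke_index_def del: mat2_mult_nth)
qed

text \<open>Separate from the Hauptmodul, because Liouville's theorem is applied to the difference
  of a Hecke sum and a polynomial in f.\<close>

locale Gamma0_function =
  fixes N :: nat and f :: "complex \<Rightarrow> complex"
  assumes N: "N > 0"
    and invariant: "\<gamma> \<in> Gamma0 N \<Longrightarrow> Im z > 0 \<Longrightarrow> f (moebius_map \<gamma> z) = f z"
begin

definition row_fun :: "int \<times> int \<Rightarrow> complex \<Rightarrow> complex" where
  "row_fun v = slash f (row_rep N v)"

text \<open>Two matrices with the same row differ by a left factor in \<open>Gamma1 N\<close>, hence
  in \<open>Gamma0 N\<close>, under which f is invariant.\<close>

lemma slash_eq_row_fun: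
  assumes "A \<in> SL2" "Im z > 0" shows "slash f A z = row_fun (bottom_row N A) z"
proof -
  let ?B = "row_rep N (bottom_row N A)"
  have B: "?B \<in> SL2" "bottom_row N ?B = bottom_row N A"
    using row_rep[OF bottom_row_mem[OF assms(1)]] by auto
  have g: "A ** adj2 ?B \<in> Gamma0 N" using bottom_row_eqD[of ?B A N] B assms by (auto intro: Gamma1_Gamma0)
  have "moebius_map A z = moebius_map (A ** adj2 ?B) (moebius_map ?B z)"
    using assms(2) B(1) Gamma0_SL2[OF g]
    by (subst moebius_mult[symmetric]) (simp_all add: mult_adj2_cancel[OF B(1)], simp_all add: mem_SL2)
  thus ?thesis unfolding row_fun_def slash_def
    using invariant[OF g Im_moebius_pos[OF assms(2)]] B by (simp add: mem_SL2)
qed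

lemma row_fun_moebius:
  assumes "v \<in> bottom_rows N" "\<sigma> \<in> SL2" "Im z > 0"
  shows "row_fun v (moebius_map \<sigma> z) = row_fun (row_act N v \<sigma>) z"
proof -
  have "row_fun v (moebius_map \<sigma> z) = slash f (row_rep N v ** \<sigma>) z"
    unfolding row_fun_def slash_def using assms row_rep(1)[OF assms(1)]
    by (subst moebius_mult) (simp_all add: mem_SL2)
  also have "\<dots> = row_fun (bottom_row N (row_rep N v ** \<sigma>)) z"
    using assms row_rep[OF assms(1)] by (intro slash_eq_row_fun) (auto simp: SL2_mult)
  also have "bottom_row N (row_rep N v ** \<sigma>) = row_act N v \<sigma>"
    using row_rep[OF assms(1)] by (simp add: bottom_row_mult)
  finally show ?thesis .
qed

definition hecke_term :: "nat \<Rightarrow> complex \<Rightarrow> (int \<times> int) \<times> (nat \<times> nat) \<Rightarrow> complex" where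
  "hecke_term m z x = row_fun (fst x) (moebius_map (hermite m (snd x)) z)"

definition hecke :: "nat \<Rightarrow> complex \<Rightarrow> complex" where
  "hecke m z = (\<Sum>x\<in>hecke_index N m (mat 1). hecke_term m z x)"

lemma hecke_term_eq:
  assumes "x \<in> bottom_rows N \<times> hermites m" "m > 0" "Im z > 0"
  shows "hecke_term m z x = f (moebius_map (hecke_rep N m x) z)"
proof -
  have "det (row_rep N (fst x)) > 0" "det (hermite m (snd x)) > 0"
    using assms row_rep[of "fst x" N] det_hermite[of "snd x" m] by (auto simp: mem_SL2)
  thus ?thesis unfolding hecke_term_def row_fun_def slash_def hecke_rep_def
    using assms(3) by (simp add: moebius_mult)
qed

lemma hecke_moebius:
  assumes "m > 0" "\<sigma> \<in> SL2" "Im z > 0"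
  shows "hecke m (moebius_map \<sigma> z) = (\<Sum>x\<in>hecke_index N m \<sigma>. hecke_term m z x)"
  unfolding hecke_def
proof (rule sum.reindex_bij_witness[of _ "\<lambda>y. hecke_class N m (hecke_rep N m y ** adj2 \<sigma>)"
      "\<lambda>x. hecke_class N m (hecke_rep N m x ** \<sigma>)"])
  fix x assume x: "x \<in> hecke_index N m (mat 1)"
  hence x': "x \<in> bottom_rows N \<times> hermites m" by (simp add: hecke_index_def)
  obtain y where y: "hecke_class N m (hecke_rep N m x ** \<sigma>) = y" by blast
  note act = hecke_act[OF assms(1) x' assms(2), unfolded y]
  show "hecke_class N m (hecke_rep N m (hecke_class N m (hecke_rep N m x ** \<sigma>)) ** adj2 \<sigma>) = x"
    unfolding y by (rule act(3))
  show "hecke_class N m (hecke_rep N m x ** \<sigma>) \<in> hecke_index N m \<sigma>"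
    unfolding y using act(4)[of "mat 1"] x by simp
  obtain g where g: "g \<in> Gamma1 N" "hecke_rep N m x ** \<sigma> = g ** hecke_rep N m y" using act(2) by blast
  have tau': "Im (moebius_map \<sigma> z) > 0"
    using assms(2,3) by (intro Im_moebius_pos) (auto simp: mem_SL2)
  have dets: "det \<sigma> > 0" "det (hecke_rep N m x) > 0" "det (hecke_rep N m y) > 0" "det g > 0"
    using assms(1,2) det_hecke_rep[OF x'] det_hecke_rep[OF act(1)] Gamma1_SL2[OF g(1)]
    by (auto simp: mem_SL2)
  have "hecke_term m (moebius_map \<sigma> z) x = f (moebius_map (hecke_rep N m x) (moebius_map \<sigma> z))"
    by (rule hecke_term_eq[OF x' assms(1) tau'])
  also have "\<dots> = f (moebius_map (hecke_rep N m x ** \<sigma>) z)"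
    using moebius_mult[OF assms(3) dets(2,1)] by simp
  also have "\<dots> = f (moebius_map g (moebius_map (hecke_rep N m y) z))"
    unfolding g(2) using moebius_mult[OF assms(3) dets(4,3)] by simp
  also have "\<dots> = f (moebius_map (hecke_rep N m y) z)"
    by (rule invariant[OF Gamma1_Gamma0[OF g(1)] Im_moebius_pos[OF assms(3) dets(3)]])
  finally show "hecke_term m z (hecke_class N m (hecke_rep N m x ** \<sigma>)) = hecke_term m (moebius_map \<sigma> z) x"
    unfolding y using hecke_term_eq[OF act(1) assms(1,3)] by simp
next
  fix x assume x: "x \<in> hecke_index N m \<sigma>"
  hence x': "x \<in> bottom_rows N \<times> hermites m" by (simp add: hecke_index_def)
  note act = hecke_act[OF assms(1) x' SL2_adj2[OF assms(2)]]
  show "hecke_class N m (hecke_rep N m (hecke_class N m (hecke_rep N m x ** adj2 \<sigma>)) ** \<sigma>) = x"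
    using act(3) by (simp add: adj2_adj2)
  show "hecke_class N m (hecke_rep N m x ** adj2 \<sigma>) \<in> hecke_index N m (mat 1)"
    using act(4)[of \<sigma>] x adj2_inverse[OF assms(2)] by simp
qed

text \<open>The lower left entry of A \<sigma>^-1 is A_21 \<sigma>_22 - A_22 \<sigma>_21. For
  \<sigma> in \<open>Gamma0 N\<close> the second term is divisible by \<open>N\<close> and
  \<sigma>_22 is prime to \<open>N\<close>, so the index set for \<sigma> is the one for
  \<open>mat 1\<close>.\<close>

lemma hecke_invariant:
  assumes "m > 0" "\<sigma> \<in> Gamma0 N" "Im z > 0"
  shows "hecke m (moebius_map \<sigma> z) = hecke m z"
proof -
  have s: "\<sigma> \<in> SL2" "int N dvd \<sigma>$2$1" using assms by (auto simp: Gamma0_def)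
  have "coprime (\<sigma>$2$2) (int N)"
    using coprime_divisors[OF s(2) dvd_refl SL2_row_coprime[OF s(1)]] by (simp add: coprime_commute)
  have "int N dvd (A ** adj2 \<sigma>)$2$1 \<longleftrightarrow> int N dvd A$2$1" for A :: "int^2^2"
  proof -
    have "(A ** adj2 \<sigma>)$2$1 = A$2$1 * \<sigma>$2$2 - A$2$2 * \<sigma>$2$1" by (simp add: adj2_def)
    moreover have "int N dvd A$2$2 * \<sigma>$2$1" using s(2) by simp
    ultimately have "int N dvd (A ** adj2 \<sigma>)$2$1 \<longleftrightarrow> int N dvd A$2$1 * \<sigma>$2$2"
      by (metis diff_add_cancel dvd_add_left_iff)
    thus ?thesis using \<open>coprime (\<sigma>$2$2) (int N)\<close> by (simp add: coprime_dvd_mult_left_iff coprime_commute)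
  qed
  hence "hecke_index N m \<sigma> = hecke_index N m (mat 1)"
    unfolding hecke_index_def using adj2_one by (simp add: matrix_mul_rid)
  thus ?thesis using hecke_moebius[OF assms(1) s(1) assms(3)] by (simp add: hecke_def)
qed

end

section \<open>Expansions of periodic functions\<close>

definition qexp :: "nat \<Rightarrow> complex \<Rightarrow> complex" where
  "qexp h z = exp (2 * of_real pi * \<i> * z / of_nat h)"

lemma qexp_nonzero [simp]: "qexp h z \<noteq> 0"
  by (simp add: qexp_def)

lemma norm_qexp: "norm (qexp h z) = exp (- (2 * pi * Im z / real h))"
proof -
  have "2 * of_real pi * \<i> * z / of_nat h = of_real (2 * pi / real h) * (\<i> * z)" by simp
  hence "Re (2 * of_real pi * \<i> * z / of_nat h) = (2 * pi / real h) * Re (\<i> * z)"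
    by (metis Re_complex_of_real Im_complex_of_real complex.sel(1) mult.commute mult_zero_left diff_zero times_complex.sel(1))
  thus ?thesis by (simp add: qexp_def norm_exp_eq_Re)
qed

lemma qexp_log: "h > 0 \<Longrightarrow> qexp h (of_nat h / (2 * of_real pi * \<i>) * l) = exp l"
  by (simp add: qexp_def)

lemma norm_qexp_less_1_iff: "h > 0 \<Longrightarrow> norm (qexp h z) < 1 \<longleftrightarrow> Im z > 0"
  by (simp add: norm_qexp zero_less_divide_iff zero_less_mult_iff)

lemma qexp_holomorphic [holomorphic_intros]: "g holomorphic_on A \<Longrightarrow> (\<lambda>z. qexp h (g z)) holomorphic_on A"
  unfolding qexp_def by (intro holomorphic_intros) (auto simp: divide_inverse)

lemma qexp_add: "qexp h (z + w) = qexp h z * qexp h w"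
  by (simp add: qexp_def exp_add[symmetric] add_divide_distrib ring_distribs)

lemma qexp_period: "h > 0 \<Longrightarrow> qexp h (of_nat h * of_int k) = 1"
  by (simp add: qexp_def exp_eq_1)

lemma qexp_surj:
  assumes "h > 0" "w \<noteq> 0" "norm w < 1" obtains z where "Im z > 0" "w = qexp h z"
proof
  let ?t = "of_nat h / (2 * of_real pi * \<i>) * Ln w"
  show "w = qexp h ?t" using assms by (simp only: qexp_log) simp
  thus "Im ?t > 0" using assms(3) norm_qexp_less_1_iff[OF assms(1)] by metis
qed

lemma periodic_int:
  assumes per: "\<And>z. Im z > 0 \<Longrightarrow> g (z + of_nat h) = g z" and "Im z > 0"
  shows "g (z + of_nat h * of_int k) = g z"
proof -
  have *: "g (z + of_nat h * of_nat n) = g z" if "Im z > 0" for n :: nat and z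
  proof (induction n)
    case (Suc n)
    have "g (z + of_nat h * of_nat n + of_nat h) = g (z + of_nat h * of_nat n)"
      using that by (intro per) simp
    with Suc show ?case by (simp add: algebra_simps)
  qed auto
  show ?thesis
  proof (cases "k \<ge> 0")
    case True
    then show ?thesis using *[OF assms(2), of "nat k"] by simp
  next
    case False
    then show ?thesis using *[of "z + of_nat h * of_int k" "nat (- k)"] assms(2) by simp
  qed
qed

text \<open>Two logarithms of w differ by a multiple of 2 pi i, which becomes a multiple of the
  period h. Hence any branch may replace the principal one.\<close>

lemma cusp_chart_log:
  assumes "h > 0" "\<And>z. Im z > 0 \<Longrightarrow> g (z + of_nat h) = g z" "exp l = w" "norm w < 1"
  shows "cusp_chart h g w = g (of_nat h / (2 * of_real pi * \<i>) * l)"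
proof -
  have "exp l = exp (Ln w)" using assms(3) by auto
  then obtain n :: int where n: "Ln w = l + of_int (2 * n) * pi * \<i>" unfolding exp_eq by (metis add_diff_cancel diff_add_cancel exp_eq \<open>exp l = exp (Ln w)\<close>)
  let ?t = "of_nat h / (2 * of_real pi * \<i>) * l"
  have "norm (qexp h ?t) < 1" using assms(3,4) by (simp only: qexp_log[OF assms(1)])
  hence "Im ?t > 0" by (simp only: norm_qexp_less_1_iff[OF assms(1)])
  hence "g (?t + of_nat h * of_int n) = g ?t" using assms(2) by (intro periodic_int) auto
  moreover have "?t + of_nat h * of_int n = of_nat h / (2 * of_real pi * \<i>) * Ln w"
    unfolding n by (simp add: field_simps)
  ultimately show ?thesis by (simp add: cusp_chart_def)
qed

lemma cusp_chart_qexp: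
  assumes "h > 0" "\<And>z. Im z > 0 \<Longrightarrow> g (z + of_nat h) = g z" "Im z > 0"
  shows "cusp_chart h g (qexp h z) = g z"
proof -
  have "cusp_chart h g (qexp h z) = g (of_nat h / (2 * of_real pi * \<i>) * (2 * of_real pi * \<i> * z / of_nat h))"
    using assms norm_qexp_less_1_iff by (intro cusp_chart_log) (auto simp: qexp_def)
  thus ?thesis using assms(1) by simp
qed

lemma cusp_chart_holomorphic_branch:
  assumes h: "h > 0" and per: "\<And>z. Im z > 0 \<Longrightarrow> g (z + of_nat h) = g z" and g: "g holomorphic_on upper_half_plane"
    and L: "L holomorphic_on A" "\<And>w. w \<in> A \<Longrightarrow> exp (L w) = w" "A \<subseteq> ball 0 1"
  shows "cusp_chart h g holomorphic_on A"
proof -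
  let ?t = "\<lambda>w. of_nat h / (2 * of_real pi * \<i>) * L w"
  have "?t ` A \<subseteq> upper_half_plane"
  proof clarify
    fix w assume w: "w \<in> A"
    hence "norm (qexp h (?t w)) < 1" using L(2)[OF w] L(3) by (auto simp: qexp_log[OF h] simp del: times_divide_eq_left)
    thus "?t w \<in> upper_half_plane" by (simp only: norm_qexp_less_1_iff[OF h] upper_half_plane_def mem_Collect_eq)
  qed
  hence "(\<lambda>w. g (?t w)) holomorphic_on A"
    by (intro holomorphic_on_compose_gen[OF _ g, unfolded o_def] holomorphic_intros L(1)) auto
  also have "?this \<longleftrightarrow> ?thesis"
    using L by (intro holomorphic_cong refl cusp_chart_log[where g = g, OF h per, symmetric]) auto
  finally show ?thesis .
qed

text \<open>\<open>Ln\<close> jumps across the negative axis. A second branch with its cut along the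
  positive axis is available by periodicity, and the two slit discs cover the punctured
  disc.\<close>

lemma cusp_chart_holomorphic:
  assumes "h > 0" "\<And>z. Im z > 0 \<Longrightarrow> g (z + of_nat h) = g z" "g holomorphic_on upper_half_plane"
  shows "cusp_chart h g holomorphic_on ball 0 1 - {0}"
proof -
  have 1: "cusp_chart h g holomorphic_on ball 0 1 - \<real>\<^sub>\<le>\<^sub>0"
  proof (rule cusp_chart_holomorphic_branch[OF assms, of Ln])
    fix w :: complex assume "w \<in> ball 0 1 - \<real>\<^sub>\<le>\<^sub>0"
    hence "w \<noteq> 0" by auto
    thus "exp (Ln w) = w" by simp
  qed (auto intro!: holomorphic_intros)
  have 2: "cusp_chart h g holomorphic_on ball 0 1 - \<real>\<^sub>\<ge>\<^sub>0"
  proof (rule cusp_chart_holomorphic_branch[OF assms, of "\<lambda>w. Ln (- w) + of_real pi * \<i>"])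
    fix w :: complex assume "w \<in> ball 0 1 - \<real>\<^sub>\<ge>\<^sub>0"
    hence "w \<noteq> 0" by auto
    thus "exp (Ln (- w) + of_real pi * \<i>) = w" by (simp add: exp_add)
  qed (auto intro!: holomorphic_intros simp: complex_nonpos_Reals_iff complex_nonneg_Reals_iff)
  have "cusp_chart h g holomorphic_on (ball 0 1 - \<real>\<^sub>\<le>\<^sub>0) \<union> (ball 0 1 - \<real>\<^sub>\<ge>\<^sub>0)"
    using 1 2 by (intro holomorphic_on_Un) (auto intro!: open_Diff)
  also have "(ball 0 1 - \<real>\<^sub>\<le>\<^sub>0) \<union> (ball 0 1 - \<real>\<^sub>\<ge>\<^sub>0) = ball 0 1 - {0::complex}"
    by (auto simp: complex_nonpos_Reals_iff complex_nonneg_Reals_iff complex_eq_iff)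
  finally show ?thesis .
qed

abbreviation at_cusp :: "complex filter" where "at_cusp \<equiv> filtercomap Im at_top"

text \<open>Only nonnegative powers of q^(1/h), with convergence on the whole half plane. A function
  with a pole at the cusp is entered after subtracting its polar part or multiplying by a power of
  the variable.\<close>

definition q_series :: "nat \<Rightarrow> (nat \<Rightarrow> complex) \<Rightarrow> (complex \<Rightarrow> complex) \<Rightarrow> bool" where
  "q_series h B g \<longleftrightarrow> (\<forall>z. Im z > 0 \<longrightarrow> (\<lambda>n. B n * qexp h z ^ n) sums g z)"

lemma q_seriesI:
  "(\<And>z. Im z > 0 \<Longrightarrow> (\<lambda>n. B n * qexp h z ^ n) sums g z) \<Longrightarrow> q_series h B g"
  by (simp add: q_series_def)

definition bounded_at_cusp :: "(complex \<Rightarrow> complex) \<Rightarrow> bool" where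
  "bounded_at_cusp g \<longleftrightarrow> (\<exists>K Y. \<forall>z. Im z > Y \<longrightarrow> norm (g z) \<le> K)"

text \<open>Boundedness makes the centre of the punctured disc a removable singularity, and the
  Taylor series of the extension converges in the full unit disc.\<close>

lemma q_series_exists:
  assumes h: "h > 0" and per: "\<And>z. Im z > 0 \<Longrightarrow> g (z + of_nat h) = g z"
    and hol: "g holomorphic_on upper_half_plane" and bd: "bounded_at_cusp g"
  shows "\<exists>B. q_series h B g"
proof -
  obtain K Y where KY: "\<And>z. Im z > Y \<Longrightarrow> norm (g z) \<le> K" using bd by (auto simp: bounded_at_cusp_def)
  define r where "r = min 1 (exp (- (2 * pi * Y / real h)))"
  have "norm (cusp_chart h g w) \<le> K" if w: "w \<noteq> 0" "norm w < r" for w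
  proof -
    obtain z where t: "Im z > 0" "w = qexp h z" using qexp_surj[OF h w(1)] w(2) by (auto simp: r_def)
    have "exp (- (2 * pi * Im z / real h)) < exp (- (2 * pi * Y / real h))"
      using w(2) t by (simp add: norm_qexp r_def)
    hence "Im z > Y" using h by (simp add: divide_less_cancel)
    thus ?thesis using KY cusp_chart_qexp[where g = g, OF h per t(1)] t by simp
  qed
  hence "eventually (\<lambda>w. norm (cusp_chart h g w) \<le> K) (at 0)"
    unfolding eventually_at by (intro exI[of _ r]) (auto simp: r_def)
  moreover have "cusp_chart h g holomorphic_on ball 0 1 - {0}"
    using cusp_chart_holomorphic[OF h per hol] .
  ultimately obtain G where G: "G holomorphic_on ball 0 1" "\<forall>z\<in>ball 0 1 - {0}. G z = cusp_chart h g z"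
    using holomorphic_on_extend_bounded[of "cusp_chart h g" "ball 0 1" 0] by auto
  have "q_series h (\<lambda>n. (deriv ^^ n) G 0 / fact n) g"
  proof (rule q_seriesI)
    fix z :: complex assume t: "Im z > 0"
    have q: "qexp h z \<in> ball 0 1" using norm_qexp_less_1_iff[OF h] t by simp
    have "g z = G (qexp h z)" using G(2) q cusp_chart_qexp[where g = g, OF h per t] by auto
    thus "(\<lambda>n. (deriv ^^ n) G 0 / fact n * qexp h z ^ n) sums g z"
      using holomorphic_power_series[OF G(1) q] by simp
  qed
  thus ?thesis by blast
qed

lemma q_series_disc:
  assumes h: "h > 0" and ser: "q_series h B g"
  obtains G where "G holomorphic_on ball 0 1" "\<And>w. norm w < 1 \<Longrightarrow> (\<lambda>n. B n * w ^ n) sums G w"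
    "\<And>z. Im z > 0 \<Longrightarrow> g z = G (qexp h z)" "G has_fps_expansion Abs_fps B" "G 0 = B 0"
proof -
  define G where "G w = suminf (\<lambda>n. B n * w ^ n)" for w
  have sums: "(\<lambda>n. B n * w ^ n) sums G w" if w1: "norm w < 1" for w
  proof (cases "w = 0")
    case True
    thus ?thesis unfolding G_def by (simp add: summable_sums)
  next
    case False
    then obtain z where t: "Im z > 0" "w = qexp h z" using qexp_surj[OF h False w1] by metis
    hence "(\<lambda>n. B n * w ^ n) sums g z" using ser unfolding q_series_def by blast
    thus ?thesis unfolding G_def by (simp add: sums_iff)
  qed
  show thesis
  proof (rule that)
    show "G holomorphic_on ball 0 1"
      by (rule power_series_holomorphic[where a = B]) (use sums in auto)
    show "(\<lambda>n. B n * w ^ n) sums G w" if "norm w < 1" for w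
      using that by (rule sums)
    show "g z = G (qexp h z)" if "Im z > 0" for z
    proof (rule sums_unique2)
      show "(\<lambda>n. B n * qexp h z ^ n) sums g z" using ser that by (simp add: q_series_def)
    qed (use sums norm_qexp_less_1_iff[OF h] that in blast)
    have "eventually (\<lambda>u. u \<in> ball 0 1) (nhds (0 :: complex))"
      by (intro eventually_nhds_in_open) auto
    thus "G has_fps_expansion Abs_fps B"
      by (intro has_fps_expansionI) (auto elim!: eventually_mono intro: sums)
    show "G 0 = B 0"
      by (rule sums_unique2[OF sums powser_sums_zero]) simp
  qed
qed

text \<open>Convergence at height y/2 forces absolute convergence at height y, and the sum of
  absolute values there dominates the series at all greater heights.\<close>

lemma q_series_bounded:
  assumes h: "h > 0" and ser: "q_series h B g" and y: "y > 0"
  shows "\<exists>K. \<forall>z. Im z \<ge> y \<longrightarrow> norm (g z) \<le> K"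
proof -
  define r where "r = qexp h (\<i> * of_real y)"
  have r: "norm r < norm (qexp h (\<i> * of_real (y / 2)))"
    unfolding r_def norm_qexp using h y by (simp add: field_simps)
  have "summable (\<lambda>n. B n * qexp h (\<i> * of_real (y / 2)) ^ n)"
    using ser y unfolding q_series_def sums_iff by simp
  hence sm: "summable (\<lambda>n. norm (B n * r ^ n))" using r by (rule powser_insidea)
  have "norm (g z) \<le> suminf (\<lambda>n. norm (B n * r ^ n))" if t: "Im z \<ge> y" for z
  proof -
    have le: "norm (B n * qexp h z ^ n) \<le> norm (B n * r ^ n)" for n
      unfolding norm_mult norm_power r_def norm_qexp using t h
      by (intro mult_left_mono power_mono) (auto simp: divide_simps)
    have sm': "summable (\<lambda>n. norm (B n * qexp h z ^ n))"
      by (rule summable_comparison_test'[OF sm, of 0]) (use le in simp)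
    have "g z = suminf (\<lambda>n. B n * qexp h z ^ n)"
      using ser t y unfolding q_series_def by (intro sums_unique) auto
    also have "norm \<dots> \<le> suminf (\<lambda>n. norm (B n * qexp h z ^ n))"
      by (rule summable_norm[OF sm'])
    also have "\<dots> \<le> suminf (\<lambda>n. norm (B n * r ^ n))"
      by (rule suminf_le[OF le sm' sm])
    finally show ?thesis .
  qed
  thus ?thesis by blast
qed

lemma q_series_tendsto:
  assumes h: "h > 0" and ser: "q_series h B g"
  shows "(g \<longlongrightarrow> B 0) at_cusp"
proof -
  obtain G where G: "\<And>z. Im z > 0 \<Longrightarrow> g z = G (qexp h z)" "G 0 = B 0" "G holomorphic_on ball 0 1"
    using q_series_disc[OF h ser] by metis
  have "isCont G 0" using holomorphic_on_imp_continuous_on[OF G(3)]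
    by (simp add: continuous_on_eq_continuous_at)
  moreover have "((\<lambda>z. norm (qexp h z)) \<longlongrightarrow> 0) at_cusp"
  proof -
    have "((\<lambda>y. exp (- (2 * pi * y / real h))) \<longlongrightarrow> 0) at_top" using h by real_asymp
    thus ?thesis unfolding norm_qexp by (rule filterlim_compose) (rule filterlim_filtercomap)
  qed
  hence "(qexp h \<longlongrightarrow> 0) at_cusp" by (simp add: tendsto_norm_zero_iff)
  ultimately have "((\<lambda>z. G (qexp h z)) \<longlongrightarrow> B 0) at_cusp"
    using G(2) isCont_tendsto_compose by metis
  moreover have "eventually (\<lambda>z. Im z > 0) at_cusp"
    unfolding eventually_filtercomap using eventually_gt_at_top by blast
  hence "eventually (\<lambda>z. G (qexp h z) = g z) at_cusp"
    by eventually_elim (simp add: G(1))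
  ultimately show ?thesis by (rule Lim_transform_eventually)
qed

text \<open>Cauchy's inequality on the circle of radius exp(-2 pi y / h), the image of the line Im z
  = y.\<close>

lemma q_series_coeff_bound:
  assumes h: "h > 0" and ser: "q_series h B g" and y: "y > 0"
    and K: "\<And>z. Im z = y \<Longrightarrow> norm (g z) \<le> K"
  shows "norm (B n) \<le> K * exp (2 * pi * real n * y / real h)"
proof -
  obtain G where G: "\<And>z. Im z > 0 \<Longrightarrow> g z = G (qexp h z)" "G has_fps_expansion Abs_fps B" "G holomorphic_on ball 0 1"
    using q_series_disc[OF h ser] by metis
  define r where "r = exp (- (2 * pi * y / real h))"
  have r: "r > 0" "r < 1" using h y by (auto simp: r_def)
  have "norm ((deriv ^^ n) G 0) \<le> fact n * K / r ^ n"
  proof (rule Cauchy_inequality)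
    show "G holomorphic_on ball 0 r" using r by (intro holomorphic_on_subset[OF G(3)]) auto
    show "continuous_on (cball 0 r) G"
      using r by (intro continuous_on_subset[OF holomorphic_on_imp_continuous_on[OF G(3)]]) auto
    fix w :: complex assume w: "norm (0 - w) = r"
    hence "w \<noteq> 0" "norm w < 1" using r by auto
    then obtain z where t: "Im z > 0" "w = qexp h z" using qexp_surj[OF h] by metis
    have "exp (- (2 * pi * Im z / real h)) = exp (- (2 * pi * y / real h))"
      using w t by (simp add: norm_qexp r_def)
    hence "Im z = y" using h by simp
    thus "norm (G w) \<le> K" using K[of z] G(1)[OF t(1)] t by simp
  qed (use r in auto)
  moreover have "B n = (deriv ^^ n) G 0 / fact n"
    using fps_nth_fps_expansion[OF G(2), of n] by simp
  ultimately have "norm (B n) \<le> (fact n * K / r ^ n) / fact n"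
    by (simp only: norm_divide norm_fact divide_right_mono fact_ge_zero)
  hence "norm (B n) \<le> K / r ^ n" by simp
  also have "K / r ^ n = K * exp (2 * pi * real n * y / real h)"
    by (simp add: r_def exp_minus exp_of_nat_mult[symmetric] field_simps)
  finally show ?thesis .
qed

text \<open>Bridge from \<open>laurent_expansion\<close> to explicit series: by uniqueness of
  Laurent expansions, removing the factor q^(k/h) shifts the index by k.\<close>

lemma q_expansion_nth:
  assumes h: "h > 0" and ser: "q_series h B (\<lambda>z. g z * qexp h z ^ k)"
  shows "fls_nth (q_expansion h g) n = (if n + int k \<ge> 0 then B (nat (n + int k)) else 0)"
proof -
  obtain G where G: "\<And>z. Im z > 0 \<Longrightarrow> g z * qexp h z ^ k = G (qexp h z)" "G has_fps_expansion Abs_fps B"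
    using q_series_disc[OF h ser] by metis
  have g: "g z = G (qexp h z) / qexp h z ^ k" if "Im z > 0" for z
    using G(1)[OF that] by (simp add: field_simps)
  have per: "g (z + of_nat h) = g z" if "Im z > 0" for z
    using that g[of "z + of_nat h"] g[of z] qexp_period[OF h, of 1] by (simp add: qexp_add)
  have "(\<lambda>w. G w * w powi (- int k)) has_laurent_expansion fls_shift (int k) (fps_to_fls (Abs_fps B))"
    using has_laurent_expansion_shift[OF has_laurent_expansion_fps[OF G(2)], of "- int k"] by simp
  also have "?this \<longleftrightarrow> cusp_chart h g has_laurent_expansion fls_shift (int k) (fps_to_fls (Abs_fps B))"
  proof (intro has_laurent_expansion_cong refl)
    have "eventually (\<lambda>u. u \<in> ball 0 1 - {0}) (at (0 :: complex))"
      by (intro eventually_at_in_open) auto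
    thus "eventually (\<lambda>w. G w * w powi (- int k) = cusp_chart h g w) (at 0)"
    proof eventually_elim
      case (elim w)
      then obtain z where t: "Im z > 0" "w = qexp h z" using qexp_surj[OF h, of w] by auto
      thus ?case using cusp_chart_qexp[where g = g, OF h per t(1)] g[OF t(1)]
        by (simp add: power_int_minus divide_inverse)
    qed
  qed
  finally have "q_expansion h g = fls_shift (int k) (fps_to_fls (Abs_fps B))"
    unfolding q_expansion_def by (rule laurent_expansion_0_eqI)
  thus ?thesis by simp
qed

lemma q_series_unique:
  assumes "h > 0" "q_series h B g" "q_series h B' g" shows "B = B'"
proof
  fix n
  show "B n = B' n"
    using q_expansion_nth[of h B g 0 "int n"] q_expansion_nth[of h B' g 0 "int n"] assms by simp
qed

lemma tendsto_at_0_bounded: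
  fixes f :: "complex \<Rightarrow> complex"
  assumes "f \<midarrow>0\<rightarrow> L"
  obtains K r where "r > 0" "\<And>w. w \<noteq> 0 \<Longrightarrow> norm w < r \<Longrightarrow> norm (f w) \<le> K"
proof -
  have "eventually (\<lambda>w. dist (f w) L < 1) (at 0)" using assms by (rule tendstoD) simp
  then obtain r where r: "r > 0" "\<And>w. w \<noteq> 0 \<Longrightarrow> norm w < r \<Longrightarrow> dist (f w) L < 1"
    unfolding eventually_at by (auto simp: dist_norm)
  have "norm (f w) \<le> norm L + 1" if "w \<noteq> 0" "norm w < r" for w
    using r(2)[OF that] norm_triangle_ineq2[of "f w" L] by (simp add: dist_norm)
  thus thesis using r(1) that by blast
qed

lemma norm_qexp_less:
  assumes "h > 0" "r > 0" "Im z > - (real h / (2 * pi) * ln r)" shows "norm (qexp h z) < r"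
proof -
  have "- (2 * pi * Im z / real h) < ln r" using assms by (simp add: field_simps)
  thus ?thesis using assms(2) by (metis norm_qexp exp_less_cancel_iff exp_ln)
qed

lemma q_expansion_nonneg_bounded:
  assumes h: "h > 0" and per: "\<And>z. Im z > 0 \<Longrightarrow> g (z + of_nat h) = g z"
    and mero: "cusp_chart h g meromorphic_on {0}" and nth: "\<And>n. n < 0 \<Longrightarrow> fls_nth (q_expansion h g) n = 0"
  shows "bounded_at_cusp g"
proof -
  have "cusp_chart h g has_laurent_expansion q_expansion h g"
    using mero by (simp add: meromorphic_on_def' q_expansion_def)
  moreover have "fls_subdegree (q_expansion h g) \<ge> 0"
    using nth by (cases "q_expansion h g = 0") (auto intro: fls_subdegree_geI)
  ultimately have lim: "cusp_chart h g \<midarrow>0\<rightarrow> fls_nth (q_expansion h g) 0"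
    by (rule has_laurent_expansion_imp_tendsto_0)
  obtain K r where K: "r > 0" "\<And>w. w \<noteq> 0 \<Longrightarrow> norm w < r \<Longrightarrow> norm (cusp_chart h g w) \<le> K"
    using tendsto_at_0_bounded[OF lim] by metis
  show ?thesis unfolding bounded_at_cusp_def
  proof (intro exI allI impI)
    fix z :: complex assume t: "Im z > max 0 (- (real h / (2 * pi) * ln r))"
    have "norm (qexp h z) < r" using t by (intro norm_qexp_less h K(1)) simp
    thus "norm (g z) \<le> K" using K(2)[of "qexp h z"] cusp_chart_qexp[where g = g, OF h per] t by auto
  qed
qed

text \<open>The pole order in q^(1/h) is finite, so (q^(1/h))^(hk) = q^k removes it for large k. An
  integral power of q is taken so that the product keeps period 1 when g has it.\<close>

lemma cusp_chart_meromorphic_bound: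
  assumes h: "h > 0" and per: "\<And>z. Im z > 0 \<Longrightarrow> g (z + of_nat h) = g z"
    and mero: "cusp_chart h g meromorphic_on {0}"
  shows "\<exists>k. bounded_at_cusp (\<lambda>z. g z * qexp 1 z ^ k)"
proof -
  define F where "F = laurent_expansion (cusp_chart h g) 0"
  define k where "k = nat (- fls_subdegree F)"
  have "cusp_chart h g has_laurent_expansion F"
    using mero by (simp add: meromorphic_on_def' F_def)
  hence 1: "(\<lambda>w. cusp_chart h g w * w powi int (h * k)) has_laurent_expansion fls_shift (- int (h * k)) F"
    by (intro laurent_expansion_intros)
  have "k \<le> h * k" using h by simp
  hence "int k \<le> int (h * k)" unfolding of_nat_le_iff .
  hence "fls_subdegree F + int (h * k) \<ge> 0" unfolding k_def by linarith
  hence 2: "fls_subdegree (fls_shift (- int (h * k)) F) \<ge> 0"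
    by (cases "F = 0") (auto simp: fls_shift_subdegree)
  have lim: "(\<lambda>w. cusp_chart h g w * w powi int (h * k)) \<midarrow>0\<rightarrow> fls_nth (fls_shift (- int (h * k)) F) 0"
    by (rule has_laurent_expansion_imp_tendsto_0[OF 1 2])
  obtain K r where K: "r > 0" "\<And>w. w \<noteq> 0 \<Longrightarrow> norm w < r \<Longrightarrow> norm (cusp_chart h g w * w powi int (h * k)) \<le> K"
    using tendsto_at_0_bounded[OF lim] by metis
  have "norm (g z * qexp 1 z ^ k) \<le> K" if t: "Im z > max 0 (- (real h / (2 * pi) * ln r))" for z
  proof -
    have "norm (qexp h z) < r" using t by (intro norm_qexp_less h K(1)) simp
    moreover have "qexp h z ^ (h * k) = qexp 1 z ^ k"
      unfolding power_mult using h by (simp add: qexp_def exp_of_nat_mult[symmetric])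
    ultimately show ?thesis using K(2)[of "qexp h z"] cusp_chart_qexp[where g = g, OF h per, of z] t
      by (simp del: of_nat_mult)
  qed
  thus ?thesis unfolding bounded_at_cusp_def by blast
qed

section \<open>Growth of a Hauptmodul and of its coefficients\<close>

lemma bounded_at_cuspI:
  "(\<And>z. Im z > Y \<Longrightarrow> norm (g z) \<le> K) \<Longrightarrow> bounded_at_cusp g"
  unfolding bounded_at_cusp_def by blast

lemma bounded_at_cuspE:
  assumes "bounded_at_cusp g" obtains K Y where "\<And>z. Im z > Y \<Longrightarrow> norm (g z) \<le> K"
  using assms unfolding bounded_at_cusp_def by blast

lemma bounded_at_cusp_cong:
  assumes "bounded_at_cusp g" "\<And>z. Im z > 0 \<Longrightarrow> g z = g' z" shows "bounded_at_cusp g'"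
proof -
  obtain K Y where "\<And>z. Im z > Y \<Longrightarrow> norm (g z) \<le> K" by (rule bounded_at_cuspE[OF assms(1)]) blast
  thus ?thesis using assms(2) by (intro bounded_at_cuspI[of "max Y 0" _ K]) (metis max_less_iff_conj)
qed

lemma bounded_at_cusp_const: "bounded_at_cusp (\<lambda>_. c)"
  by (rule bounded_at_cuspI[of 0 _ "norm c"]) auto

lemma bounded_at_cusp_add:
  assumes "bounded_at_cusp g" "bounded_at_cusp g'" shows "bounded_at_cusp (\<lambda>z. g z + g' z)"
proof -
  obtain K Y where 1: "\<And>z. Im z > Y \<Longrightarrow> norm (g z) \<le> K" by (rule bounded_at_cuspE[OF assms(1)]) blast
  obtain K' Y' where 2: "\<And>z. Im z > Y' \<Longrightarrow> norm (g' z) \<le> K'" by (rule bounded_at_cuspE[OF assms(2)]) blast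
  show ?thesis
    by (rule bounded_at_cuspI[of "max Y Y'" _ "K + K'"]) (auto intro!: norm_triangle_mono 1 2)
qed

lemma bounded_at_cusp_mult:
  assumes "bounded_at_cusp g" "bounded_at_cusp g'" shows "bounded_at_cusp (\<lambda>z. g z * g' z)"
proof -
  obtain K Y where 1: "\<And>z. Im z > Y \<Longrightarrow> norm (g z) \<le> K" by (rule bounded_at_cuspE[OF assms(1)]) blast
  obtain K' Y' where 2: "\<And>z. Im z > Y' \<Longrightarrow> norm (g' z) \<le> K'" by (rule bounded_at_cuspE[OF assms(2)]) blast
  show ?thesis
    using 1 2 by (intro bounded_at_cuspI[of "max Y Y'" _ "K * K'"])
      (auto simp: norm_mult intro!: mult_mono intro: order_trans[OF norm_ge_zero])
qed

lemma bounded_at_cusp_diff: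
  assumes "bounded_at_cusp g" "bounded_at_cusp g'" shows "bounded_at_cusp (\<lambda>z. g z - g' z)"
  using bounded_at_cusp_add[OF assms(1) bounded_at_cusp_mult[OF bounded_at_cusp_const[of "-1"] assms(2)]]
  by simp

lemma bounded_at_cusp_sum:
  "(\<And>x. x \<in> A \<Longrightarrow> bounded_at_cusp (g x)) \<Longrightarrow> bounded_at_cusp (\<lambda>z. \<Sum>x\<in>A. g x z)"
  by (induction A rule: infinite_finite_induct) (auto intro: bounded_at_cusp_const bounded_at_cusp_add)

lemma bounded_at_cusp_poly:
  assumes "bounded_at_cusp g" shows "bounded_at_cusp (\<lambda>z. poly p (g z))"
  by (induction p) (auto intro!: bounded_at_cusp_const bounded_at_cusp_add bounded_at_cusp_mult assms)

lemma q_series_imp_bounded: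
  assumes "h > 0" "q_series h B g" shows "bounded_at_cusp g"
proof -
  obtain K where "\<And>z. Im z \<ge> 1 \<Longrightarrow> norm (g z) \<le> K" using q_series_bounded[OF assms, of 1] by auto
  thus ?thesis by (intro bounded_at_cuspI[of 1 _ K]) auto
qed

lemma bottom_rows_mod:
  assumes "v \<in> bottom_rows N" shows "fst v mod int N = fst v" "snd v mod int N = snd v"
  using assms by (auto simp: bottom_rows_def bottom_row_def)

lemma row_act_translation:
  "v \<in> bottom_rows N \<Longrightarrow> row_act N v (translation k) = (fst v, (fst v * k + snd v) mod int N)"
  by (simp add: row_act_def translation_eq bottom_rows_mod)

text \<open>The number h_s of any matrix with this bottom row, read off from the row alone.\<close>

definition row_width :: "nat \<Rightarrow> int \<times> int \<Rightarrow> nat" where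
  "row_width N v = N div nat (gcd (fst v) (int N))"

lemma row_width:
  assumes "N > 0" shows "row_width N v > 0" "int N dvd fst v * int (row_width N v)"
proof -
  define g where "g = gcd (fst v) (int N)"
  have g: "g > 0" "g dvd int N" "g dvd fst v" using assms by (auto simp: g_def)
  have w: "int (row_width N v) = int N div g" using g(1) by (simp add: row_width_def g_def zdiv_int)
  have "int N div g > 0" using g assms by (simp add: pos_imp_zdiv_pos_iff zdvd_imp_le)
  thus "row_width N v > 0" using w by simp
  obtain k where k: "fst v = g * k" using g by auto
  have "fst v * int (row_width N v) = int N * k" using g unfolding w k by (auto simp: mult_ac)
  thus "int N dvd fst v * int (row_width N v)" by simp
qed

lemma row_act_translation_width:
  assumes "N > 0" "v \<in> bottom_rows N"
  shows "row_act N v (translation (int (row_width N v))) = v"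
proof -
  obtain k where "fst v * int (row_width N v) = int N * k" using row_width(2)[OF assms(1), of v] by (auto elim: dvdE)
  thus ?thesis using assms(2) by (simp add: row_act_translation bottom_rows_mod prod_eq_iff)
qed

lemma (in Gamma0_function) holomorphic_imp_row_fun_holomorphic:
  assumes "f holomorphic_on upper_half_plane" "v \<in> bottom_rows N"
  shows "row_fun v holomorphic_on upper_half_plane"
  unfolding row_fun_def slash_def
proof (rule holomorphic_on_compose_gen[OF _ assms(1), unfolded o_def])
  have d: "det (row_rep N v) > 0" using row_rep(1)[OF assms(2)] by (simp add: mem_SL2)
  show "moebius_map (row_rep N v) holomorphic_on upper_half_plane" by (rule moebius_holomorphic[OF d])
  show "moebius_map (row_rep N v) ` upper_half_plane \<subseteq> upper_half_plane"
    using Im_moebius_pos[OF _ d] by (auto simp: upper_half_plane_def)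
qed

section \<open>Expansions of a Hauptmodul along the rows\<close>

locale hauptmodul =
  fixes N :: nat and f :: "complex \<Rightarrow> complex"
  assumes N_ge_2: "N \<ge> 2" and hauptmodul: "Hauptmodul N f"
begin

sublocale Gamma0_function N f
  using hauptmodul N_ge_2
  by unfold_locales (auto simp: Hauptmodul_def modular_function_def upper_half_plane_def)

lemma f_holomorphic: "f holomorphic_on upper_half_plane"
  using hauptmodul by (simp add: Hauptmodul_def)

lemma f_periodic: assumes "Im z > 0" shows "f (z + 1) = f z"
proof -
  have "translation 1 \<in> Gamma0 N" using SL2_translation by (simp add: Gamma0_def translation_eq)
  from invariant[OF this assms] show ?thesis by (simp add: moebius_translation)
qed

lemma row_fun_periodic:
  assumes "v \<in> bottom_rows N" "Im z > 0"
  shows "row_fun v (z + of_nat (row_width N v)) = row_fun v z"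
  using row_fun_moebius[OF assms(1) SL2_translation[of "int (row_width N v)"] assms(2)] assms N
  by (simp add: moebius_translation row_act_translation_width)

lemmas row_fun_holomorphic = holomorphic_imp_row_fun_holomorphic[OF f_holomorphic]

lemma row_fun_zero:
  assumes "v \<in> bottom_rows N" "fst v = 0" "Im z > 0" shows "row_fun v z = f z"
proof -
  have "row_rep N v \<in> Gamma0 N" using row_rep[OF assms(1)] assms(2) by (simp add: Gamma0_iff_row)
  thus ?thesis using invariant assms(3) by (simp add: row_fun_def slash_def)
qed

lemma f_q_series: "\<exists>c. q_series 1 c (\<lambda>z. f z - inverse (qexp 1 z))"
proof -
  have "slash f (mat 1) = f" by (simp add: slash_def moebius_one fun_eq_iff)
  hence mero: "cusp_chart N f meromorphic_on {0}"
    using hauptmodul SL2_one unfolding Hauptmodul_def modular_function_def by metis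
  have per: "f (z + of_nat N) = f z" if "Im z > 0" for z
    using periodic_int[of f 1 z "int N"] f_periodic that by simp
  obtain k where k: "bounded_at_cusp (\<lambda>z. f z * qexp 1 z ^ k)"
    using cusp_chart_meromorphic_bound[where g = f, OF N per mero] by blast
  have "\<exists>B. q_series 1 B (\<lambda>z. f z * qexp 1 z ^ k)"
    using qexp_period[of 1 1]
    by (intro q_series_exists k holomorphic_intros f_holomorphic) (auto simp: f_periodic qexp_add)
  then obtain B where B: "q_series 1 B (\<lambda>z. f z * qexp 1 z ^ k)" by blast
  let ?Q = "q_expansion 1 f"
  have Q: "fls_nth ?Q n = (if n + int k \<ge> 0 then B (nat (n + int k)) else 0)" for n
    by (rule q_expansion_nth[OF _ B]) simp
  have sub: "fls_subdegree ?Q = -1" "fls_nth ?Q (-1) = 1" using hauptmodul by (auto simp: Hauptmodul_def)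
  have k1: "k \<ge> 1" using Q[of "-1"] sub by (cases k) auto
  \<comment> \<open>The coefficient of q^n in f has index n + k in B. Leading term q^-1 with
    coefficient 1 therefore means that q^(k-1) is the only term of index below k.\<close>
  have B0: "B j = 0" if "j < k - 1" for j
    using Q[of "int j - int k"] sub that fls_eq0_below_subdegree[of "int j - int k" ?Q] by simp
  have B1: "B (k - 1) = 1" using Q[of "-1"] sub k1 by (simp add: nat_diff_distrib)
  have "q_series 1 (\<lambda>n. B (n + k)) (\<lambda>z. f z - inverse (qexp 1 z))"
  proof (rule q_seriesI)
    fix z :: complex assume "Im z > 0"
    define q where "q = qexp 1 z"
    have q: "q \<noteq> 0" by (simp add: q_def)
    have "(\<lambda>n. B n * q ^ n) sums (f z * q ^ k)" using B \<open>Im z > 0\<close> by (simp add: q_series_def q_def)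
    hence "(\<lambda>n. B (n + k) * q ^ (n + k)) sums (f z * q ^ k - (\<Sum>i<k. B i * q ^ i))"
      by (rule sums_split_initial_segment)
    also have "(\<Sum>i<k. B i * q ^ i) = (\<Sum>i\<in>{k - 1}. B i * q ^ i)"
      using B0 k1 by (intro sum.mono_neutral_right) auto
    also have "\<dots> = q ^ (k - 1)" using B1 by simp
    finally have "(\<lambda>n. B (n + k) * q ^ (n + k) / q ^ k) sums ((f z * q ^ k - q ^ (k - 1)) / q ^ k)"
      by (rule sums_divide)
    also have "(f z * q ^ k - q ^ (k - 1)) / q ^ k = f z - inverse q"
      using q k1 by (cases k) (simp_all add: field_simps)
    finally show "(\<lambda>n. B (n + k) * q ^ n) sums (f z - inverse q)"
      using q by (simp add: power_add)
  qed
  thus ?thesis by blast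
qed

definition c :: "nat \<Rightarrow> complex" where
  "c = (SOME c. q_series 1 c (\<lambda>z. f z - inverse (qexp 1 z)))"

lemma c: "q_series 1 c (\<lambda>z. f z - inverse (qexp 1 z))"
  unfolding c_def using f_q_series by (rule someI_ex)

text \<open>Columns of SL2 matrices are primitive, so \<gamma> and \<sigma> sending infinity to the
  same point would give \<gamma>_21 | \<sigma>_21, and with it \<open>N\<close> | \<sigma>_21. Thus
  every row with nonzero first entry falls under the pole-free condition of
  \<open>Hauptmodul\<close>.\<close>

lemma not_Gamma0_not_equivalent:
  assumes "\<sigma> \<in> SL2" "\<sigma> \<notin> Gamma0 N"
  shows "\<not> equivalent_pts (Gamma0 N) None (moebius_pt \<sigma> None)"
proof
  assume "equivalent_pts (Gamma0 N) None (moebius_pt \<sigma> None)"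
  then obtain \<gamma> where g: "\<gamma> \<in> Gamma0 N" "moebius_pt \<gamma> None = moebius_pt \<sigma> None"
    by (auto simp: equivalent_pts_def)
  have s: "\<sigma>$2$1 \<noteq> 0" using assms by (auto simp: Gamma0_def)
  hence "\<gamma>$2$1 \<noteq> 0" using g(2) by (auto simp: moebius_pt_def split: if_splits)
  hence "(of_int (\<gamma>$1$1) * of_int (\<sigma>$2$1) :: complex) = of_int (\<sigma>$1$1) * of_int (\<gamma>$2$1)"
    using g(2) s by (auto simp: moebius_pt_def frac_eq_eq)
  hence eq: "\<gamma>$1$1 * \<sigma>$2$1 = \<sigma>$1$1 * \<gamma>$2$1" by (simp only: of_int_mult[symmetric] of_int_eq_iff)
  have "coprime (\<gamma>$2$1) (\<gamma>$1$1)" using SL2_col_coprime[OF Gamma0_SL2[OF g(1)]] by (simp add: coprime_commute)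
  moreover have "\<gamma>$2$1 dvd \<gamma>$1$1 * \<sigma>$2$1" unfolding eq by simp
  ultimately have "\<gamma>$2$1 dvd \<sigma>$2$1" by (simp add: coprime_dvd_mult_right_iff)
  moreover have "int N dvd \<gamma>$2$1" using g(1) by (simp add: Gamma0_def)
  ultimately show False using assms by (auto simp: Gamma0_def intro: dvd_trans)
qed

lemma row_fun_q_series:
  assumes v: "v \<in> bottom_rows N" "fst v \<noteq> 0"
  shows "\<exists>B. q_series (row_width N v) B (row_fun v)"
proof -
  let ?\<sigma> = "row_rep N v"
  have s: "?\<sigma> \<in> SL2" "?\<sigma> \<notin> Gamma0 N" using row_rep[OF v(1)] v(2) by (auto simp: Gamma0_iff_row)
  have per: "row_fun v (z + of_nat (row_width N v)) = row_fun v z" if "Im z > 0" for z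
    by (rule row_fun_periodic[OF v(1) that])
  \<comment> \<open>\<open>Hauptmodul\<close> speaks of expansions in q^(1/N), so boundedness is
    obtained with period \<open>N\<close> first; the series itself is then taken in q^(1/h).\<close>
  have perN: "row_fun v (z + of_nat N) = row_fun v z" if "Im z > 0" for z
  proof -
    have "nat (gcd (fst v) (int N)) dvd N" by (metis gcd_dvd2 int_dvd_int_iff nat_0_le gcd_ge_0_int)
    then obtain k where "N = row_width N v * k"
      unfolding row_width_def by (metis dvd_div_mult_self)
    thus ?thesis using periodic_int[where g = "row_fun v", OF per that, of "int k"] by (metis of_int_of_nat_eq of_nat_mult)
  qed
  have "bounded_at_cusp (row_fun v)"
  proof (rule q_expansion_nonneg_bounded[where g = "row_fun v", OF N perN])
    show "cusp_chart N (row_fun v) meromorphic_on {0}"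
      using hauptmodul s(1) unfolding row_fun_def Hauptmodul_def modular_function_def by blast
    show "fls_nth (q_expansion N (row_fun v)) n = 0" if "n < 0" for n
      using hauptmodul s(1) not_Gamma0_not_equivalent[OF s] that
      unfolding row_fun_def Hauptmodul_def by blast
  qed
  thus ?thesis
    using row_width(1)[OF N] per row_fun_holomorphic[OF v(1)] by (intro q_series_exists) auto
qed

text \<open>Rows with first entry 0 come from \<open>Gamma0 N\<close>, where the row function is f
  itself with polar part 1/q. All other rows belong to cusps at which f is bounded.\<close>

definition row_pole :: "int \<times> int \<Rightarrow> complex \<Rightarrow> complex" where
  "row_pole v z = (if fst v = 0 then inverse (qexp 1 z) else 0)"

lemma row_coeff_exists:
  assumes "v \<in> bottom_rows N"
  shows "\<exists>B. q_series (row_width N v) B (\<lambda>z. row_fun v z - row_pole v z)"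
proof (cases "fst v = 0")
  case True
  hence "row_width N v = 1" using N by (simp add: row_width_def)
  moreover have "q_series 1 c (\<lambda>z. row_fun v z - inverse (qexp 1 z))"
    using c row_fun_zero[OF assms True] by (simp add: q_series_def)
  ultimately show ?thesis using True by (auto simp: row_pole_def)
qed (use row_fun_q_series[OF assms] in \<open>simp add: row_pole_def\<close>)

definition row_coeff :: "int \<times> int \<Rightarrow> nat \<Rightarrow> complex" where
  "row_coeff v = (SOME B. q_series (row_width N v) B (\<lambda>z. row_fun v z - row_pole v z))"

lemma row_coeff:
  assumes "v \<in> bottom_rows N"
  shows "q_series (row_width N v) (row_coeff v) (\<lambda>z. row_fun v z - row_pole v z)"
  unfolding row_coeff_def using row_coeff_exists[OF assms] by (rule someI_ex)

lemmas row_fun_minus_pole_bounded = q_series_imp_bounded[OF row_width(1)[OF N] row_coeff]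

lemma row_fun_bound_half:
  assumes v: "v \<in> bottom_rows N"
  shows "\<exists>K. \<forall>z. Im z \<ge> 1/2 \<longrightarrow> norm (row_fun v z) \<le> K * exp (2 * pi * Im z)"
proof -
  obtain K where K: "\<And>z. Im z \<ge> 1/2 \<Longrightarrow> norm (row_fun v z - row_pole v z) \<le> K"
    using q_series_bounded[OF row_width(1)[OF N] row_coeff[OF v], of "1/2"] by auto
  have "norm (row_fun v z) \<le> (K + 1) * exp (2 * pi * Im z)" if t: "Im z \<ge> 1/2" for z
  proof -
    have "norm (row_fun v z) \<le> norm (row_fun v z - row_pole v z) + norm (row_pole v z)"
      by (metis diff_add_cancel norm_triangle_ineq)
    also have "norm (row_pole v z) \<le> exp (2 * pi * Im z)"
      by (simp add: row_pole_def norm_inverse norm_qexp exp_minus)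
    finally have "norm (row_fun v z) \<le> K + exp (2 * pi * Im z)" using K[OF t] by linarith
    moreover have "K \<ge> 0" using K[OF t] norm_ge_zero order_trans by blast
    hence "K * 1 \<le> K * exp (2 * pi * Im z)" using t by (intro mult_left_mono) auto
    ultimately show ?thesis by (simp add: algebra_simps)
  qed
  thus ?thesis by blast
qed

text \<open>Moving z to height at least 1/2 changes the row, but only within a finite set. There the
  bound from the expansion holds, and \<open>Im_moebius_le\<close> expresses the new height through
  the old one.\<close>

lemma row_fun_bound:
  "\<exists>K>0. \<forall>v\<in>bottom_rows N. \<forall>z. Im z > 0 \<longrightarrow>
     norm (row_fun v z) \<le> K * exp (2 * pi * max (Im z) (1 / Im z))"
proof -
  obtain k where k: "\<And>v z. v \<in> bottom_rows N \<Longrightarrow> Im z \<ge> 1/2 \<Longrightarrow> norm (row_fun v z) \<le> k v * exp (2 * pi * Im z)"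
    using row_fun_bound_half by metis
  define K where "K = 1 + (\<Sum>v\<in>bottom_rows N. \<bar>k v\<bar>)"
  have kK: "k v \<le> K" if "v \<in> bottom_rows N" for v
    using member_le_sum[of v "bottom_rows N" "\<lambda>v. \<bar>k v\<bar>"] finite_bottom_rows[OF N] that
    unfolding K_def by (smt (verit) abs_ge_self abs_ge_zero)
  have K0: "K > 0" unfolding K_def by (smt (verit) abs_ge_zero sum_nonneg)
  have "norm (row_fun v z) \<le> K * exp (2 * pi * max (Im z) (1 / Im z))"
    if v: "v \<in> bottom_rows N" and t: "Im z > 0" for v z
  proof -
    obtain \<sigma> where s: "\<sigma> \<in> SL2" "Im (moebius_map \<sigma> z) \<ge> 1/2" using SL2_reduce[OF t] by blast
    let ?z = "moebius_map \<sigma> z" and ?v = "row_act N v (adj2 \<sigma>)"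
    have "row_fun v z = row_fun (row_act N ?v \<sigma>) z"
      using v s by (simp add: row_act_mult adj2_inverse row_act_one)
    also have "\<dots> = row_fun ?v ?z"
      by (rule row_fun_moebius[symmetric, OF row_act_mem[OF v SL2_adj2[OF s(1)]] s(1) t])
    finally have "norm (row_fun v z) \<le> k ?v * exp (2 * pi * Im ?z)"
      using k[OF row_act_mem[OF v SL2_adj2[OF s(1)]] s(2)] by simp
    also have "\<dots> \<le> K * exp (2 * pi * max (Im z) (1 / Im z))"
      using kK[OF row_act_mem[OF v SL2_adj2[OF s(1)]]] K0 Im_moebius_le[OF s(1) t]
      by (intro mult_mono) auto
    finally show ?thesis .
  qed
  thus ?thesis using K0 by blast
qed

section \<open>Sums over all rows with a given gcd with \<open>N\<close>\<close>

abbreviation \<phi> :: complex where "\<phi> \<equiv> of_nat (Gamma_index N)"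

definition class_rows :: "nat \<Rightarrow> (int \<times> int) set" where
  "class_rows d = {v \<in> bottom_rows N. gcd (fst v) (int N) = int d}"

definition class_sum :: "nat \<Rightarrow> complex \<Rightarrow> complex" where
  "class_sum d z = (\<Sum>v\<in>class_rows d. row_fun v z)"

definition class_pole :: "nat \<Rightarrow> complex" where
  "class_pole d = (if d = N then \<phi> else 0)"

lemma finite_class_rows: "finite (class_rows d)"
  using finite_bottom_rows[OF N] by (simp add: class_rows_def)

lemma class_rows_N: "class_rows N = {v \<in> bottom_rows N. fst v = 0}"
proof -
  have "fst v = 0" if "v \<in> bottom_rows N" "gcd (fst v) (int N) = int N" for v
  proof -
    have "int N dvd fst v" using that(2) by (metis gcd_dvd1)
    thus ?thesis using bottom_rows_mod(1)[OF that(1)] by (simp add: mod_eq_0_iff_dvd)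
  qed
  thus ?thesis by (auto simp: class_rows_def)
qed

lemma class_sum_minus_pole:
  assumes "Im z > 0"
  shows "class_sum d z - class_pole d * inverse (qexp 1 z) =
    (\<Sum>v\<in>class_rows d. row_fun v z - row_pole v z)"
proof (cases "d = N")
  case True
  have "(\<Sum>v\<in>class_rows N. row_pole v z) = (\<Sum>v\<in>class_rows N. inverse (qexp 1 z))"
    by (intro sum.cong) (auto simp: class_rows_N row_pole_def)
  also have "\<dots> = class_pole N * inverse (qexp 1 z)"
    by (simp add: class_pole_def Gamma_index_eq class_rows_N)
  finally show ?thesis by (simp add: class_sum_def sum_subtractf True)
next
  case False
  have "(\<Sum>v\<in>class_rows d. row_pole v z) = 0"
    using False by (intro sum.neutral) (auto simp: class_rows_def row_pole_def)
  thus ?thesis using False by (simp add: class_sum_def sum_subtractf class_pole_def)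
qed

text \<open>A translation alters only the second entry of a row and so permutes the class. The
  individual row functions have expansions in q^(1/h); their sum has one in q.\<close>

lemma class_sum_periodic:
  assumes "Im z > 0" shows "class_sum d (z + 1) = class_sum d z"
proof -
  have mem: "row_act N v (translation k) \<in> class_rows d" if "v \<in> class_rows d" for v k
    using that row_act_mem[OF _ SL2_translation[of k], of v N] by (auto simp: class_rows_def row_act_translation)
  have inv: "row_act N (row_act N v (translation k)) (translation (- k)) = v" if "v \<in> class_rows d" for v k
  proof -
    have "translation k ** translation (- k) = mat 1" by (simp flip: translation_add add: translation_0)
    thus ?thesis using that by (simp add: row_act_mult row_act_one class_rows_def)
  qed
  have "class_sum d (z + 1) = (\<Sum>v\<in>class_rows d. row_fun (row_act N v (translation 1)) z)"
    unfolding class_sum_def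
  proof (intro sum.cong refl)
    fix v assume "v \<in> class_rows d"
    thus "row_fun v (z + 1) = row_fun (row_act N v (translation 1)) z"
      using row_fun_moebius[OF _ SL2_translation[of 1] assms, of v] by (simp add: class_rows_def moebius_translation)
  qed
  also have "\<dots> = class_sum d z" unfolding class_sum_def
    using mem inv inv[of _ "-1"]
    by (intro sum.reindex_bij_witness[of _ "\<lambda>v. row_act N v (translation (-1))" "\<lambda>v. row_act N v (translation 1)"]) auto
  finally show ?thesis .
qed

lemma class_sum_q_series: "\<exists>B. q_series 1 B (\<lambda>z. class_sum d z - class_pole d * inverse (qexp 1 z))"
proof (rule q_series_exists)
  show "class_sum d (z + of_nat 1) - class_pole d * inverse (qexp 1 (z + of_nat 1)) =
      class_sum d z - class_pole d * inverse (qexp 1 z)" if "Im z > 0" for z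
    using qexp_period[of 1 1] class_sum_periodic[OF that] by (simp add: qexp_add)
  show "(\<lambda>z. class_sum d z - class_pole d * inverse (qexp 1 z)) holomorphic_on upper_half_plane"
    unfolding class_sum_def
    by (intro holomorphic_intros row_fun_holomorphic) (simp_all add: class_rows_def)
  have "bounded_at_cusp (\<lambda>z. row_fun v z - row_pole v z)"
    if "v \<in> class_rows d" for v
    using that by (intro row_fun_minus_pole_bounded) (simp add: class_rows_def)
  hence "bounded_at_cusp (\<lambda>z. \<Sum>v\<in>class_rows d. row_fun v z - row_pole v z)"
    by (rule bounded_at_cusp_sum)
  thus "bounded_at_cusp (\<lambda>z. class_sum d z - class_pole d * inverse (qexp 1 z))"
    by (rule bounded_at_cusp_cong) (rule class_sum_minus_pole[symmetric])
qed simp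

definition class_coeff :: "nat \<Rightarrow> nat \<Rightarrow> complex" where
  "class_coeff d = (SOME B. q_series 1 B (\<lambda>z. class_sum d z - class_pole d * inverse (qexp 1 z)))"

lemma class_coeff: "q_series 1 (class_coeff d) (\<lambda>z. class_sum d z - class_pole d * inverse (qexp 1 z))"
  unfolding class_coeff_def using class_sum_q_series by (rule someI_ex)

text \<open>The Cauchy estimate on the line \<open>Im z = 1 / sqrt l\<close>.\<close>

lemma class_coeff_bound:
  "\<exists>K>0. \<forall>d. \<forall>l>0. norm (class_coeff d l) \<le> K * exp (4 * pi * sqrt (real l))"
proof -
  obtain K where K: "K > 0" "\<And>v z. v \<in> bottom_rows N \<Longrightarrow> Im z > 0 \<Longrightarrow>
      norm (row_fun v z) \<le> K * exp (2 * pi * max (Im z) (1 / Im z))"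
    using row_fun_bound by blast
  define n where "n = real (card (bottom_rows N))"
  define K' where "K' = n * K + real (Gamma_index N)"
  have n0: "n \<ge> 0" by (simp add: n_def)
  have "norm (class_coeff d l) \<le> K' * exp (4 * pi * sqrt (real l))" if l: "l > 0" for d l
  proof -
    define s where "s = sqrt (real l)"
    have s: "s \<ge> 1" "s * s = real l" using l by (auto simp: s_def)
    define y where "y = 1 / s"
    have y: "y > 0" "y \<le> 1" "1 / y = s" "real l * y = s" using s by (auto simp: y_def field_simps)
    have "norm (class_sum d z - class_pole d * inverse (qexp 1 z)) \<le> K' * exp (2 * pi * s)"
      if t: "Im z = y" for z
    proof -
      have mx: "max (Im z) (1 / Im z) = s" using y s t by (simp add: max_def)
      have "norm (class_sum d z) \<le> (\<Sum>v\<in>class_rows d. K * exp (2 * pi * s))"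
        unfolding class_sum_def using K(2)[of _ z] y(1) t mx
        by (intro sum_norm_le) (auto simp: class_rows_def)
      also have "\<dots> = real (card (class_rows d)) * (K * exp (2 * pi * s))" by simp
      also have "\<dots> \<le> n * (K * exp (2 * pi * s))"
        unfolding n_def using K(1) finite_bottom_rows[OF N]
        by (intro mult_right_mono) (auto intro!: card_mono simp: class_rows_def)
      finally have 1: "norm (class_sum d z) \<le> n * K * exp (2 * pi * s)" by (simp add: mult_ac)
      have "norm (class_pole d * inverse (qexp 1 z)) \<le> real (Gamma_index N) * exp (2 * pi * y)"
        by (simp add: class_pole_def norm_mult norm_inverse norm_qexp exp_minus t)
      also have "\<dots> \<le> real (Gamma_index N) * exp (2 * pi * s)" using y s by (intro mult_left_mono) auto
      finally show ?thesis using 1 norm_triangle_ineq4[of "class_sum d z" "class_pole d * inverse (qexp 1 z)"]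
        by (simp add: K'_def algebra_simps)
    qed
    hence "norm (class_coeff d l) \<le> K' * exp (2 * pi * s) * exp (2 * pi * real l * y / real 1)"
      by (intro q_series_coeff_bound[OF _ class_coeff y(1)]) auto
    also have "\<dots> = K' * exp (2 * pi * s + 2 * pi * (real l * y))" by (simp add: exp_add mult_ac)
    also have "\<dots> = K' * exp (4 * pi * s)" unfolding y(4) by simp
    finally show ?thesis by (simp add: s_def)
  qed
  moreover have "K' > 0" using Gamma_index_pos[OF N] n0 K(1) by (simp add: K'_def add_nonneg_pos)
  ultimately show ?thesis by blast
qed

end

declare One_nat_def [simp del]

section \<open>Liouville's theorem\<close>

text \<open>
  The maximum modulus over all rows and over a disc in the variable \<open>q\<^sup>1\<^sup>/\<^sup>N\<close> is attained, and it bounds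
  the function everywhere because every point can be moved to \<open>Im z \<ge> 1/2\<close>.
\<close>

lemma (in Gamma0_function) liouville:
  assumes hol: "f holomorphic_on upper_half_plane"
    and bd: "\<And>v. v \<in> bottom_rows N \<Longrightarrow> bounded_at_cusp (row_fun v)"
    and lim: "(f \<longlongrightarrow> 0) at_cusp"
    and t: "Im z > 0"
  shows "f z = 0"
proof -
  have per: "row_fun v (z + of_nat N) = row_fun v z" if "v \<in> bottom_rows N" "Im z > 0" for v z
    using row_fun_moebius[OF that(1) SL2_translation[of "int N"] that(2)] that(1)
    by (simp add: moebius_translation row_act_translation bottom_rows_mod)
  have "\<exists>G. G holomorphic_on ball 0 1 \<and> (\<forall>z. Im z > 0 \<longrightarrow> row_fun v z = G (qexp N z))"
    if v: "v \<in> bottom_rows N" for v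
  proof -
    obtain B where "q_series N B (row_fun v)"
      using q_series_exists[where g = "row_fun v", OF N per[OF v] holomorphic_imp_row_fun_holomorphic[OF hol v] bd[OF v]] by blast
    from q_series_disc[OF N this] show ?thesis by metis
  qed
  then obtain G where G: "\<And>v. v \<in> bottom_rows N \<Longrightarrow> G v holomorphic_on ball 0 1"
      "\<And>v z. v \<in> bottom_rows N \<Longrightarrow> Im z > 0 \<Longrightarrow> row_fun v z = G v (qexp N z)" by metis
  \<comment> \<open>The modulus of q^(1/N) at height 1/2, so that height at least 1/2 corresponds to
    the closed disc of radius r.\<close>
  define r where "r = exp (- (pi / real N))"
  have r: "0 < r" "r < 1" using N by (auto simp: r_def)
  have "\<exists>w\<in>cball 0 r. \<forall>p\<in>cball 0 r. norm (G v p) \<le> norm (G v w)" if v: "v \<in> bottom_rows N" for v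
  proof (rule continuous_attains_sup)
    show "continuous_on (cball 0 r) (\<lambda>p. norm (G v p))"
      using r by (intro continuous_on_norm continuous_on_subset[OF holomorphic_on_imp_continuous_on[OF G(1)[OF v]]]) auto
  qed (use r in auto)
  then obtain w where w: "\<And>v. v \<in> bottom_rows N \<Longrightarrow> w v \<in> cball 0 r"
      "\<And>v p. v \<in> bottom_rows N \<Longrightarrow> p \<in> cball 0 r \<Longrightarrow> norm (G v p) \<le> norm (G v (w v))" by metis
  define R where "R = (\<lambda>v. norm (G v (w v))) ` bottom_rows N"
  have R: "finite R" "R \<noteq> {}"
    using finite_bottom_rows[OF N] bottom_row_mem[OF SL2_one] by (auto simp: R_def)
  obtain v0 where v0: "v0 \<in> bottom_rows N" "Max R = norm (G v0 (w v0))"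
    using Max_in[OF R] by (auto simp: R_def)
  have ge: "norm (G v p) \<le> norm (G v0 (w v0))" if v: "v \<in> bottom_rows N" and p: "p \<in> cball 0 r" for v p
  proof -
    have "norm (G v p) \<le> norm (G v (w v))" using w(2) v p by blast
    also have "\<dots> \<le> Max R" using v by (intro Max_ge R) (auto simp: R_def)
    finally show ?thesis using v0 by simp
  qed
  have max: "norm (G v0 p) \<le> norm (G v0 (w v0))" if p: "p \<in> ball 0 1" for p
  proof (cases "p = 0")
    case True
    thus ?thesis using ge[OF v0(1), of 0] r by simp
  next
    case False
    then obtain z where t: "Im z > 0" "p = qexp N z" using qexp_surj[OF N, of p] p by auto
    obtain \<sigma> where s: "\<sigma> \<in> SL2" "Im (moebius_map \<sigma> z) \<ge> 1/2" using SL2_reduce[OF t(1)] by blast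
    let ?v = "row_act N v0 (adj2 \<sigma>)"
    have v: "?v \<in> bottom_rows N" by (rule row_act_mem[OF v0(1) SL2_adj2[OF s(1)]])
    have "G v0 p = row_fun (row_act N ?v \<sigma>) z"
      using v0 s t by (simp add: row_act_mult adj2_inverse row_act_one G(2))
    also have "\<dots> = row_fun ?v (moebius_map \<sigma> z)" by (rule row_fun_moebius[symmetric, OF v s(1) t(1)])
    also have "\<dots> = G ?v (qexp N (moebius_map \<sigma> z))" using s by (intro G(2)[OF v]) simp
    also have "norm (qexp N (moebius_map \<sigma> z)) \<le> r"
    proof -
      have "pi * 1 \<le> pi * (2 * Im (moebius_map \<sigma> z))" using s(2) by (intro mult_left_mono) auto
      thus ?thesis using N by (simp add: norm_qexp r_def divide_right_mono mult_ac)
    qed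
    hence "norm (G ?v (qexp N (moebius_map \<sigma> z))) \<le> norm (G v0 (w v0))"
      by (intro ge[OF v]) simp
    finally show ?thesis .
  qed
  \<comment> \<open>The maximiser has modulus at most r < 1. It is thus an interior point of the
    unit disc, and the maximum modulus principle makes this row function constant.\<close>
  have "w v0 \<in> ball 0 1" using w(1)[OF v0(1)] r by auto
  hence "G v0 constant_on ball 0 1"
    using max by (intro maximum_modulus_principle[OF G(1)[OF v0(1)], of "ball 0 1" "w v0"]) auto
  then obtain k where k: "\<And>p. p \<in> ball 0 1 \<Longrightarrow> G v0 p = k" by (auto simp: constant_on_def)
  have const: "f z = k" if t: "Im z > 0" for z
  proof -
    let ?A = "row_rep N v0"
    have A: "?A \<in> SL2" by (rule row_rep(1)[OF v0(1)])
    have Im: "Im (moebius_map (adj2 ?A) z) > 0"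
      using SL2_adj2[OF A] by (intro Im_moebius_pos[OF t]) (simp add: mem_SL2)
    have "moebius_map (?A ** adj2 ?A) z = moebius_map ?A (moebius_map (adj2 ?A) z)"
      using A SL2_adj2[OF A] t by (intro moebius_mult) (simp_all add: mem_SL2)
    hence "f z = row_fun v0 (moebius_map (adj2 ?A) z)"
      by (simp add: adj2_inverse[OF A] moebius_one row_fun_def slash_def)
    also have "\<dots> = k" using k norm_qexp_less_1_iff[OF N] Im G(2)[OF v0(1) Im] by simp
    finally show ?thesis .
  qed
  have "eventually (\<lambda>z. Im z > 0) at_cusp"
    unfolding eventually_filtercomap using eventually_gt_at_top by blast
  hence "eventually (\<lambda>z. f z = k) at_cusp" by eventually_elim (rule const)
  hence "(f \<longlongrightarrow> k) at_cusp" by (rule tendsto_eventually)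
  moreover have "surj Im" by (metis Im_complex_of_real complex.sel(2) surjI)
  hence "at_cusp \<noteq> bot" by (intro filtercomap_neq_bot_surj) auto
  ultimately have "k = 0" using lim tendsto_unique by blast
  thus ?thesis using const[OF t] by simp
qed

section \<open>Hecke sums of a Hauptmodul\<close>

lemma sum_roots_of_unity:
  assumes "d > 0"
  shows "(\<Sum>b<d. exp (2 * of_real pi * \<i> * of_int n * of_nat b / of_nat d)) = (if int d dvd n then of_nat d else 0)"
proof -
  define z where "z = exp (2 * of_real pi * \<i> * of_int n / of_nat d)"
  have z: "exp (2 * of_real pi * \<i> * of_int n * of_nat b / of_nat d) = z ^ b" for b
    by (simp add: z_def exp_of_nat_mult[symmetric] mult_ac)
  have zd: "z ^ d = 1"
  proof -
    have "z ^ d = exp (2 * of_real pi * \<i> * of_int n)" using assms by (simp add: z_def exp_of_nat_mult[symmetric])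
    also have "\<dots> = 1" by (auto simp: exp_eq_1)
    finally show ?thesis .
  qed
  have z1: "z = 1 \<longleftrightarrow> int d dvd n"
  proof
    assume "z = 1"
    then obtain k :: int where "2 * pi * of_int n / real d = of_int (2 * k) * pi"
      unfolding z_def exp_eq_1 by auto
    hence "real_of_int n = of_int k * real d" using assms by (simp add: field_simps)
    also have "\<dots> = of_int (k * int d)" by simp
    finally have "n = k * int d" by (simp only: of_int_eq_iff)
    thus "int d dvd n" by simp
  next
    assume "int d dvd n"
    then obtain k where "n = int d * k" by auto
    thus "z = 1" using assms by (auto simp: z_def exp_eq_1)
  qed
  show ?thesis unfolding z
    using z1 zd by (cases "z = 1") (simp_all add: geometric_sum)
qed

lemma qexp_power: "qexp 1 z ^ n = qexp 1 (of_nat n * z)"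
  by (simp add: qexp_def exp_of_nat_mult[symmetric] mult_ac)

lemma qexp_hermite_power:
  assumes "d > 0"
  shows "qexp 1 ((z + of_nat b) / of_nat d) ^ n = qexp 1 (of_nat n * z / of_nat d) * exp (2 * of_real pi * \<i> * of_int (int n) * of_nat b / of_nat d)"
  unfolding qexp_power by (simp add: qexp_def exp_add[symmetric] add_divide_distrib ring_distribs mult_ac)

lemma sum_qexp_hermite:
  assumes "d > 0"
  shows "(\<Sum>b<d. qexp 1 ((z + of_nat b) / of_nat d) ^ n) = (if d dvd n then of_nat d * qexp 1 (of_nat n * z / of_nat d) else 0)"
proof -
  have "(\<Sum>b<d. qexp 1 ((z + of_nat b) / of_nat d) ^ n) = qexp 1 (of_nat n * z / of_nat d) * (\<Sum>b<d. exp (2 * of_real pi * \<i> * of_int (int n) * of_nat b / of_nat d))"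
    unfolding qexp_hermite_power[OF assms] by (simp add: sum_distrib_left)
  also have "(\<Sum>b<d. exp (2 * of_real pi * \<i> * of_int (int n) * of_nat b / of_nat d)) = (if d dvd n then of_nat d else 0)"
    unfolding sum_roots_of_unity[OF assms] by simp
  finally show ?thesis by (simp add: mult.commute)
qed

text \<open>The sum runs over powers of a d-th root of unity with exponent -1, and d divides -1 only
  for d = 1.\<close>

lemma sum_inverse_qexp_hermite:
  assumes "d > 0"
  shows "(\<Sum>b<d. inverse (qexp 1 ((z + of_nat b) / of_nat d))) = (if d = 1 then inverse (qexp 1 z) else 0)"
proof -
  have "inverse (qexp 1 ((z + of_nat b) / of_nat d)) = inverse (qexp 1 (z / of_nat d)) * exp (2 * of_real pi * \<i> * of_int (-1) * of_nat b / of_nat d)" for b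
    by (simp add: qexp_def exp_minus[symmetric] exp_add[symmetric] add_divide_distrib ring_distribs mult_ac)
  hence "(\<Sum>b<d. inverse (qexp 1 ((z + of_nat b) / of_nat d))) = inverse (qexp 1 (z / of_nat d)) * (\<Sum>b<d. exp (2 * of_real pi * \<i> * of_int (-1) * of_nat b / of_nat d))"
    by (simp only: sum_distrib_left)
  also have "(\<Sum>b<d. exp (2 * of_real pi * \<i> * of_int (-1) * of_nat b / of_nat d)) = (if d = 1 then of_nat d else 0)"
    unfolding sum_roots_of_unity[OF assms] using assms by auto
  finally show ?thesis by simp
qed

lemma hecke_index_iff:
  assumes "v \<in> bottom_rows N" "u \<in> hermites m"
  shows "(v, u) \<in> hecke_index N m \<sigma> \<longleftrightarrow>
    int N dvd fst v * (hermite m u ** adj2 \<sigma>) $ 1 $ 1 + snd v * (hermite m u ** adj2 \<sigma>) $ 2 $ 1"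
proof -
  let ?X = "hermite m u ** adj2 \<sigma>"
  have "int N dvd (hecke_rep N m (v, u) ** adj2 \<sigma>)$2$1 \<longleftrightarrow> fst (bottom_row N (row_rep N v ** ?X)) = 0"
    by (simp add: hecke_rep_def bottom_row_def matrix_mul_assoc dvd_eq_mod_eq_0 del: mat2_mult_nth)
  also have "bottom_row N (row_rep N v ** ?X) = row_act N v ?X" using assms by (simp add: row_act_eq)
  finally show ?thesis using assms
    by (simp add: hecke_index_def row_act_def dvd_eq_mod_eq_0 del: mat2_mult_nth)
qed

lemma bottom_rows_snd_coprime:
  assumes "N > 0" "v \<in> bottom_rows N" "fst v = 0" shows "coprime (snd v) (int N)"
proof -
  have A: "row_rep N v \<in> SL2" "bottom_row N (row_rep N v) = v" using row_rep[OF assms(2)] by auto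
  have "row_rep N v $2$1 mod int N = 0" using assms(3) A(2) by (metis bottom_row_def fst_conv)
  hence "int N dvd row_rep N v $2$1" by (simp add: dvd_eq_mod_eq_0)
  hence "coprime (row_rep N v $2$2) (int N)"
    using coprime_divisors[OF _ dvd_refl SL2_row_coprime[OF A(1)], of "int N"] by (simp add: coprime_commute)
  moreover have "snd v = row_rep N v $2$2 mod int N" using A(2) by (metis bottom_row_def snd_conv)
  ultimately show ?thesis using assms(1) by simp
qed

lemma Im_moebius_hermite:
  assumes "d > 0"
  shows "Im (moebius_map (hermite m (d, b)) z) = real (m div d) * Im z / real d"
  unfolding moebius_hermite by (simp add: Im_divide_of_nat)

lemma bounded_at_cusp_hermite:
  assumes "bounded_at_cusp g" "m > 0" "u \<in> hermites m"
  shows "bounded_at_cusp (\<lambda>z. g (moebius_map (hermite m u) z))"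
proof -
  obtain d b where u: "u = (d, b)" "d dvd m" "b < d" using assms(3) by (cases u) (auto simp: hermites_def)
  have pos: "real (m div d) > 0" "real d > 0" using u assms(2) by (auto simp: div_greater_zero_iff dvd_imp_le)
  obtain K Y where KY: "\<And>z. Im z > Y \<Longrightarrow> norm (g z) \<le> K" by (rule bounded_at_cuspE[OF assms(1)]) blast
  show ?thesis
  proof (rule bounded_at_cuspI[of "Y * real d / real (m div d)" _ K])
    fix z assume "Im z > Y * real d / real (m div d)"
    hence "Y < real (m div d) * Im z / real d" using pos by (simp add: field_simps)
    thus "norm (g (moebius_map (hermite m u) z)) \<le> K"
      using pos by (intro KY) (simp add: u Im_moebius_hermite)
  qed
qed

context hauptmodul
begin

definition polar_term :: "nat \<Rightarrow> complex \<Rightarrow> (int \<times> int) \<times> (nat \<times> nat) \<Rightarrow> complex" where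
  "polar_term m z x = row_pole (fst x) (moebius_map (hermite m (snd x)) z)"

lemma hecke_term_minus_polar_bounded:
  assumes "x \<in> bottom_rows N \<times> hermites m" "m > 0"
  shows "bounded_at_cusp (\<lambda>z. hecke_term m z x - polar_term m z x)"
  using bounded_at_cusp_hermite[OF row_fun_minus_pole_bounded assms(2), of "fst x" "snd x"] assms(1)
  by (auto simp: hecke_term_def polar_term_def)

text \<open>Only rows with first entry 0 have a pole, and their second entry is a unit modulo
  \<open>N\<close>, so the index condition becomes \<open>N\<close> | d \<sigma>_21. As \<sigma> is
  not in \<open>Gamma0 N\<close>, d = 1 is excluded, and every sum over b modulo d > 1
  vanishes.\<close>

lemma sum_polar_term:
  assumes m: "m > 0" and s: "\<sigma> \<in> SL2" "\<sigma> \<notin> Gamma0 N"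
  shows "(\<Sum>x\<in>hecke_index N m \<sigma>. polar_term m z x) = 0"
proof -
  let ?D = "{d. d dvd m \<and> int N dvd int d * \<sigma>$2$1}"
  have idx: "(v, (d, b)) \<in> hecke_index N m \<sigma> \<longleftrightarrow> d \<in> ?D \<and> b < d"
    if v: "v \<in> class_rows N" for v d b
  proof (cases "(d, b) \<in> hermites m")
    case True
    have v': "v \<in> bottom_rows N" "fst v = 0" using v by (auto simp: class_rows_N)
    have "coprime (int N) (snd v)" using bottom_rows_snd_coprime[OF N v'] by (simp add: coprime_commute)
    hence "int N dvd snd v * (int d * \<sigma>$2$1) \<longleftrightarrow> int N dvd int d * \<sigma>$2$1"
      by (simp add: coprime_dvd_mult_right_iff)
    thus ?thesis using True v' by (simp add: hecke_index_iff) (simp add: hermite_def adj2_def hermites_def)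
  qed (auto simp: hecke_index_def hermites_def)
  have "(\<Sum>x\<in>hecke_index N m \<sigma>. polar_term m z x) =
        (\<Sum>x\<in>class_rows N \<times> Sigma ?D (\<lambda>d. {..<d}). polar_term m z x)"
  proof (rule sum.mono_neutral_right)
    show "finite (hecke_index N m \<sigma>)" by (rule finite_hecke_index[OF N m])
    show "class_rows N \<times> Sigma ?D (\<lambda>d. {..<d}) \<subseteq> hecke_index N m \<sigma>" using idx by auto
    show "\<forall>x\<in>hecke_index N m \<sigma> - class_rows N \<times> Sigma ?D (\<lambda>d. {..<d}). polar_term m z x = 0"
    proof
      fix x assume x: "x \<in> hecke_index N m \<sigma> - class_rows N \<times> Sigma ?D (\<lambda>d. {..<d})"
      obtain v d b where x': "x = (v, (d, b))" by (metis prod.exhaust)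
      have "v \<notin> class_rows N" using x idx[of v d b] unfolding x' by auto
      moreover have "v \<in> bottom_rows N" using x unfolding x' by (auto simp: hecke_index_def)
      ultimately show "polar_term m z x = 0" by (auto simp: x' polar_term_def row_pole_def class_rows_N)
    qed
  qed
  also have "\<dots> = (\<Sum>v\<in>class_rows N. \<Sum>u\<in>Sigma ?D (\<lambda>d. {..<d}). polar_term m z (v, u))"
    by (simp add: sum.cartesian_product case_prod_unfold)
  also have "\<dots> = (\<Sum>v\<in>class_rows N. \<Sum>d\<in>?D. \<Sum>b<d. polar_term m z (v, (d, b)))"
    using m by (intro sum.cong refl) (simp add: sum.Sigma case_prod_unfold)
  also have "\<dots> = 0"
  proof (rule sum.neutral, rule ballI, rule sum.neutral, rule ballI)
    fix v d assume v: "v \<in> class_rows N" and d: "d \<in> ?D"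
    have "d > 0" using d m by (auto intro!: Nat.gr0I)
    moreover have "d \<noteq> 1" using d s by (auto simp: Gamma0_def)
    moreover have "(\<Sum>b<d. polar_term m z (v, (d, b))) = (\<Sum>b<d. inverse (qexp 1 ((of_nat (m div d) * z + of_nat b) / of_nat d)))"
      using v by (simp add: polar_term_def row_pole_def class_rows_N moebius_hermite)
    ultimately show "(\<Sum>b<d. polar_term m z (v, (d, b))) = 0" by (simp add: sum_inverse_qexp_hermite)
  qed
  finally show ?thesis .
qed

lemma hecke_moebius_bounded:
  assumes m: "m > 0" and s: "\<sigma> \<in> SL2" "\<sigma> \<notin> Gamma0 N"
  shows "bounded_at_cusp (\<lambda>z. hecke m (moebius_map \<sigma> z))"
proof (rule bounded_at_cusp_cong)
  show "bounded_at_cusp (\<lambda>z. \<Sum>x\<in>hecke_index N m \<sigma>. hecke_term m z x - polar_term m z x)"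
    by (intro bounded_at_cusp_sum hecke_term_minus_polar_bounded m) (auto simp: hecke_index_def)
  show "(\<Sum>x\<in>hecke_index N m \<sigma>. hecke_term m z x - polar_term m z x) = hecke m (moebius_map \<sigma> z)"
    if "Im z > 0" for z
    using sum_polar_term[OF m s] hecke_moebius[OF m s(1) that] by (simp add: sum_subtractf)
qed

lemma hecke_holomorphic:
  assumes "m > 0" shows "hecke m holomorphic_on upper_half_plane"
  unfolding hecke_def hecke_term_def
proof (intro holomorphic_intros)
  fix x assume "x \<in> hecke_index N m (mat 1)"
  hence x: "fst x \<in> bottom_rows N" "snd x \<in> hermites m" by (auto simp: hecke_index_def)
  have d: "det (hermite m (snd x)) > 0" using det_hermite[OF x(2)] assms by simp
  show "(\<lambda>z. row_fun (fst x) (moebius_map (hermite m (snd x)) z)) holomorphic_on upper_half_plane"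
  proof (rule holomorphic_on_compose_gen[OF _ row_fun_holomorphic[OF x(1)], unfolded o_def])
    show "moebius_map (hermite m (snd x)) holomorphic_on upper_half_plane" by (rule moebius_holomorphic[OF d])
    show "moebius_map (hermite m (snd x)) ` upper_half_plane \<subseteq> upper_half_plane"
      using Im_moebius_pos[OF _ d] by (auto simp: upper_half_plane_def)
  qed
qed

section \<open>Expansion of the Hecke sums at infinity\<close>

definition class_pairs :: "nat \<Rightarrow> (nat \<times> nat) set" where
  "class_pairs m = {(e, d). e dvd N \<and> d dvd m \<and> N div e dvd m div d}"

lemma finite_class_pairs: "m > 0 \<Longrightarrow> finite (class_pairs m)"
  using N by (intro finite_subset[of "class_pairs m" "{e. e dvd N} \<times> {d. d dvd m}"]) (auto simp: class_pairs_def)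

text \<open>Dividing by the gcd e leaves a factor prime to N/e. With a = m/d, where d is the lower
  right entry of the Hermite form, this turns the index condition of the Hecke sum into the
  divisibility in \<open>class_pairs\<close>.\<close>

lemma class_rows_dvd_iff:
  assumes "e dvd N" "v \<in> class_rows e" shows "int N dvd fst v * int a \<longleftrightarrow> N div e dvd a"
proof -
  have g: "gcd (fst v) (int N) = int e" using assms by (simp add: class_rows_def)
  have e0: "e > 0" using assms N by (auto intro!: Nat.gr0I)
  obtain k where k: "fst v = int e * k" using g by (metis gcd_dvd1 dvd_def)
  obtain h where h: "N = e * h" using assms(1) by auto
  have "gcd (int e * k) (int e * int h) = int e" using g k h by simp
  hence "gcd k (int h) = 1" using e0 by (simp add: gcd_mult_distrib_int[symmetric])
  hence cop: "coprime (int h) k" by (simp add: coprime_iff_gcd_eq_1 gcd.commute)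
  have "int N dvd fst v * int a \<longleftrightarrow> int e * int h dvd int e * (k * int a)" by (simp add: k h mult_ac)
  also have "\<dots> \<longleftrightarrow> int h dvd k * int a" using e0 by (subst dvd_times_left_cancel_iff) auto
  also have "\<dots> \<longleftrightarrow> int h dvd int a" using cop by (simp add: coprime_dvd_mult_right_iff)
  finally show ?thesis using h e0 by simp
qed

lemma hecke_eq_class_sums:
  assumes m: "m > 0"
  shows "hecke m z = (\<Sum>(e, d)\<in>class_pairs m. \<Sum>b<d. class_sum e ((of_nat (m div d) * z + of_nat b) / of_nat d))"
proof -
  let ?z = "\<lambda>d b. (of_nat (m div d) * z + of_nat b) / of_nat d :: complex"
  let ?S = "Sigma (class_pairs m) (\<lambda>(e, d). class_rows e \<times> {..<d})"
  have "hecke m z = (\<Sum>x\<in>?S. hecke_term m z (fst (snd x), (snd (fst x), snd (snd x))))"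
    unfolding hecke_def
  proof (rule sum.reindex_bij_witness[of _ "\<lambda>x. (fst (snd x), (snd (fst x), snd (snd x)))"
        "\<lambda>x. ((nat (gcd (fst (fst x)) (int N)), fst (snd x)), (fst x, snd (snd x)))"])
    fix x assume x: "x \<in> hecke_index N m (mat 1)"
    obtain v d b where x': "x = (v, (d, b))" by (metis prod.exhaust)
    have v: "v \<in> bottom_rows N" and u: "(d, b) \<in> hermites m" using x by (auto simp: x' hecke_index_def)
    define e where "e = nat (gcd (fst v) (int N))"
    have ve: "v \<in> class_rows e" using v by (simp add: class_rows_def e_def)
    have eN: "e dvd N" using ve by (simp add: class_rows_def) (metis gcd_dvd2 int_dvd_int_iff)
    have "int N dvd fst v * int (m div d)"
      using x v u by (simp add: x' hecke_index_iff adj2_one matrix_mul_rid) (simp add: hermite_def)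
    hence "N div e dvd m div d" using class_rows_dvd_iff[OF eN ve] by simp
    thus "((nat (gcd (fst (fst x)) (int N)), fst (snd x)), (fst x, snd (snd x))) \<in> ?S"
      using ve eN u by (simp add: x' e_def[symmetric] class_pairs_def hermites_def)
  next
    fix x assume x: "x \<in> ?S"
    obtain e d v b where x': "x = ((e, d), (v, b))" by (metis prod.exhaust)
    have h: "e dvd N" "d dvd m" "N div e dvd m div d" "v \<in> class_rows e" "b < d"
      using x by (auto simp: x' class_pairs_def)
    have v: "v \<in> bottom_rows N" using h(4) by (simp add: class_rows_def)
    have u: "(d, b) \<in> hermites m" using h by (simp add: hermites_def)
    have "(v, (d, b)) \<in> hecke_index N m (mat 1)"
      using class_rows_dvd_iff[OF h(1,4), of "m div d"] h(3) v u
      by (simp add: hecke_index_iff adj2_one matrix_mul_rid) (simp add: hermite_def)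
    thus "(fst (snd x), (snd (fst x), snd (snd x))) \<in> hecke_index N m (mat 1)" by (simp add: x')
    show "((nat (gcd (fst (fst (fst (snd x), (snd (fst x), snd (snd x))))) (int N)),
            fst (snd (fst (snd x), (snd (fst x), snd (snd x))))),
          (fst (fst (snd x), (snd (fst x), snd (snd x))), snd (snd (fst (snd x), (snd (fst x), snd (snd x)))))) = x"
      using h(4) by (simp add: x' class_rows_def)
  qed auto
  also have "\<dots> = (\<Sum>p\<in>class_pairs m. \<Sum>y\<in>class_rows (fst p) \<times> {..<snd p}. hecke_term m z (fst y, (snd p, snd y)))"
    using finite_class_pairs[OF m] finite_class_rows by (subst sum.Sigma) (auto simp: case_prod_unfold)
  also have "\<dots> = (\<Sum>(e, d)\<in>class_pairs m. \<Sum>b<d. class_sum e (?z d b))"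
  proof (intro sum.cong refl, clarify)
    fix e d
    have "(\<Sum>y\<in>class_rows e \<times> {..<d}. hecke_term m z (fst y, (d, snd y))) = (\<Sum>v\<in>class_rows e. \<Sum>b<d. hecke_term m z (v, (d, b)))"
      by (simp add: sum.cartesian_product case_prod_unfold)
    also have "\<dots> = (\<Sum>b<d. \<Sum>v\<in>class_rows e. hecke_term m z (v, (d, b)))" by (rule sum.swap)
    also have "\<dots> = (\<Sum>b<d. class_sum e (?z d b))" by (simp add: class_sum_def hecke_term_def moebius_hermite)
    finally show "(\<Sum>y\<in>class_rows (fst (e, d)) \<times> {..<snd (e, d)}. hecke_term m z (fst y, (snd (e, d), snd y))) = (\<Sum>b<d. class_sum e (?z d b))"
      by simp
  qed
  finally show ?thesis .
qed

text \<open>For a Hermite form with diagonal (a, d), averaging over b keeps the exponents d l and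
  multiplies them by d; the substitution z -> a z / d turns q^(d l) into q^(a l). So n = a l
  receives d times the coefficient of index d l = d (n / a).\<close>

definition hecke_coeff :: "nat \<Rightarrow> nat \<Rightarrow> complex" where
  "hecke_coeff m n = (\<Sum>(e, d)\<in>class_pairs m.
     if m div d dvd n then of_nat d * class_coeff e (d * (n div (m div d))) else 0)"

lemma sum_class_sum_sums:
  assumes t: "Im z > 0" and d: "d dvd m" "m > 0"
  shows "(\<lambda>n. (if m div d dvd n then of_nat d * class_coeff e (d * (n div (m div d))) else 0) * qexp 1 z ^ n)
    sums ((\<Sum>b<d. class_sum e ((of_nat (m div d) * z + of_nat b) / of_nat d)) -
          (if d = 1 then class_pole e * inverse (qexp 1 z) ^ m else 0))"
proof -
  define a where "a = m div d"
  have ad: "m = a * d" using d by (simp add: a_def)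
  have pos: "a > 0" "d > 0" using ad d by auto
  let ?z = "\<lambda>b. (of_nat a * z + of_nat b) / of_nat d :: complex"
  have "(\<lambda>l. class_coeff e l * qexp 1 (?z b) ^ l) sums (class_sum e (?z b) - class_pole e * inverse (qexp 1 (?z b)))" for b
    using class_coeff[of e] t pos by (simp add: q_series_def Im_divide_of_nat)
  hence "(\<lambda>l. \<Sum>b<d. class_coeff e l * qexp 1 (?z b) ^ l) sums (\<Sum>b<d. class_sum e (?z b) - class_pole e * inverse (qexp 1 (?z b)))"
    by (intro sums_sum) auto
  also have "(\<lambda>l. \<Sum>b<d. class_coeff e l * qexp 1 (?z b) ^ l) =
      (\<lambda>l. if d dvd l then class_coeff e l * (of_nat d * qexp 1 (of_nat l * (of_nat a * z) / of_nat d)) else 0)"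
    unfolding sum_distrib_left[symmetric] sum_qexp_hermite[OF pos(2)] by auto
  also have "(\<Sum>b<d. class_sum e (?z b) - class_pole e * inverse (qexp 1 (?z b))) =
      (\<Sum>b<d. class_sum e (?z b)) - class_pole e * (\<Sum>b<d. inverse (qexp 1 (?z b)))"
    by (simp only: sum_subtractf sum_distrib_left)
  also have "class_pole e * (\<Sum>b<d. inverse (qexp 1 (?z b))) = (if d = 1 then class_pole e * inverse (qexp 1 z) ^ m else 0)"
    unfolding sum_inverse_qexp_hermite[OF pos(2)] using ad by (auto simp: qexp_power power_inverse)
  finally have S: "(\<lambda>l. if d dvd l then class_coeff e l * (of_nat d * qexp 1 (of_nat l * (of_nat a * z) / of_nat d)) else 0)
      sums ((\<Sum>b<d. class_sum e (?z b)) - (if d = 1 then class_pole e * inverse (qexp 1 z) ^ m else 0))" .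
  \<comment> \<open>First reindexing: only exponents d l survive the sum over b. Such a term equals
    a power q^(a l), and a second reindexing passes to the exponent n = a l.\<close>
  have "(\<lambda>l. if d dvd d * l then class_coeff e (d * l) * (of_nat d * qexp 1 (of_nat (d * l) * (of_nat a * z) / of_nat d)) else 0)
      sums ((\<Sum>b<d. class_sum e (?z b)) - (if d = 1 then class_pole e * inverse (qexp 1 z) ^ m else 0))"
    by (subst sums_mono_reindex[where f = "\<lambda>l. if d dvd l then class_coeff e l * (of_nat d * qexp 1 (of_nat l * (of_nat a * z) / of_nat d)) else 0"])
       (use S pos in \<open>auto simp: strict_mono_def elim!: dvdE\<close>)
  also have "(\<lambda>l. if d dvd d * l then class_coeff e (d * l) * (of_nat d * qexp 1 (of_nat (d * l) * (of_nat a * z) / of_nat d)) else 0)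
     = (\<lambda>l. (\<lambda>n. (if a dvd n then of_nat d * class_coeff e (d * (n div a)) else 0) * qexp 1 z ^ n) (a * l))"
    using pos by (auto simp: qexp_power fun_eq_iff mult_ac)
  finally have "(\<lambda>n. (if a dvd n then of_nat d * class_coeff e (d * (n div a)) else 0) * qexp 1 z ^ n)
      sums ((\<Sum>b<d. class_sum e (?z b)) - (if d = 1 then class_pole e * inverse (qexp 1 z) ^ m else 0))"
    by (subst (asm) sums_mono_reindex) (use pos in \<open>auto simp: strict_mono_def elim!: dvdE\<close>)
  thus ?thesis by (simp only: a_def)
qed

lemma hecke_q_series:
  assumes m: "m > 0"
  shows "q_series 1 (hecke_coeff m) (\<lambda>z. hecke m z - \<phi> * inverse (qexp 1 z) ^ m)"
proof (rule q_seriesI)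
  fix z :: complex assume t: "Im z > 0"
  let ?Z = "\<lambda>e d. \<Sum>b<d. class_sum e ((of_nat (m div d) * z + of_nat b) / of_nat d)"
  let ?P = "\<lambda>e d. if d = (1::nat) then class_pole e * inverse (qexp 1 z) ^ m else 0"
  have "(\<lambda>n. \<Sum>(e, d)\<in>class_pairs m. (if m div d dvd n then of_nat d * class_coeff e (d * (n div (m div d))) else 0) * qexp 1 z ^ n)
    sums (\<Sum>(e, d)\<in>class_pairs m. ?Z e d - ?P e d)"
    unfolding case_prod_unfold
    by (intro sums_sum sum_class_sum_sums t m) (auto simp: class_pairs_def)
  also have "(\<lambda>n. \<Sum>(e, d)\<in>class_pairs m. (if m div d dvd n then of_nat d * class_coeff e (d * (n div (m div d))) else 0) * qexp 1 z ^ n)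
     = (\<lambda>n. hecke_coeff m n * qexp 1 z ^ n)"
    by (simp add: hecke_coeff_def sum_distrib_right case_prod_unfold)
  also have "(\<Sum>(e, d)\<in>class_pairs m. ?Z e d - ?P e d) = hecke m z - (\<Sum>(e, d)\<in>class_pairs m. ?P e d)"
    unfolding hecke_eq_class_sums[OF m] by (simp add: sum_subtractf case_prod_unfold)
  \<comment> \<open>A pole needs d = 1 by the root of unity sum and e = \<open>N\<close> by
    \<open>class_pole\<close>; this single pair contributes \<phi> q^-m.\<close>
  also have "(\<Sum>(e, d)\<in>class_pairs m. ?P e d) = (\<Sum>(e, d)\<in>{(N, 1)}. ?P e d)"
  proof (rule sum.mono_neutral_right[OF finite_class_pairs[OF m]])
    show "{(N, 1)} \<subseteq> class_pairs m" using N by (simp add: class_pairs_def)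
    show "\<forall>p\<in>class_pairs m - {(N, 1)}. (case p of (e, d) \<Rightarrow> ?P e d) = 0"
    proof
      fix p assume "p \<in> class_pairs m - {(N, 1)}"
      moreover obtain e d where p: "p = (e, d)" by (cases p)
      ultimately show "(case p of (e, d) \<Rightarrow> ?P e d) = 0"
        by (cases "d = 1") (simp_all add: class_pole_def)
    qed
  qed
  also have "\<dots> = \<phi> * inverse (qexp 1 z) ^ m" by (simp add: class_pole_def)
  finally show "(\<lambda>n. hecke_coeff m n * qexp 1 z ^ n) sums (hecke m z - \<phi> * inverse (qexp 1 z) ^ m)" .
qed

end

section \<open>Faber polynomials\<close>

text \<open>The operator -X E'/E. The sign is such that 1 - aX is sent to the sum of a^m X^m over m
  > 0.\<close>

definition logd :: "complex fps \<Rightarrow> complex fps" where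
  "logd E = - (fps_X * fps_deriv E * inverse E)"

lemma logd_mult:
  assumes "fps_nth A 0 \<noteq> 0" "fps_nth B 0 \<noteq> 0" shows "logd (A * B) = logd A + logd B"
proof -
  have A: "A * inverse A = 1" "B * inverse B = 1" using assms by (simp_all add: inverse_mult_eq_1')
  have "fps_X * (fps_deriv A * B + A * fps_deriv B) * (inverse A * inverse B)
     = fps_X * fps_deriv A * inverse A * (B * inverse B) + fps_X * fps_deriv B * inverse B * (A * inverse A)"
    by (simp add: algebra_simps)
  thus ?thesis unfolding logd_def A by (simp add: fps_inverse_mult algebra_simps)
qed

text \<open>Comparison of coefficients in E * \<open>logd E\<close> = -X E'. These are Newton's
  identities, the coefficients of \<open>logd E\<close> being the power sums.\<close>

lemma logd_rec:
  assumes "fps_nth E 0 = 1"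
  shows "fps_nth (logd E) m = - of_nat m * fps_nth E m - (\<Sum>i=1..m. fps_nth E i * fps_nth (logd E) (m - i))"
proof -
  have "inverse E * E = 1" using assms by (simp add: inverse_mult_eq_1)
  hence "E * logd E = - (fps_X * fps_deriv E)"
    by (simp add: logd_def mult_ac)
  moreover have "fps_nth (fps_X * fps_deriv E) m = of_nat m * fps_nth E m" by (cases m) (simp_all add: One_nat_def)
  ultimately have "(\<Sum>i=0..m. fps_nth E i * fps_nth (logd E) (m - i)) = - of_nat m * fps_nth E m"
    by (metis fps_mult_nth fps_neg_nth mult_minus_left)
  also have "(\<Sum>i=0..m. fps_nth E i * fps_nth (logd E) (m - i))
     = fps_nth (logd E) m + (\<Sum>i=1..m. fps_nth E i * fps_nth (logd E) (m - i))"
    using assms by (simp add: sum.atLeast_Suc_atMost One_nat_def)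
  finally show ?thesis by (simp add: algebra_simps)
qed

text \<open>In the recursion the coefficient of index m is multiplied by m, which is invertible in
  characteristic 0, so \<open>logd\<close> and the constant term determine the series.\<close>

lemma logd_cong:
  assumes "logd E = logd F" "fps_nth E 0 = 1" "fps_nth F 0 = 1" shows "E = F"
proof -
  have "fps_nth E m = fps_nth F m" for m
  proof (induction m rule: less_induct)
    case (less m)
    show ?case
    proof (cases m)
      case 0 thus ?thesis using assms by simp
    next
      case (Suc k)
      have m: "m > 0" by (simp add: Suc)
      have rec: "fps_nth (logd G) m = - of_nat m * fps_nth G m - fps_nth G m * fps_nth (logd G) 0
          - (\<Sum>i\<in>{1..m} - {m}. fps_nth G i * fps_nth (logd G) (m - i))" if "fps_nth G 0 = 1" for G
        using m by (subst logd_rec[OF that], subst sum.remove[of "{1..m}" m]) auto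
      have l0: "fps_nth (logd G) 0 = 0" for G by (simp add: logd_def)
      have "(\<Sum>i\<in>{1..m} - {m}. fps_nth E i * fps_nth (logd E) (m - i)) = (\<Sum>i\<in>{1..m} - {m}. fps_nth F i * fps_nth (logd F) (m - i))"
        using less by (intro sum.cong) (auto simp: assms(1))
      hence "of_nat m * fps_nth E m = of_nat m * fps_nth F m"
        using rec[OF assms(2)] rec[OF assms(3)] assms(1) l0 by auto
      thus ?thesis using m by simp
    qed
  qed
  thus ?thesis by (simp add: fps_eq_iff)
qed

text \<open>By the recursion, each coefficient of \<open>logd\<close> is a polynomial without
  constant term in the higher coefficients of E.\<close>

lemma logd_tendsto_0:
  assumes one: "\<And>x. fps_nth (E x) 0 = 1" and lim: "\<And>n. n > 0 \<Longrightarrow> ((\<lambda>x. fps_nth (E x) n) \<longlongrightarrow> 0) F"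
  shows "((\<lambda>x. fps_nth (logd (E x)) m) \<longlongrightarrow> 0) F"
proof (induction m rule: less_induct)
  case (less m)
  have "((\<lambda>x. - of_nat m * fps_nth (E x) m) \<longlongrightarrow> 0) F"
  proof (cases "m = 0")
    case False
    thus ?thesis using tendsto_mult_right_zero[OF lim[of m], of "- of_nat m"] by simp
  qed simp
  moreover have "((\<lambda>x. \<Sum>i=1..m. fps_nth (E x) i * fps_nth (logd (E x)) (m - i)) \<longlongrightarrow> 0) F"
    using lim less by (intro tendsto_null_sum tendsto_mult_zero) auto
  ultimately have "((\<lambda>x. - of_nat m * fps_nth (E x) m - (\<Sum>i=1..m. fps_nth (E x) i * fps_nth (logd (E x)) (m - i))) \<longlongrightarrow> 0 - 0) F"
    by (rule tendsto_diff)
  also have "(\<lambda>x. - of_nat m * fps_nth (E x) m - (\<Sum>i=1..m. fps_nth (E x) i * fps_nth (logd (E x)) (m - i)))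
      = (\<lambda>x. fps_nth (logd (E x)) m)"
    by (rule ext) (rule logd_rec[OF one, symmetric])
  finally show ?case by simp
qed

lemma logd_linear:
  "fps_nth (logd (1 - fps_const a * fps_X)) m = (if m = 0 then 0 else a ^ m)"
proof (cases m)
  case (Suc k)
  have "(1 - fps_const a * fps_X) * Abs_fps (\<lambda>n. a ^ n) = 1"
    by (rule fps_ext) (auto simp: fps_mult_left_const_nth left_diff_distrib mult.assoc power_eq_if One_nat_def)
  hence "inverse (1 - fps_const a * fps_X) = Abs_fps (\<lambda>n. a ^ n)"
    by (metis fps_inverse_unique)
  thus ?thesis by (simp add: logd_def Suc mult.assoc)
qed (simp add: logd_def)

text \<open>With X = q1 and w = f(z2) this is q1 (f(z1) - f(z2)), as a series in q1.\<close>

definition faber_fps :: "(nat \<Rightarrow> complex) \<Rightarrow> complex \<Rightarrow> complex fps" where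
  "faber_fps c w = 1 + fps_X * (Abs_fps c - fps_const w)"

lemma faber_fps_nth:
  "fps_nth (faber_fps c w) n = (if n = 0 then 1 else c (n - 1) - (if n = 1 then w else 0))"
  by (simp add: faber_fps_def)

lemma faber_polynomial: "\<exists>p. \<forall>w. fps_nth (logd (faber_fps c w)) m = poly p w"
proof (induction m rule: less_induct)
  case (less m)
  then obtain p where p: "\<And>k w. k < m \<Longrightarrow> fps_nth (logd (faber_fps c w)) k = poly (p k) w" by metis
  define e where "e n = (if n = 0 then 1 else [:c (n - 1), if n = 1 then -1 else 0:])" for n :: nat
  have e: "fps_nth (faber_fps c w) n = poly (e n) w" for n w by (simp add: faber_fps_nth e_def)
  have "fps_nth (logd (faber_fps c w)) m = poly ([:- of_nat m:] * e m - (\<Sum>i=1..m. e i * p (m - i))) w" for w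
  proof -
    have one: "fps_nth (faber_fps c w) 0 = 1" by (simp add: faber_fps_nth)
    have "fps_nth (logd (faber_fps c w)) m = - of_nat m * poly (e m) w -
        (\<Sum>i=1..m. poly (e i) w * fps_nth (logd (faber_fps c w)) (m - i))"
      using logd_rec[OF one, of m] unfolding e .
    also have "(\<Sum>i=1..m. poly (e i) w * fps_nth (logd (faber_fps c w)) (m - i)) = (\<Sum>i=1..m. poly (e i) w * poly (p (m - i)) w)"
      using p by (intro sum.cong refl) simp
    finally show ?thesis by (simp add: poly_sum)
  qed
  thus ?case by blast
qed

text \<open>For w = f(z) and q the variable at z: the part of the expansion of f beyond index k,
  divided by q^k, that is, the sum of c(j + k) q^j over j > 0.\<close>

definition tail :: "(nat \<Rightarrow> complex) \<Rightarrow> complex \<Rightarrow> complex \<Rightarrow> nat \<Rightarrow> complex" where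
  "tail c w q k = (w - inverse q - (\<Sum>i<Suc k. c i * q ^ i)) / q ^ k"

text \<open>
  For \<open>w = 1/q + c\<^sub>0 + c\<^sub>1q + \<dots>\<close> the series splits off the factor \<open>1 - X/q\<close>, and the coefficients of
  the cofactor tend to 0 with \<open>q\<close>.
\<close>

lemma faber_fps_factor:
  assumes "q \<noteq> 0"
  shows "faber_fps c w = (1 - fps_const (inverse q) * fps_X) *
    (1 - fps_X * Abs_fps (tail c w q))"
proof (rule fps_ext)
  fix n
  let ?s = "tail c w q"
  have s: "inverse q * ?s k = c (Suc k) + ?s (Suc k)" for k
    using assms by (simp add: tail_def field_simps)
  have s0: "?s 0 = w - inverse q - c 0" by (simp add: tail_def)
  have eq: "(1 - fps_const (inverse q) * fps_X) * (1 - fps_X * Abs_fps ?s)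
      = 1 - fps_X * Abs_fps ?s - fps_const (inverse q) * fps_X + fps_const (inverse q) * fps_X * (fps_X * Abs_fps ?s)"
    by (simp add: algebra_simps)
  show "fps_nth (faber_fps c w) n = fps_nth ((1 - fps_const (inverse q) * fps_X) * (1 - fps_X * Abs_fps ?s)) n"
  proof (cases n)
    case 0 thus ?thesis by (simp add: faber_fps_nth)
  next
    case (Suc k)
    show ?thesis
    proof (cases k)
      case 0
      thus ?thesis unfolding eq using Suc s0 by (simp add: faber_fps_nth mult.assoc One_nat_def)
    next
      case (Suc j)
      thus ?thesis unfolding eq using \<open>n = Suc k\<close> s[of j]
        by (simp add: faber_fps_nth mult.assoc One_nat_def)
    qed
  qed
qed

lemma tendsto_bounded_at_cusp:
  assumes "(g \<longlongrightarrow> l) at_cusp" shows "bounded_at_cusp g"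
proof -
  have "eventually (\<lambda>z. dist (g z) l < 1) at_cusp" using assms by (rule tendstoD) simp
  then obtain Y where Y: "\<And>z. Im z \<ge> Y \<Longrightarrow> dist (g z) l < 1"
    unfolding eventually_filtercomap eventually_at_top_linorder by blast
  have "norm (g z) \<le> norm l + 1" if "Im z > Y" for z
    using Y[of z] that norm_triangle_ineq2[of "g z" l] by (simp add: dist_norm)
  thus ?thesis by (rule bounded_at_cuspI)
qed

context hauptmodul
begin

lemma tail_q_series:
  "q_series 1 (\<lambda>j. if j = 0 then 0 else c (j + k)) (\<lambda>z. tail c (f z) (qexp 1 z) k)"
proof (rule q_seriesI)
  fix z :: complex assume t: "Im z > 0"
  define q where "q = qexp 1 z"
  have q: "q \<noteq> 0" by (simp add: q_def)
  have "(\<lambda>n. c n * q ^ n) sums (f z - inverse q)" using c t by (simp add: q_series_def q_def)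
  hence "(\<lambda>n. c (n + Suc k) * q ^ (n + Suc k)) sums (f z - inverse q - (\<Sum>i<Suc k. c i * q ^ i))"
    by (rule sums_split_initial_segment)
  hence "(\<lambda>n. c (n + Suc k) * q ^ (n + Suc k) / q ^ k) sums tail c (f z) q k"
    unfolding tail_def by (rule sums_divide)
  also have "(\<lambda>n. c (n + Suc k) * q ^ (n + Suc k) / q ^ k) = (\<lambda>n. (if Suc n = 0 then 0 else c (Suc n + k)) * q ^ Suc n)"
    using q by (simp add: power_add field_simps)
  finally show "(\<lambda>j. (if j = 0 then 0 else c (j + k)) * q ^ j) sums tail c (f z) q k"
    by (subst (asm) sums_Suc_iff) simp
qed

text \<open>In the factorisation of \<open>faber_fps\<close> the factor 1 - X/q contributes exactly
  q^-m, while the coefficients of the cofactor tend to 0 and take its \<open>logd\<close> with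
  them.\<close>

lemma logd_asymptotics:
  assumes "m > 0"
  shows "((\<lambda>z. fps_nth (logd (faber_fps c (f z))) m - inverse (qexp 1 z) ^ m) \<longlongrightarrow> 0) at_cusp"
proof -
  let ?s = "\<lambda>z. tail c (f z) (qexp 1 z)"
  let ?G = "\<lambda>z. 1 - fps_X * Abs_fps (?s z)"
  have "((\<lambda>z. fps_nth (?G z) n) \<longlongrightarrow> 0) at_cusp" if "n > 0" for n
  proof -
    obtain k where n: "n = Suc k" using \<open>n > 0\<close> by (cases n) auto
    have "((\<lambda>z. ?s z k) \<longlongrightarrow> 0) at_cusp"
      using q_series_tendsto[OF _ tail_q_series[of k]] by simp
    from tendsto_minus[OF this] show ?thesis by (simp add: n)
  qed
  hence "((\<lambda>z. fps_nth (logd (?G z)) m) \<longlongrightarrow> 0) at_cusp"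
    by (intro logd_tendsto_0) simp_all
  moreover have "fps_nth (logd (?G z)) m = fps_nth (logd (faber_fps c (f z))) m - inverse (qexp 1 z) ^ m" for z
    unfolding faber_fps_factor[OF qexp_nonzero[of 1 z], of c "f z"]
    using assms by (subst logd_mult) (simp_all add: logd_linear)
  ultimately show ?thesis by simp
qed

lemma logd_eq_hecke:
  assumes m: "m > 0" and t: "Im z > 0"
  shows "\<phi> * fps_nth (logd (faber_fps c (f z))) m = hecke m z - hecke_coeff m 0"
proof -
  obtain p where p: "\<And>w. fps_nth (logd (faber_fps c w)) m = poly p w"
    using faber_polynomial by blast
  \<comment> \<open>The polar parts \<phi> q^-m cancel. By \<open>logd_asymptotics\<close> the
    polynomial in f has constant term 0 at infinity, whereas the Hecke sum has
    \<open>hecke_coeff m 0\<close>; subtracting it gives D the limit 0.\<close>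
  define D where "D z = hecke m z - hecke_coeff m 0 - \<phi> * poly p (f z)" for z
  have inv: "D (moebius_map \<gamma> z) = D z" if "\<gamma> \<in> Gamma0 N" "Im z > 0" for \<gamma> z
    using hecke_invariant[OF m that] invariant[OF that] by (simp add: D_def)
  interpret D: Gamma0_function N D using N inv by unfold_locales
  have "((\<lambda>z. (hecke m z - \<phi> * inverse (qexp 1 z) ^ m) - hecke_coeff m 0
       - \<phi> * (fps_nth (logd (faber_fps c (f z))) m - inverse (qexp 1 z) ^ m)) \<longlongrightarrow> hecke_coeff m 0 - hecke_coeff m 0 - \<phi> * 0)
     at_cusp"
    by (intro tendsto_intros q_series_tendsto[OF _ hecke_q_series[OF m]] logd_asymptotics m) simp
  hence lim: "(D \<longlongrightarrow> 0) at_cusp" by (simp add: D_def[abs_def] p algebra_simps)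
  have "D z = 0"
  proof (rule D.liouville[OF _ _ lim t])
    show "D holomorphic_on upper_half_plane"
      unfolding D_def by (intro holomorphic_intros hecke_holomorphic m f_holomorphic)
    fix v assume v: "v \<in> bottom_rows N"
    have A: "row_rep N v \<in> SL2" by (rule row_rep(1)[OF v])
    show "bounded_at_cusp (D.row_fun v)"
    proof (cases "fst v = 0")
      case True
      hence "row_rep N v \<in> Gamma0 N" using row_rep[OF v] by (simp add: Gamma0_iff_row)
      thus ?thesis
        by (intro bounded_at_cusp_cong[OF tendsto_bounded_at_cusp[OF lim]])
           (simp add: D.row_fun_def slash_def inv)
    next
      case False
      hence nA: "row_rep N v \<notin> Gamma0 N" using row_rep[OF v] by (simp add: Gamma0_iff_row)
      obtain B where "q_series (row_width N v) B (row_fun v)" using row_fun_q_series[OF v False] by blast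
      hence "bounded_at_cusp (row_fun v)" by (rule q_series_imp_bounded[OF row_width(1)[OF N]])
      hence "bounded_at_cusp (\<lambda>z. hecke m (moebius_map (row_rep N v) z) - hecke_coeff m 0 - \<phi> * poly p (row_fun v z))"
        by (intro bounded_at_cusp_diff bounded_at_cusp_mult bounded_at_cusp_const
            bounded_at_cusp_poly hecke_moebius_bounded m A nA)
      moreover have "D.row_fun v = (\<lambda>z. hecke m (moebius_map (row_rep N v) z) - hecke_coeff m 0 - \<phi> * poly p (row_fun v z))"
        by (simp add: fun_eq_iff D.row_fun_def row_fun_def slash_def D_def)
      ultimately show ?thesis by simp
    qed
  qed
  thus ?thesis by (simp add: D_def p)
qed

lemma logd_sums:
  assumes m: "m > 0" and t: "Im z > 0"
  shows "(\<lambda>n. (if n = 0 then 0 else hecke_coeff m n / \<phi>) * qexp 1 z ^ n)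
    sums (fps_nth (logd (faber_fps c (f z))) m - inverse (qexp 1 z) ^ m)"
proof -
  let ?q = "qexp 1 z"
  have phi: "\<phi> \<noteq> 0" using Gamma_index_pos[OF N] by simp
  have "(\<lambda>n. hecke_coeff m n * ?q ^ n) sums (hecke m z - \<phi> * inverse ?q ^ m)"
    using hecke_q_series[OF m] t by (simp add: q_series_def)
  moreover have "(\<lambda>n. if n = 0 then hecke_coeff m 0 else 0) sums hecke_coeff m 0"
    using sums_If_finite[of "\<lambda>n. n = 0" "\<lambda>_. hecke_coeff m 0"] by simp
  ultimately have "(\<lambda>n. hecke_coeff m n * ?q ^ n - (if n = 0 then hecke_coeff m 0 else 0))
     sums (hecke m z - \<phi> * inverse ?q ^ m - hecke_coeff m 0)" by (rule sums_diff)
  hence "(\<lambda>n. (hecke_coeff m n * ?q ^ n - (if n = 0 then hecke_coeff m 0 else 0)) / \<phi>)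
     sums ((hecke m z - \<phi> * inverse ?q ^ m - hecke_coeff m 0) / \<phi>)" by (rule sums_divide)
  also have "hecke m z - \<phi> * inverse ?q ^ m - hecke_coeff m 0
     = \<phi> * (fps_nth (logd (faber_fps c (f z))) m - inverse ?q ^ m)"
    using logd_eq_hecke[OF m t] by (simp add: right_diff_distrib)
  also have "(\<lambda>n. (hecke_coeff m n * ?q ^ n - (if n = 0 then hecke_coeff m 0 else 0)) / \<phi>)
     = (\<lambda>n. (if n = 0 then 0 else hecke_coeff m n / \<phi>) * ?q ^ n)" by auto
  finally show ?thesis using phi by simp
qed

end

section \<open>The product\<close>

text \<open>With T the sum of all |t x|, the mean value inequality gives |exp (t x) - 1| <= exp T |t
  x|, which is summable; the limit of the products is that of the sums by continuity of exp.\<close>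

lemma has_abs_prod_exp:
  fixes t :: "'a \<Rightarrow> complex"
  assumes "(\<lambda>x. norm (t x)) summable_on A"
  shows "has_abs_prod (\<lambda>x. exp (t x)) (exp (infsum t A)) A"
proof -
  define T where "T = infsum (\<lambda>x. norm (t x)) A"
  have T0: "T \<ge> 0" unfolding T_def by (intro infsum_nonneg) simp
  have le: "norm (t x) \<le> T" if "x \<in> A" for x
  proof -
    have "infsum (\<lambda>x. norm (t x)) {x} \<le> T"
      unfolding T_def using assms that by (intro infsum_mono_neutral) auto
    thus ?thesis by simp
  qed
  have "norm (exp (t x) - 1) \<le> exp T * norm (t x)" if "x \<in> A" for x
  proof -
    have "norm (exp (t x) - exp 0) \<le> exp T * norm (t x - 0)"
    proof (rule field_differentiable_bound[where S = "cball 0 T"])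
      fix z :: complex assume "z \<in> cball 0 T"
      hence "Re z \<le> T" using complex_Re_le_cmod[of z] by simp
      thus "norm (exp z) \<le> exp T" by (simp add: norm_exp_eq_Re)
      show "(exp has_field_derivative exp z) (at z within cball 0 T)"
        by (auto intro!: derivative_eq_intros)
    qed (use le[OF that] T0 in auto)
    thus ?thesis by simp
  qed
  hence "(\<lambda>x. norm (exp (t x) - 1)) summable_on A"
    by (intro summable_on_comparison_test[OF summable_on_cmult_right[OF assms, of "exp T"]]) auto
  moreover have "((\<lambda>F. exp (sum t F)) \<longlongrightarrow> exp (infsum t A)) (finite_subsets_at_top A)"
    using has_sum_infsum[OF abs_summable_summable[OF assms]] unfolding has_sum_def by (intro tendsto_exp)
  hence "((\<lambda>F. \<Prod>x\<in>F. exp (t x)) \<longlongrightarrow> exp (infsum t A)) (finite_subsets_at_top A)"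
  proof (rule Lim_transform_eventually)
    show "\<forall>\<^sub>F F in finite_subsets_at_top A. exp (sum t F) = (\<Prod>x\<in>F. exp (t x))"
      by (rule eventually_finite_subsets_at_top_weakI) (simp add: exp_sum)
  qed
  ultimately show ?thesis unfolding has_abs_prod_def by blast
qed

lemma has_sum_Ln:
  fixes x :: complex
  assumes "norm x < 1" shows "((\<lambda>k. x ^ k / of_nat k) has_sum (- Ln (1 - x))) {0<..}"
proof -
  have 1: "(\<lambda>n. - ((- (- x)) ^ n) / of_nat n) sums Ln (1 + (- x))"
    using assms by (intro Ln_series') simp
  have "summable (\<lambda>n. norm x ^ n)" using assms by (intro summable_geometric) simp
  hence "summable (\<lambda>n. norm (x ^ n / of_nat n))"
  proof (rule summable_comparison_test'[of _ 0])
    fix n :: nat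
    have "norm x ^ n / real n \<le> norm x ^ n"
    proof (cases "n = 0")
      case False
      hence "norm x ^ n / real n \<le> norm x ^ n / 1" by (intro divide_left_mono) auto
      thus ?thesis by simp
    qed simp
    thus "norm (norm (x ^ n / of_nat n)) \<le> norm x ^ n" by (simp add: norm_divide norm_power)
  qed
  moreover have "(\<lambda>n. x ^ n / of_nat n) sums (- Ln (1 - x))"
    using sums_minus[OF 1] by simp
  ultimately have "((\<lambda>n. x ^ n / of_nat n) has_sum (- Ln (1 - x))) UNIV"
    by (rule norm_summable_imp_has_sum)
  \<comment> \<open>The term of index 0 has denominator 0 and hence the value 0.\<close>
  also have "?this \<longleftrightarrow> ?thesis" by (rule has_sum_cong_neutral) auto
  finally show ?thesis .
qed

lemma summable_on_times_real:
  fixes g :: "'a \<Rightarrow> real" and h :: "'b \<Rightarrow> real"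
  assumes "g summable_on A" "h summable_on B" "\<And>x. x \<in> A \<Longrightarrow> g x \<ge> 0" "\<And>y. y \<in> B \<Longrightarrow> h y \<ge> 0"
  shows "(\<lambda>(x, y). g x * h y) summable_on A \<times> B"
proof (rule summable_on_SigmaI)
  show "((\<lambda>y. case (x, y) of (x, y) \<Rightarrow> g x * h y) has_sum (g x * infsum h B)) B" for x
    using has_sum_cmult_right[OF has_sum_infsum[OF assms(2)], of "g x"] by simp
  show "(\<lambda>x. g x * infsum h B) summable_on A" by (rule summable_on_cmult_left[OF assms(1)])
qed (use assms in auto)

lemma summable_on_geometric:
  assumes "0 \<le> g" "g < (1::real)" shows "(\<lambda>n. g ^ n) summable_on A"
proof -
  have "((\<lambda>n. g ^ n) has_sum (1 / (1 - g))) UNIV"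
    using assms by (intro sums_nonneg_imp_has_sum geometric_sums) auto
  hence "(\<lambda>n. g ^ n) summable_on UNIV" by (rule has_sum_imp_summable)
  thus ?thesis by (rule summable_on_subset_banach) simp
qed

lemma has_fps_expansion_eq_on_disc:
  assumes "f has_fps_expansion F" "g has_fps_expansion F"
    "f holomorphic_on ball 0 r" "g holomorphic_on ball 0 r" "norm z < r"
  shows "f z = g z"
proof -
  have "(\<lambda>n. fps_nth F n * z ^ n) sums f z" "(\<lambda>n. fps_nth F n * z ^ n) sums g z"
    using has_fps_expansion_imp_sums_complex[of f F "ereal r" z]
          has_fps_expansion_imp_sums_complex[of g F "ereal r" z] assms by simp_all
  thus ?thesis by (rule sums_unique2)
qed

section \<open>The logarithm of the product and its convergence\<close>

context hauptmodul
begin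

lemma quotient_pos: "e dvd N \<Longrightarrow> N div e > 0"
  using N by (auto simp: div_greater_zero_iff dvd_imp_le intro!: Nat.gr0I)

text \<open>The number A(l, e), written with rows in place of cusps;
  \<open>exponent_eq_product_exponent\<close> identifies the two.\<close>

definition product_exponent :: "nat \<Rightarrow> nat \<Rightarrow> complex" where
  "product_exponent l e = class_coeff e l / (\<phi> * of_nat (N div e))"

text \<open>The inequality of arithmetic and geometric means, sqrt(mn) <= (m + n)/2, turns the bound
  for the coefficient of index mn into geometric growth in m and n separately.\<close>

lemma product_exponent_bound:
  "\<exists>K>0. \<forall>e m n. e dvd N \<longrightarrow> m > 0 \<longrightarrow> n > 0 \<longrightarrow>
     norm (product_exponent (m * n) e) \<le> K * exp (2 * pi) ^ (m + n)"
proof -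
  obtain K where K: "K > 0" "\<And>d l. l > 0 \<Longrightarrow> norm (class_coeff d l) \<le> K * exp (4 * pi * sqrt (real l))"
    using class_coeff_bound by blast
  have "norm (product_exponent (m * n) e) \<le> K * exp (2 * pi) ^ (m + n)"
    if e: "e dvd N" and mn: "m > 0" "n > 0" for e m n
  proof -
    have "N div e > 0" using e by (rule quotient_pos)
    hence "1 \<le> Gamma_index N * (N div e)" using Gamma_index_pos[OF N] by (simp add: Suc_le_eq One_nat_def)
    hence "real 1 \<le> real (Gamma_index N * (N div e))" by (simp only: of_nat_le_iff)
    hence ge1: "1 \<le> real (Gamma_index N) * real (N div e)" by simp
    have "norm (product_exponent (m * n) e) = norm (class_coeff e (m * n)) / (real (Gamma_index N) * real (N div e))"
      by (simp add: product_exponent_def norm_divide norm_mult)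
    also have "\<dots> \<le> norm (class_coeff e (m * n)) / 1" using ge1 by (intro divide_left_mono) auto
    also have "\<dots> \<le> K * exp (4 * pi * sqrt (real (m * n)))" using K(2)[of "m * n" e] mn by simp
    also have "\<dots> \<le> K * exp (2 * pi * (real m + real n))"
    proof -
      have "sqrt (real m * real n) \<le> (real m + real n) / 2" by (rule arith_geo_mean_sqrt) auto
      hence "4 * pi * sqrt (real (m * n)) \<le> 4 * pi * ((real m + real n) / 2)" by (intro mult_left_mono) simp_all
      thus ?thesis using K(1) by simp
    qed
    also have "exp (2 * pi * (real m + real n)) = exp (2 * pi) ^ (m + n)"
      by (simp add: exp_of_nat_mult[symmetric] mult_ac)
    finally show ?thesis .
  qed
  thus ?thesis using K(1) by blast
qed

text \<open>The terms of minus the logarithm of the product: k is the index in the series of -Ln (1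
  - x). Absolute summability over all four indices permits both groupings used below, by factors of
  the product and by powers of w.\<close>

definition log_term :: "complex \<Rightarrow> complex \<Rightarrow> (nat \<times> nat) \<times> (nat \<times> nat) \<Rightarrow> complex" where
  "log_term w q = (\<lambda>((m, n), (e, k)). product_exponent (m * n) e * (((w ^ m * q ^ n) ^ (N div e)) ^ k / of_nat k))"

definition log_factor :: "complex \<Rightarrow> complex \<Rightarrow> nat \<times> nat \<Rightarrow> complex" where
  "log_factor w q = (\<lambda>(m, n). \<Sum>e | e dvd N. product_exponent (m * n) e * Ln (1 - (w ^ m * q ^ n) ^ (N div e)))"

abbreviation Npos :: "nat set" where "Npos \<equiv> {0<..}"

abbreviation log_index :: "((nat \<times> nat) \<times> (nat \<times> nat)) set" where
  "log_index \<equiv> (Npos \<times> Npos) \<times> ({e. e dvd N} \<times> Npos)"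

text \<open>With g = exp(-2 pi), a monomial to the power k is at most g^(3(m+n)k) <= g^(m+n) g^(m+n)
  g^k. One factor g^(m+n) cancels the growth of the exponents, the other and g^k make the sums over
  m, n and k converge.\<close>

definition radius :: real where "radius = exp (- (2 * pi)) ^ 3"

lemma radius: "radius > 0" "radius < 1"
  by (simp_all add: radius_def power_less_one_iff)

lemma log_term_summable:
  assumes w: "norm w < radius" and q: "norm q < radius"
  shows "(\<lambda>x. norm (log_term w q x)) summable_on log_index"
proof -
  obtain K where K: "K > 0" "\<And>e m n. e dvd N \<Longrightarrow> m > 0 \<Longrightarrow> n > 0 \<Longrightarrow>
     norm (product_exponent (m * n) e) \<le> K * exp (2 * pi) ^ (m + n)"
    using product_exponent_bound by blast
  define g where "g = exp (- (2 * pi))"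
  have g: "0 < g" "g < 1" by (simp_all add: g_def)
  have g3: "exp (2 * pi) * g = 1" by (simp add: g_def exp_minus)
  have rg: "radius = g ^ 3" by (simp add: radius_def g_def)
  have fin: "finite {e. e dvd N}" using N by simp
  have "(\<lambda>((m, n), (e, k)). (g ^ m * g ^ n) * (1 * g ^ k)) summable_on log_index"
  proof -
    have A: "(\<lambda>(m, n). g ^ m * g ^ n) summable_on Npos \<times> Npos"
      using g by (intro summable_on_times_real summable_on_geometric) auto
    have B: "(\<lambda>(e, k). 1 * g ^ k) summable_on {e. e dvd N} \<times> Npos"
      using g fin by (intro summable_on_times_real summable_on_geometric) auto
    have "(\<lambda>(x, y). (case x of (m, n) \<Rightarrow> g ^ m * g ^ n) * (case y of (e, k) \<Rightarrow> 1 * g ^ k)) summable_on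
        log_index"
      by (rule summable_on_times_real[OF A B]) (use g in auto)
    thus ?thesis by (simp add: case_prod_unfold)
  qed
  hence S: "(\<lambda>x. K * (\<lambda>((m, n), (e, k)). (g ^ m * g ^ n) * (1 * g ^ k)) x) summable_on log_index"
    by (rule summable_on_cmult_right)
  show ?thesis
  proof (rule summable_on_comparison_test[OF S])
    fix x assume x: "x \<in> log_index"
    obtain m n e k where x': "x = ((m, n), (e, k))" by (metis prod.exhaust)
    have h: "m > 0" "n > 0" "e dvd N" "k > 0" using x by (auto simp: x')
    define a where "a = norm (w ^ m * q ^ n)"
    have "a \<le> radius ^ m * radius ^ n"
      unfolding a_def norm_mult norm_power using w q radius by (intro mult_mono power_mono) auto
    hence a: "0 \<le> a" "a \<le> g ^ (3 * (m + n))" by (simp_all add: a_def rg power_mult[symmetric] power_add[symmetric] distrib_left)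
    have a1: "a \<le> 1" using a(2) g power_le_one[of g "3 * (m + n)"] by linarith
    have h1: "N div e > 0" using h by (intro quotient_pos)
    have "norm (((w ^ m * q ^ n) ^ (N div e)) ^ k / of_nat k) = a ^ (N div e * k) / real k"
      by (simp add: a_def norm_divide norm_power power_mult)
    also have "\<dots> \<le> a ^ (N div e * k) / 1" using h a by (intro divide_left_mono) (auto simp: Suc_le_eq One_nat_def)
    also have "\<dots> \<le> a ^ k / 1" using h1 a a1 by (intro divide_right_mono power_decreasing) auto
    also have "\<dots> \<le> (g ^ (3 * (m + n))) ^ k" using a by (simp add: power_mono)
    also have "\<dots> = g ^ (3 * (m + n) * k)" by (rule power_mult[symmetric])
    also have "\<dots> \<le> g ^ ((m + n) + (m + n) + k)"
    proof (intro power_decreasing)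
      have "m + n \<le> (m + n) * k" "k \<le> (m + n) * k" using h by simp_all
      thus "(m + n) + (m + n) + k \<le> 3 * (m + n) * k" by linarith
    qed (use g in auto)
    finally have 1: "norm (((w ^ m * q ^ n) ^ (N div e)) ^ k / of_nat k) \<le> g ^ ((m + n) + (m + n) + k)" .
    have "norm (log_term w q x) = norm (product_exponent (m * n) e) * norm (((w ^ m * q ^ n) ^ (N div e)) ^ k / of_nat k)"
      by (simp only: x' log_term_def prod.case norm_mult)
    also have "\<dots> \<le> (K * exp (2 * pi) ^ (m + n)) * g ^ ((m + n) + (m + n) + k)"
      using K h by (intro mult_mono 1 K(2)) auto
    also have "\<dots> = K * (exp (2 * pi) * g) ^ (m + n) * (g ^ (m + n) * g ^ k)"
      by (simp add: power_add power_mult_distrib mult_ac)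
    also have "\<dots> = K * (\<lambda>((m, n), (e, k)). (g ^ m * g ^ n) * (1 * g ^ k)) x"
      unfolding g3 by (simp add: x' power_add mult_ac)
    finally show "norm (log_term w q x) \<le> K * (\<lambda>((m, n), (e, k)). (g ^ m * g ^ n) * (1 * g ^ k)) x" .
  qed simp
qed

lemma norm_monomial_less_1:
  fixes w q :: complex
  assumes "norm w < radius" "norm q < radius" "m > 0" "h > 0"
  shows "norm ((w ^ m * q ^ n) ^ h) < 1"
proof -
  have "norm (w ^ m) * norm (q ^ n) \<le> norm (w ^ m) * 1"
    using assms radius by (intro mult_left_mono) (simp_all add: norm_power power_le_one)
  also have "\<dots> < 1" using assms radius by (simp add: norm_power power_less_one_iff)
  finally show ?thesis using assms by (simp add: norm_power norm_mult power_less_one_iff)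
qed

lemma log_factor_has_sum:
  assumes w: "norm w < radius" and q: "norm q < radius"
  shows "((\<lambda>x. - log_factor w q x) has_sum infsum (log_term w q) log_index) (Npos \<times> Npos)"
proof (rule has_sum_Sigma')
  have s: "log_term w q summable_on log_index"
    by (rule abs_summable_summable[OF log_term_summable[OF w q]])
  thus "(log_term w q has_sum infsum (log_term w q) log_index) log_index"
    by (rule has_sum_infsum)
  fix x assume x: "x \<in> Npos \<times> Npos"
  obtain m n where x': "x = (m, n)" by (cases x)
  have mn: "m > 0" "n > 0" using x by (auto simp: x')
  have "(\<lambda>y. log_term w q (x, y)) summable_on {e. e dvd N} \<times> Npos"
    using summable_on_SigmaD1[of "\<lambda>x y. log_term w q (x, y)" "Npos \<times> Npos" "\<lambda>_. {e. e dvd N} \<times> Npos"] s x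
    by (simp add: case_prod_unfold)
  moreover have "((\<lambda>k. log_term w q (x, (e, k))) has_sum (- (product_exponent (m * n) e * Ln (1 - (w ^ m * q ^ n) ^ (N div e))))) Npos"
    if "e \<in> {e. e dvd N}" for e
  proof -
    have "N div e > 0" using that by (intro quotient_pos) simp
    hence "norm ((w ^ m * q ^ n) ^ (N div e)) < 1" using norm_monomial_less_1[OF w q mn(1)] by simp
    from has_sum_cmult_right[OF has_sum_Ln[OF this], of "product_exponent (m * n) e"]
    show ?thesis by (simp add: log_term_def x')
  qed
  moreover have "((\<lambda>e. - (product_exponent (m * n) e * Ln (1 - (w ^ m * q ^ n) ^ (N div e)))) has_sum (- log_factor w q x)) {e. e dvd N}"
    using N by (intro has_sum_finiteI) (simp_all add: log_factor_def x' sum_negf)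
  ultimately show "((\<lambda>y. log_term w q (x, y)) has_sum - log_factor w q x) ({e. e dvd N} \<times> Npos)"
    by (intro has_sum_SigmaI) simp_all
qed

text \<open>Coefficients of S where \<open>faber_fps c (f z)\<close> = exp (-S) (1 - X/q): there
  \<open>logd\<close> is X S' plus the powers q^-m.\<close>

definition log_coeff :: "complex \<Rightarrow> nat \<Rightarrow> complex" where
  "log_coeff z m = (if m = 0 then 0 else
     (fps_nth (logd (faber_fps c (f z))) m - inverse (qexp 1 z) ^ m) / of_nat m)"

text \<open>
  The terms with \<open>M = mkN/e\<close> and \<open>n' = nkN/e\<close> add up to a coefficient of a Hecke sum.
\<close>

lemma log_term_sums:
  assumes w: "norm w < radius" and t: "Im z > 0" "norm (qexp 1 z) < radius"
  shows "(\<lambda>m. log_coeff z m * w ^ m) sums infsum (log_term w (qexp 1 z)) log_index"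
proof -
  let ?q = "qexp 1 z"
  let ?J = "log_index"
  let ?R = "\<lambda>p. {y \<in> class_pairs (fst p). fst p div snd y dvd snd p}"
  let ?Z = "\<lambda>((M, n), (e, d)). of_nat d * class_coeff e (d * (n div (M div d))) / (\<phi> * of_nat M) * (w ^ M * ?q ^ n)"
  \<comment> \<open>Here d = m, so M / d is the common factor k N/e, from which \<open>?i\<close>
    recovers k and the original n. The weights agree because d / (\<phi> M) = 1 / (\<phi> k
    N/e).\<close>
  let ?i = "\<lambda>((M, n), (e, d)). ((d, n div (M div d)), (e, (M div d) div (N div e))) :: (nat \<times> nat) \<times> (nat \<times> nat)" and ?j = "\<lambda>((m, n), (e, k)). ((m * (k * (N div e)), n * (k * (N div e))), (e, m)) :: (nat \<times> nat) \<times> (nat \<times> nat)"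
  define T where "T = infsum (log_term w ?q) ?J"
  have "(log_term w ?q has_sum T) ?J"
    unfolding T_def by (rule has_sum_infsum[OF abs_summable_summable[OF log_term_summable[OF w t(2)]]])
  also have "?this \<longleftrightarrow> (?Z has_sum T) (Sigma (Npos \<times> Npos) ?R)"
  proof (rule has_sum_reindex_bij_witness[of _ ?i ?j])
    fix x assume "x \<in> ?J"
    then obtain m n e k where x: "x = ((m, n), (e, k))" and h: "m > 0" "n > 0" "e dvd N" "k > 0" by auto
    define h where "h = N div e"
    have h0: "h > 0" using h unfolding h_def by (intro quotient_pos)
    show "?i (?j x) = x"
      using h h0 by (simp add: x h_def[symmetric])
    show "?j x \<in> Sigma (Npos \<times> Npos) ?R"
      using h h0 by (simp add: x h_def[symmetric] class_pairs_def)
    have "product_exponent (m * n) e * (((w ^ m * ?q ^ n) ^ h) ^ k / of_nat k)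
        = of_nat m * class_coeff e (m * n) / (\<phi> * of_nat (m * (k * h))) * (w ^ (m * (k * h)) * ?q ^ (n * (k * h)))"
      using h h0 by (simp add: product_exponent_def h_def[symmetric] power_mult_distrib power_mult[symmetric] mult_ac)
    thus "?Z (?j x) = log_term w ?q x"
      using h h0 by (simp add: x h_def[symmetric] log_term_def)
  next
    fix y assume "y \<in> Sigma (Npos \<times> Npos) ?R"
    then obtain M n e d where y: "y = ((M, n), (e, d))"
      and h: "M > 0" "n > 0" "e dvd N" "d dvd M" "N div e dvd M div d" "M div d dvd n"
      by (auto simp: class_pairs_def)
    define h where "h = N div e"
    have h0: "h > 0" using h unfolding h_def by (intro quotient_pos)
    obtain k where k: "M div d = h * k" using h(5) by (auto simp: h_def)
    obtain j where j: "n = h * k * j" using h(6) unfolding k by auto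
    have M: "M = d * (h * k)" using h(4) k by (metis dvd_mult_div_cancel)
    have pos: "d > 0" "k > 0" "j > 0" using h(1,2) M j by auto
    show "?j (?i y) = y"
      using h0 pos by (simp add: y h_def[symmetric] k) (simp add: M j mult_ac)
    show "?i y \<in> ?J"
      using h0 pos h by (simp add: y h_def[symmetric] k) (simp add: j)
  qed simp
  finally have Z: "(?Z has_sum T) (Sigma (Npos \<times> Npos) ?R)" .
  let ?Y = "\<lambda>(M, n). hecke_coeff M n / (\<phi> * of_nat M) * (w ^ M * ?q ^ n)"
  have Y: "(?Y has_sum T) (Npos \<times> Npos)"
  proof (rule has_sum_Sigma'[OF Z])
    fix p assume "p \<in> Npos \<times> Npos"
    then obtain M n where p: "p = (M, n)" and M: "M > 0" by auto
    have fin: "finite (class_pairs M)" by (rule finite_class_pairs[OF M])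
    have "(\<Sum>y\<in>?R p. ?Z (p, y)) = (\<Sum>(e, d)\<in>{y \<in> class_pairs M. M div snd y dvd n}. of_nat d * class_coeff e (d * (n div (M div d)))) / (\<phi> * of_nat M) * (w ^ M * ?q ^ n)"
      by (simp add: p sum_distrib_right sum_divide_distrib case_prod_unfold)
    also have "(\<Sum>(e, d)\<in>{y \<in> class_pairs M. M div snd y dvd n}. of_nat d * class_coeff e (d * (n div (M div d)))) = hecke_coeff M n"
      unfolding hecke_coeff_def case_prod_unfold by (rule sum.inter_filter[OF fin])
    finally show "((\<lambda>y. ?Z (p, y)) has_sum ?Y p) (?R p)"
      using finite_subset[OF _ fin, of "?R p"] by (intro has_sum_finiteI) (auto simp: p)
  qed
  have "((\<lambda>M. log_coeff z M * w ^ M) has_sum T) Npos"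
  proof (rule has_sum_Sigma'[OF Y])
    fix M assume M: "M \<in> Npos"
    have "(\<lambda>n. ?Y (M, n)) summable_on Npos"
      using summable_on_SigmaD1[of "\<lambda>M n. ?Y (M, n)" Npos "\<lambda>_. Npos" M] has_sum_imp_summable[OF Y] M
      by (simp add: case_prod_unfold)
    then obtain S where S: "((\<lambda>n. ?Y (M, n)) has_sum S) Npos" by (auto simp: summable_on_def)
    let ?y = "\<lambda>n. (if n = 0 then 0 else hecke_coeff M n / \<phi>) * ?q ^ n"
    have "((\<lambda>n. ?y n * (w ^ M / of_nat M)) has_sum S) UNIV \<longleftrightarrow> ((\<lambda>n. ?Y (M, n)) has_sum S) Npos"
      by (rule has_sum_cong_neutral) auto
    hence "(\<lambda>n. ?y n * (w ^ M / of_nat M)) sums S" using S by (intro has_sum_imp_sums) simp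
    moreover have "(\<lambda>n. ?y n * (w ^ M / of_nat M)) sums
       ((fps_nth (logd (faber_fps c (f z))) M - inverse (qexp 1 z) ^ M) * (w ^ M / of_nat M))"
      using M by (intro sums_mult2 logd_sums t(1)) simp
    ultimately have "S = log_coeff z M * w ^ M"
      using M sums_unique2 by (fastforce simp: log_coeff_def)
    thus "((\<lambda>n. ?Y (M, n)) has_sum (log_coeff z M * w ^ M)) Npos" using S by simp
  qed
  also have "?this \<longleftrightarrow> ((\<lambda>M. log_coeff z M * w ^ M) has_sum T) UNIV"
    by (rule has_sum_cong_neutral) (auto simp: log_coeff_def)
  finally show ?thesis unfolding T_def by (rule has_sum_imp_sums)
qed

lemma logd_exp:
  assumes "fps_nth S 0 = 0" shows "logd (fps_exp 1 oo S) = - (fps_X * fps_deriv S)"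
proof -
  let ?E = "fps_exp 1 oo S :: complex fps"
  have "fps_deriv ?E = ?E * fps_deriv S"
    using assms by (simp add: fps_compose_deriv)
  moreover have "?E * inverse ?E = 1" using assms by (intro inverse_mult_eq_1') simp
  ultimately show ?thesis
    by (simp add: logd_def mult_ac)
qed

text \<open>For fixed z2 both sides, multiplied by q1, are power series in q1 with constant term 1
  and the same \<open>logd\<close>, hence equal; both represent holomorphic functions on the disc of
  radius \<open>radius\<close>, where they may be evaluated.\<close>

lemma product_formula:
  assumes t1: "Im z1 > 0" "norm (qexp 1 z1) < radius" and t2: "Im z2 > 0" "norm (qexp 1 z2) < radius"
  shows "f z1 - f z2 = (inverse (qexp 1 z1) - inverse (qexp 1 z2)) *
     exp (infsum (log_factor (qexp 1 z1) (qexp 1 z2)) (Npos \<times> Npos))"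
proof -
  let ?q = "qexp 1 z2" and ?w = "qexp 1 z1"
  let ?L = "1 - fps_const (inverse ?q) * fps_X"
  define S where "S w = infsum (log_term w ?q) log_index" for w
  have S: "(\<lambda>m. log_coeff z2 m * w ^ m) sums S w" if "norm w < radius" for w
    unfolding S_def by (rule log_term_sums[OF that t2])
  have Shol: "S holomorphic_on ball 0 radius"
    by (rule power_series_holomorphic[where a = "log_coeff z2"]) (use S in auto)
  have ev: "eventually (\<lambda>u. u \<in> ball 0 radius) (nhds (0 :: complex))"
    using radius by (intro eventually_nhds_in_open) auto
  define H where "H = - Abs_fps (log_coeff z2)"
  have H0: "fps_nth H 0 = 0" by (simp add: H_def log_coeff_def)
  have "S has_fps_expansion Abs_fps (log_coeff z2)"
    by (rule has_fps_expansionI, rule eventually_mono[OF ev]) (use S in auto)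
  hence "(\<lambda>w. - S w) has_fps_expansion H" unfolding H_def by (rule has_fps_expansion_minus)
  hence "(exp \<circ> (\<lambda>w. - S w)) has_fps_expansion (fps_exp 1 oo H)"
    using H0 by (intro has_fps_expansion_compose has_fps_expansion_exp1)
  hence G: "(\<lambda>w. exp (- S w) * (1 - inverse ?q * w)) has_fps_expansion (fps_exp 1 oo H) * ?L"
    unfolding o_def by (intro has_fps_expansion_mult has_fps_expansion_diff has_fps_expansion_1
        has_fps_expansion_cmult_left has_fps_expansion_fps_X)
  obtain F where F: "F holomorphic_on ball 0 1" "\<And>z. Im z > 0 \<Longrightarrow> f z - inverse (qexp 1 z) = F (qexp 1 z)"
      "F has_fps_expansion Abs_fps c"
    using q_series_disc[OF zero_less_one c] by metis
  have E: "(\<lambda>w. 1 + w * (F w - f z2)) has_fps_expansion faber_fps c (f z2)"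
    unfolding faber_fps_def by (intro fps_expansion_intros F)
  have "fps_nth (logd (faber_fps c (f z2))) m = fps_nth (logd ((fps_exp 1 oo H) * ?L)) m" for m
  proof (cases m)
    case 0 thus ?thesis by (simp add: logd_def)
  next
    case (Suc k)
    have "logd ((fps_exp 1 oo H) * ?L) = logd (fps_exp 1 oo H) + logd ?L"
      using H0 by (intro logd_mult) simp_all
    moreover have "fps_nth (logd (fps_exp 1 oo H)) m = of_nat m * log_coeff z2 m"
      unfolding logd_exp[OF H0] using Suc by (simp add: H_def One_nat_def)
    moreover have "m \<noteq> 0" using Suc by simp
    moreover from this have "of_nat m \<noteq> (0 :: complex)" by simp
    ultimately show ?thesis by (simp add: logd_linear log_coeff_def)
  qed
  hence "faber_fps c (f z2) = (fps_exp 1 oo H) * ?L"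
  proof (rule logd_cong[OF fps_ext])
    show "fps_nth (faber_fps c (f z2)) 0 = 1" by (simp add: faber_fps_nth)
    show "fps_nth ((fps_exp 1 oo H) * ?L) 0 = 1"
      by (simp add: fps_mult_nth_0)
  qed
  hence "1 + ?w * (F ?w - f z2) = exp (- S ?w) * (1 - inverse ?q * ?w)"
    using E G t1(2) radius
    by (intro has_fps_expansion_eq_on_disc[where r = radius])
       (auto intro!: holomorphic_intros Shol holomorphic_on_subset[OF F(1)])
  hence eq: "?w * (f z1 - f z2) = exp (- S ?w) * (1 - inverse ?q * ?w)"
    using F(2)[OF t1(1)] by (simp add: algebra_simps)
  have "infsum (\<lambda>x. - log_factor ?w ?q x) (Npos \<times> Npos) = S ?w"
    unfolding S_def by (rule infsumI[OF log_factor_has_sum[OF t1(2) t2(2)]])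
  hence "- infsum (log_factor ?w ?q) (Npos \<times> Npos) = S ?w" by (simp add: infsum_uminus)
  hence "infsum (log_factor ?w ?q) (Npos \<times> Npos) = - S ?w" by (metis minus_minus)
  moreover have "f z1 - f z2 = (1 - inverse ?q * ?w) * exp (- S ?w) / ?w"
    using eq by (simp add: field_simps)
  moreover have "(1 - inverse ?q * ?w) / ?w = inverse ?w - inverse ?q" by (simp add: field_simps)
  ultimately show ?thesis by (metis times_divide_eq_left)
qed

lemma log_factor_abs_summable:
  assumes "norm w < radius" "norm q < radius"
  shows "(\<lambda>x. norm (log_factor w q x)) summable_on Npos \<times> Npos"
  using has_sum_imp_summable[OF log_factor_has_sum[OF assms]]
  by (simp add: summable_on_iff_abs_summable_on_complex)

lemma exp_log_factor:
  assumes "norm w < radius" "norm q < radius" "m > 0"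
  shows "exp (log_factor w q (m, n)) = (\<Prod>e | e dvd N. (1 - (w ^ m * q ^ n) ^ (N div e)) powr product_exponent (m * n) e)"
proof -
  have fin: "finite {e. e dvd N}" using N by simp
  \<comment> \<open>\<open>powr\<close> agrees with exp (a Ln x) only for a nonzero base.\<close>
  have "1 - (w ^ m * q ^ n) ^ (N div e) \<noteq> 0" if "e dvd N" for e
  proof -
    have "N div e > 0" using that by (intro quotient_pos) simp
    hence "norm ((w ^ m * q ^ n) ^ (N div e)) < 1" by (rule norm_monomial_less_1[OF assms])
    thus ?thesis by (metis eq_iff_diff_eq_0 norm_one less_irrefl)
  qed
  thus ?thesis by (simp add: log_factor_def exp_sum[OF fin] powr_def)
qed

end

section \<open>Cusps and orbits of bottom rows\<close>

lemma moebius_pt_mult: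
  assumes "g \<in> SL2" "A \<in> SL2"
  shows "moebius_pt g (moebius_pt A None) = moebius_pt (g ** A) None"
proof (cases "A$2$1 = 0")
  case True
  hence "A$1$1 \<noteq> 0" using assms(2) by (auto simp: mem_SL2 det_2)
  thus ?thesis using True by (simp add: moebius_pt_def)
next
  case False
  let ?x = "of_int (A$1$1) :: complex" and ?y = "of_int (A$2$1) :: complex"
  have y: "?y \<noteq> 0" using False by simp
  have 1: "of_int (g$2$1) * (?x / ?y) + of_int (g$2$2) = of_int ((g ** A)$2$1) / ?y"
    "of_int (g$1$1) * (?x / ?y) + of_int (g$1$2) = of_int ((g ** A)$1$1) / ?y"
    using y by (simp_all add: field_simps)
  have "(of_int ((g ** A)$2$1) / ?y = 0) \<longleftrightarrow> (g ** A)$2$1 = 0"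
    using False by (simp del: mat2_mult_nth)
  moreover have "moebius_pt A None = Some (?x / ?y)" using False by (simp add: moebius_pt_def)
  moreover have "moebius_pt g (Some z) = (if of_int (g$2$1) * z + of_int (g$2$2) = 0 then None
      else Some ((of_int (g$1$1) * z + of_int (g$1$2)) / (of_int (g$2$1) * z + of_int (g$2$2))))" for z
    by (simp add: moebius_pt_def moebius_map_def)
  moreover have "moebius_pt (g ** A) None = (if (g ** A)$2$1 = 0 then None
      else Some ((of_int ((g ** A)$1$1) / ?y) / (of_int ((g ** A)$2$1) / ?y)))"
    using y by (simp add: moebius_pt_def del: mat2_mult_nth)
  ultimately show ?thesis by (simp only: 1)
qed

lemma moebius_pt_uminus: "moebius_pt (- A) None = moebius_pt A None"
  by (simp add: moebius_pt_def)

lemma moebius_pt_translation: "moebius_pt (A ** translation j) None = moebius_pt A None"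
  by (simp add: moebius_pt_def translation_eq)

lemma SL2_upper_triangular:
  assumes "X \<in> SL2" "X$2$1 = 0" shows "\<exists>j. X = translation j \<or> X = - translation j"
proof -
  have "X$1$1 * X$2$2 = 1" using assms by (simp add: mem_SL2 det_2)
  hence "(X$1$1 = 1 \<and> X$2$2 = 1) \<or> (X$1$1 = -1 \<and> X$2$2 = -1)" by (auto simp: zmult_eq_1_iff)
  thus ?thesis
  proof
    assume "X$1$1 = 1 \<and> X$2$2 = 1"
    thus ?thesis using assms(2) by (intro exI[of _ "X$1$2"]) (simp add: mat2_eq_iff translation_eq)
  next
    assume "X$1$1 = -1 \<and> X$2$2 = -1"
    thus ?thesis using assms(2) by (intro exI[of _ "- (X$1$2)"]) (simp add: mat2_eq_iff translation_eq)
  qed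
qed

lemma uminus_mult_matrix: "A ** (- B) = - (A ** B)" "(- A) ** B = - (A ** B)" for A B :: "int^2^2"
  by (simp_all add: mat2_eq_iff)

text \<open>A^-1 B fixes infinity, so it is upper triangular with both diagonal entries 1 or both
  -1.\<close>

lemma moebius_pt_None_eqD:
  assumes "A \<in> SL2" "B \<in> SL2" "moebius_pt A None = moebius_pt B None"
  shows "\<exists>j. B = A ** translation j \<or> B = - (A ** translation j)"
proof -
  have "A$1$1 * B$2$1 = A$2$1 * B$1$1"
  proof (cases "A$2$1 = 0")
    case True
    hence "B$2$1 = 0" using assms(3) by (auto simp: moebius_pt_def split: if_splits)
    thus ?thesis using True by simp
  next
    case False
    hence "B$2$1 \<noteq> 0" using assms(3) by (auto simp: moebius_pt_def split: if_splits)
    hence "(of_int (A$1$1) * of_int (B$2$1) :: complex) = of_int (B$1$1) * of_int (A$2$1)"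
      using assms(3) False by (simp add: moebius_pt_def frac_eq_eq)
    thus ?thesis by (simp only: of_int_mult[symmetric] of_int_eq_iff mult.commute)
  qed
  hence "(adj2 A ** B)$2$1 = 0" by (simp add: adj2_def)
  then obtain j where "adj2 A ** B = translation j \<or> adj2 A ** B = - translation j"
    using SL2_upper_triangular[OF SL2_mult[OF SL2_adj2[OF assms(1)] assms(2)]] by blast
  hence "A ** (adj2 A ** B) = A ** translation j \<or> A ** (adj2 A ** B) = - (A ** translation j)"
    by (metis uminus_mult_matrix(1))
  thus ?thesis unfolding mult_adj2_cancel[OF assms(1)] by blast
qed

lemma moebius_pt_cusps: "moebius_pt A None \<in> cusps"
  by (auto simp: moebius_pt_def cusps_def)

lemma moebius_pt_cusp_matrix:
  assumes "cusp_matrix A s" shows "moebius_pt A None = Some (of_rat s)"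
proof -
  have "(of_rat s :: complex) = of_rat (of_int (A$1$1) / of_int (A$2$1))"
    using assms by (simp add: cusp_matrix_def)
  also have "\<dots> = of_int (A$1$1) / of_int (A$2$1)" by (simp add: of_rat_divide)
  finally show ?thesis using assms by (simp add: cusp_matrix_def moebius_pt_def)
qed

lemma gcd_mod_left_int: "gcd (x mod n) n = gcd x (n :: int)"
  by (metis gcd_red_int gcd.commute)

definition row_neg :: "nat \<Rightarrow> int \<times> int \<Rightarrow> int \<times> int" where
  "row_neg N v = ((- fst v) mod int N, (- snd v) mod int N)"

lemma bottom_row_uminus: "bottom_row N (- A) = row_neg N (bottom_row N A)"
  by (simp add: bottom_row_def row_neg_def mod_minus_eq)

text \<open>The stabiliser of infinity in SL2(Z) consists of the matrices \<plusminus> T^j. These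
  are therefore the rows of all matrices that send infinity to a point equivalent to A(infinity)
  under \<open>Gamma1 N\<close>.\<close>

definition cusp_rows :: "nat \<Rightarrow> int^2^2 \<Rightarrow> (int \<times> int) set" where
  "cusp_rows N A = range (\<lambda>j. bottom_row N (A ** translation j)) \<union> range (\<lambda>j. bottom_row N (- (A ** translation j)))"

lemma cusp_rows_subset: "A \<in> SL2 \<Longrightarrow> cusp_rows N A \<subseteq> bottom_rows N"
  by (auto simp: cusp_rows_def intro!: bottom_row_mem SL2_uminus SL2_mult)

text \<open>Through this a system of cusp representatives becomes a partition of
  \<open>bottom_rows N\<close> into the sets \<open>cusp_rows\<close>.\<close>

lemma equivalent_cusp_iff:
  assumes A: "cusp_matrix A s" and v: "v \<in> bottom_rows N"
  shows "equivalent_pts (Gamma1 N) (Some (of_rat s)) (moebius_pt (row_rep N v) None) \<longleftrightarrow> v \<in> cusp_rows N A"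
proof
  let ?B = "row_rep N v"
  have As: "A \<in> SL2" using A by (simp add: cusp_matrix_def)
  have B: "?B \<in> SL2" "bottom_row N ?B = v" using row_rep[OF v] by auto
  assume "equivalent_pts (Gamma1 N) (Some (of_rat s)) (moebius_pt ?B None)"
  then obtain g where g: "g \<in> Gamma1 N" "moebius_pt g (moebius_pt A None) = moebius_pt ?B None"
    by (auto simp: equivalent_pts_def moebius_pt_cusp_matrix[OF A])
  have "moebius_pt (g ** A) None = moebius_pt ?B None"
    using g(2) moebius_pt_mult[OF Gamma1_SL2[OF g(1)] As] by simp
  then obtain j where "?B = g ** A ** translation j \<or> ?B = - (g ** A ** translation j)"
    using moebius_pt_None_eqD[OF SL2_mult[OF Gamma1_SL2[OF g(1)] As] B(1)] by blast
  hence "?B = g ** (A ** translation j) \<or> ?B = g ** (- (A ** translation j))"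
    by (simp add: uminus_mult_matrix matrix_mul_assoc)
  hence "v = bottom_row N (A ** translation j) \<or> v = bottom_row N (- (A ** translation j))"
    using B(2) bottom_row_Gamma1_mult[OF g(1)] by metis
  thus "v \<in> cusp_rows N A" by (auto simp: cusp_rows_def)
next
  let ?B = "row_rep N v"
  have As: "A \<in> SL2" using A by (simp add: cusp_matrix_def)
  have B: "?B \<in> SL2" "bottom_row N ?B = v" using row_rep[OF v] by auto
  assume "v \<in> cusp_rows N A"
  then obtain j X where X: "X = A ** translation j \<or> X = - (A ** translation j)" "bottom_row N X = v"
    by (auto simp: cusp_rows_def)
  have Xs: "X \<in> SL2" using X(1) As by (auto intro!: SL2_uminus SL2_mult)
  have g: "?B ** adj2 X \<in> Gamma1 N" using X B Xs by (intro bottom_row_eqD) auto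
  have "moebius_pt X None = moebius_pt A None"
    using X(1) by (auto simp: moebius_pt_uminus moebius_pt_translation)
  hence "moebius_pt (?B ** adj2 X) (Some (of_rat s)) = moebius_pt (?B ** adj2 X) (moebius_pt X None)"
    by (simp add: moebius_pt_cusp_matrix[OF A])
  also have "\<dots> = moebius_pt ?B None"
    using moebius_pt_mult[OF Gamma1_SL2[OF g] Xs] by (simp add: mult_adj2_cancel[OF Xs])
  finally show "equivalent_pts (Gamma1 N) (Some (of_rat s)) (moebius_pt ?B None)"
    using g unfolding equivalent_pts_def by blast
qed

context hauptmodul
begin

lemma class_rows_dvd_iff_int:
  assumes "e dvd N" "v \<in> class_rows e" shows "int N dvd fst v * j \<longleftrightarrow> int (N div e) dvd j"
proof -
  have "int N dvd fst v * j \<longleftrightarrow> int N dvd fst v * int (nat \<bar>j\<bar>)"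
    by (cases "j \<ge> 0") simp_all
  also have "\<dots> \<longleftrightarrow> N div e dvd nat \<bar>j\<bar>" by (rule class_rows_dvd_iff[OF assms])
  also have "\<dots> \<longleftrightarrow> int (N div e) dvd int (nat \<bar>j\<bar>)" by (simp only: int_dvd_int_iff)
  finally show ?thesis by simp
qed

lemma row_width_class: "v \<in> class_rows e \<Longrightarrow> row_width N v = N div e"
  by (simp add: class_rows_def row_width_def)

lemma bottom_row_class:
  assumes "A \<in> SL2" shows "bottom_row N A \<in> class_rows (cusp_m N A)"
  using bottom_row_mem[OF assms] by (simp add: class_rows_def cusp_m_def bottom_row_def gcd_mod_left_int)

lemma cusp_m_dvd: "cusp_m N A dvd N"
proof -
  have "int (cusp_m N A) dvd int N" by (simp add: cusp_m_def)
  thus ?thesis by (simp only: int_dvd_int_iff)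
qed

lemma bottom_row_translation_eq_iff:
  assumes "A \<in> SL2"
  shows "bottom_row N (A ** translation i) = bottom_row N (A ** translation j) \<longleftrightarrow> int (cusp_h N A) dvd i - j"
proof -
  let ?u = "bottom_row N A"
  have u: "?u \<in> bottom_rows N" by (rule bottom_row_mem[OF assms])
  have "bottom_row N (A ** translation i) = bottom_row N (A ** translation j) \<longleftrightarrow>
      (fst ?u * i + snd ?u) mod int N = (fst ?u * j + snd ?u) mod int N"
    by (simp add: bottom_row_mult row_act_translation[OF u])
  also have "\<dots> \<longleftrightarrow> int N dvd fst ?u * (i - j)"
    by (simp add: mod_eq_dvd_iff algebra_simps)
  also have "\<dots> \<longleftrightarrow> int (cusp_h N A) dvd i - j"
    unfolding cusp_h_def by (rule class_rows_dvd_iff_int[OF cusp_m_dvd bottom_row_class[OF assms]])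
  finally show ?thesis .
qed

lemma row_neg_neg: "v \<in> bottom_rows N \<Longrightarrow> row_neg N (row_neg N v) = v"
  by (simp add: row_neg_def mod_minus_eq bottom_rows_mod)

lemma Gamma1_exists_iff:
  assumes "A \<in> SL2" "X \<in> SL2" shows "(\<exists>\<gamma>\<in>Gamma1 N. \<gamma> ** A = X) \<longleftrightarrow> bottom_row N X = bottom_row N A"
proof
  assume "\<exists>\<gamma>\<in>Gamma1 N. \<gamma> ** A = X"
  thus "bottom_row N X = bottom_row N A" using bottom_row_Gamma1_mult by blast
next
  assume "bottom_row N X = bottom_row N A"
  hence "X ** adj2 A \<in> Gamma1 N" using assms by (intro bottom_row_eqD) auto
  moreover have "X ** adj2 A ** A = X" by (rule mult_adj2_cancel[OF assms(1)])
  ultimately show "\<exists>\<gamma>\<in>Gamma1 N. \<gamma> ** A = X" by blast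
qed

text \<open>The orbit is the union of two cycles of length h, the rows of A T^j and their negatives.
  For N = 2 each row is its own negative and the cycles coincide. For N > 2 they are disjoint at a
  regular cusp and coincide at an irregular one, where moreover h = 2.\<close>

lemma card_cusp_rows:
  assumes A: "A \<in> SL2"
  shows "if regular_cusp (Gamma1 N) A then card (cusp_rows N A) * lambda2 N = 2 * cusp_h N A
         else card (cusp_rows N A) = 2 \<and> cusp_h N A = 2 \<and> lambda2 N = 1"
proof -
  define h where "h = cusp_h N A"
  define row where "row j = bottom_row N (A ** translation j)" for j
  define neg where "neg j = bottom_row N (- (A ** translation j))" for j
  define W where "W = cusp_width (Gamma1 N) A"
  have row0: "row 0 = bottom_row N A" by (simp add: row_def translation_0)
  have h0: "h > 0" unfolding h_def cusp_h_def by (rule quotient_pos[OF cusp_m_dvd])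
  have eq: "row i = row j \<longleftrightarrow> int h dvd i - j" for i j
    unfolding row_def h_def by (rule bottom_row_translation_eq_iff[OF A])
  have neg: "neg j = row_neg N (row j)" for j by (simp add: neg_def row_def bottom_row_uminus)
  have mem: "row j \<in> bottom_rows N" for j
    unfolding row_def by (intro bottom_row_mem SL2_mult A SL2_translation)
  have shift: "row (i + j) = row_act N (row i) (translation j)" "neg (i + j) = row_act N (neg i) (translation j)" for i j
  proof -
    have *: "A ** translation (i + j) = A ** translation i ** translation j"
      by (simp add: translation_add matrix_mul_assoc)
    show "row (i + j) = row_act N (row i) (translation j)" by (simp add: row_def * bottom_row_mult)
    show "neg (i + j) = row_act N (neg i) (translation j)"
      unfolding neg_def * by (simp add: uminus_mult_matrix(2)[symmetric] bottom_row_mult)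
  qed
  have negI: "neg (j - i) = row 0" if "row i = neg j" for i j
    using shift(1)[of i "- i"] shift(2)[of j "- i"] that by simp
  have range: "range row = row ` {0..<int h}"
  proof (intro equalityI subsetI)
    fix x assume "x \<in> range row"
    then obtain j where "x = row j" by blast
    hence "x = row (j mod int h)" by (simp add: eq mod_eq_dvd_iff[symmetric])
    moreover have "j mod int h \<in> {0..<int h}" using h0 by simp
    ultimately show "x \<in> row ` {0..<int h}" by blast
  qed auto
  have "inj_on row {0..<int h}"
  proof (rule inj_onI)
    fix i j assume "i \<in> {0..<int h}" "j \<in> {0..<int h}" "row i = row j"
    thus "i = j" using h0 by (simp add: eq mod_eq_dvd_iff[symmetric])
  qed
  hence card_row: "card (range row) = h" unfolding range by (simp add: card_image)
  have fin: "finite (range row)" unfolding range by simp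
  have rneg: "range neg = row_neg N ` range row" by (auto simp: neg)
  have "inj_on (row_neg N) (range row)"
  proof (rule inj_on_inverseI)
    fix v assume "v \<in> range row"
    hence "v \<in> bottom_rows N" using mem by auto
    thus "row_neg N (row_neg N v) = v" by (rule row_neg_neg)
  qed
  hence card_neg: "card (range neg) = h" unfolding rneg using card_row by (simp add: card_image)
  have cr: "cusp_rows N A = range row \<union> range neg" by (simp add: cusp_rows_def row_def[abs_def] neg_def[abs_def])
  have Wdef: "W = (LEAST w. w > 0 \<and> (row (int w) = row 0 \<or> neg (int w) = row 0))"
  proof -
    have "(\<exists>\<gamma>\<in>Gamma1 N. \<gamma> ** A = A ** translation (int w) \<or> \<gamma> ** A = - (A ** translation (int w)))
       \<longleftrightarrow> row (int w) = row 0 \<or> neg (int w) = row 0" for w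
      using Gamma1_exists_iff[OF A SL2_mult[OF A SL2_translation[of "int w"]]]
            Gamma1_exists_iff[OF A SL2_uminus[OF SL2_mult[OF A SL2_translation[of "int w"]]]]
      unfolding row0 row_def[of "int w"] neg_def[of "int w"] by blast
    thus ?thesis by (simp add: W_def cusp_width_def)
  qed
  have reg: "regular_cusp (Gamma1 N) A \<longleftrightarrow> row (int W) = row 0"
    using Gamma1_exists_iff[OF A SL2_mult[OF A SL2_translation[of "int W"]]]
    unfolding regular_cusp_def row0 row_def[of "int W"] W_def[symmetric] by blast
  have "row (int h) = row 0" by (simp add: eq)
  hence ex: "h > 0 \<and> (row (int h) = row 0 \<or> neg (int h) = row 0)" using h0 by blast
  have W: "W > 0 \<and> (row (int W) = row 0 \<or> neg (int W) = row 0)" unfolding Wdef by (rule LeastI[of _ h]) (rule ex)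
  have Wmin: "W \<le> w" if "w > 0" "neg (int w) = row 0" for w
    unfolding Wdef using that by (intro Least_le) simp
  have dvd2: "int N dvd 2 * x" if "[- x = x] (mod int N)" for x
  proof -
    have "int N dvd - x - x" using that by (simp only: cong_iff_dvd_diff)
    also have "- x - x = - (2 * x)" by simp
    finally show ?thesis by (simp only: dvd_minus_iff)
  qed
  \<comment> \<open>A row equal to its negative gives \<open>N\<close> | 2c and \<open>N\<close> |
    2d with c, d coprime, hence \<open>N\<close> | 2.\<close>
  have neg0: "N = 2" if "neg 0 = row 0"
  proof -
    have "[- (A$2$1) = A$2$1] (mod int N)" "[- (A$2$2) = A$2$2] (mod int N)"
      using that unfolding row0 neg row_neg_def by (simp_all add: bottom_row_def cong_def mod_minus_eq)
    hence "int N dvd 2 * A$2$1" "int N dvd 2 * A$2$2" using dvd2 by blast+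
    hence "int N dvd gcd (2 * A$2$1) (2 * A$2$2)" by simp
    also have "gcd (2 * A$2$1) (2 * A$2$2) = 2"
      using SL2_row_coprime[OF A] by (simp add: gcd_mult_distrib_int[symmetric] coprime_iff_gcd_eq_1)
    finally have "N dvd 2" by (metis int_dvd_int_iff of_nat_numeral)
    thus ?thesis using N_ge_2 by (auto dest: dvd_imp_le)
  qed
  show ?thesis
  proof (cases "N = 2")
    case True
    have "(- x) mod 2 = x mod 2" for x :: int by presburger
    hence "neg j = row j" for j unfolding neg using bottom_rows_mod[OF mem[of j]] True
      by (simp add: row_neg_def prod_eq_iff)
    hence "range neg = range row" "regular_cusp (Gamma1 N) A" using W reg by auto
    thus ?thesis using cr card_row True by (simp add: lambda2_def h_def)
  next
    case False
    show ?thesis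
    proof (cases "regular_cusp (Gamma1 N) A")
      case True
      hence "int h dvd int W" using reg eq by simp
      hence hW: "h \<le> W" using W by (auto simp: dvd_imp_le)
      \<comment> \<open>Reduced modulo h, such a w would be 0, contrary to \<open>neg0\<close>, or a
        positive number below h <= W that satisfies the condition defining the width W.\<close>
      have no: "neg w \<noteq> row 0" for w
      proof
        assume "neg w = row 0"
        moreover have "row w = row (w mod int h)" by (simp add: eq mod_eq_dvd_iff[symmetric])
        ultimately have n: "neg (w mod int h) = row 0" by (simp add: neg)
        hence "w mod int h \<noteq> 0" using neg0 False by auto
        moreover have "0 \<le> w mod int h" "w mod int h < int h" using h0 by simp_all
        ultimately have "W \<le> nat (w mod int h)" using n by (intro Wmin) auto
        thus False using hW \<open>w mod int h < int h\<close> \<open>0 \<le> w mod int h\<close> by linarith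
      qed
      have "range row \<inter> range neg = {}" using negI no by blast
      hence "card (cusp_rows N A) = 2 * h" unfolding cr
        using card_row card_neg fin by (subst card_Un_disjoint) (auto simp: rneg)
      thus ?thesis using True False by (simp add: lambda2_def h_def)
    next
      case irr: False
      hence nW: "neg (int W) = row 0" using W reg by auto
      have "neg j = row (j - int W)" for j
        using shift(2)[of "int W" "j - int W"] shift(1)[of 0 "j - int W"] nW by simp
      hence "range neg \<subseteq> range row" by auto
      hence c: "card (cusp_rows N A) = h" unfolding cr using card_row by (simp add: sup.absorb1)
      \<comment> \<open>Translations preserve the first entry, so here it equals its own negative:
        \<open>N\<close> | 2c, which says h | 2. With h = 1 every translation would fix the row and
        the cusp would be regular.\<close>
      have "fst (neg (int W)) = fst (row 0)" using nW by simp
      hence "[- (A$2$1) = A$2$1] (mod int N)"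
        unfolding row0 neg by (simp add: row_neg_def row_def bottom_row_def translation_eq cong_def mod_minus_eq)
      hence "int N dvd 2 * A$2$1" by (rule dvd2)
      hence "int N dvd A$2$1 * 2" by (simp only: mult.commute)
      hence "int N dvd fst (bottom_row N A) * 2"
        by (simp add: bottom_row_def dvd_eq_mod_eq_0 mod_mult_left_eq)
      hence "int h dvd 2" unfolding h_def cusp_h_def
        using class_rows_dvd_iff_int[OF cusp_m_dvd bottom_row_class[OF A]] by simp
      hence "h dvd 2" by (metis int_dvd_int_iff of_nat_numeral)
      hence "h \<le> 2" by (simp add: dvd_imp_le)
      moreover have "h \<noteq> 1" using irr reg eq by auto
      ultimately have "h = 2" using h0 by linarith
      thus ?thesis using irr False c by (simp add: lambda2_def h_def)
    qed
  qed
qed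

section \<open>The exponents\<close>

lemma qexp_pow_width: "h > 0 \<Longrightarrow> qexp h z ^ (l * h) = qexp 1 z ^ l"
  by (simp add: qexp_def exp_of_nat_mult[symmetric] mult_ac)

text \<open>The class sum is expanded in q^(1/h) twice, row by row and through its expansion in q;
  uniqueness of coefficients gives the equality at multiples of h.\<close>

lemma class_coeff_eq_sum:
  assumes e: "e dvd N"
  shows "class_coeff e l = (\<Sum>v\<in>class_rows e. row_coeff v (l * (N div e)))"
proof -
  define h where "h = N div e"
  have h: "h > 0" unfolding h_def by (rule quotient_pos[OF e])
  let ?g = "\<lambda>z. class_sum e z - class_pole e * inverse (qexp 1 z)"
  have 1: "q_series h (\<lambda>n. \<Sum>v\<in>class_rows e. row_coeff v n) ?g"
  proof (rule q_seriesI)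
    fix z :: complex assume t: "Im z > 0"
    have "(\<lambda>n. \<Sum>v\<in>class_rows e. row_coeff v n * qexp h z ^ n) sums (\<Sum>v\<in>class_rows e. row_fun v z - row_pole v z)"
    proof (rule sums_sum)
      fix v assume v: "v \<in> class_rows e"
      hence "v \<in> bottom_rows N" "row_width N v = h" by (simp_all add: row_width_class h_def) (simp add: class_rows_def)
      thus "(\<lambda>n. row_coeff v n * qexp h z ^ n) sums (row_fun v z - row_pole v z)"
        using row_coeff[of v] t unfolding q_series_def by metis
    qed
    thus "(\<lambda>n. (\<Sum>v\<in>class_rows e. row_coeff v n) * qexp h z ^ n) sums ?g z"
      unfolding class_sum_minus_pole[OF t] by (simp add: sum_distrib_right)
  qed
  have 2: "q_series h (\<lambda>n. if h dvd n then class_coeff e (n div h) else 0) ?g"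
  proof (rule q_seriesI)
    fix z :: complex assume t: "Im z > 0"
    have "(\<lambda>l. class_coeff e l * qexp 1 z ^ l) sums ?g z"
      using class_coeff[of e] t by (simp add: q_series_def)
    also have "(\<lambda>l. class_coeff e l * qexp 1 z ^ l) = (\<lambda>l. (\<lambda>n. (if h dvd n then class_coeff e (n div h) else 0) * qexp h z ^ n) (l * h))"
      using h by (simp add: qexp_pow_width fun_eq_iff)
    finally show "(\<lambda>n. (if h dvd n then class_coeff e (n div h) else 0) * qexp h z ^ n) sums ?g z"
      by (subst (asm) sums_mono_reindex) (use h in \<open>auto simp: strict_mono_def elim!: dvdE\<close>)
  qed
  have "(\<lambda>n. \<Sum>v\<in>class_rows e. row_coeff v n) = (\<lambda>n. if h dvd n then class_coeff e (n div h) else 0)"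
    by (rule q_series_unique[OF h 1 2])
  from fun_cong[OF this, of "l * h"] show ?thesis using h by (simp add: h_def)
qed

text \<open>Translation by j multiplies the coefficient of index n by exp(2 pi i j n / h), which is
  1 when h divides n.\<close>

lemma row_coeff_translation:
  assumes v: "v \<in> bottom_rows N"
  shows "row_coeff (row_act N v (translation j)) (l * row_width N v) = row_coeff v (l * row_width N v)"
proof -
  let ?v = "row_act N v (translation j)" and ?h = "row_width N v"
  have h: "?h > 0" by (rule row_width(1)[OF N])
  have v': "?v \<in> bottom_rows N" by (rule row_act_mem[OF v SL2_translation])
  have f: "fst ?v = fst v" by (simp add: row_act_translation[OF v])
  hence w: "row_width N ?v = ?h" by (simp add: row_width_def)
  have "q_series ?h (\<lambda>n. row_coeff v n * qexp ?h (of_int j) ^ n) (\<lambda>z. row_fun ?v z - row_pole ?v z)"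
  proof (rule q_seriesI)
    fix z :: complex assume t: "Im z > 0"
    have "(\<lambda>n. row_coeff v n * qexp ?h (z + of_int j) ^ n) sums (row_fun v (z + of_int j) - row_pole v (z + of_int j))"
      using row_coeff[OF v] t unfolding q_series_def by simp
    also have "row_fun v (z + of_int j) = row_fun ?v z"
      using row_fun_moebius[OF v SL2_translation t, of j] by (simp add: moebius_translation)
    also have "row_pole v (z + of_int j) = row_pole ?v z"
      using qexp_period[of 1 j] by (simp add: row_pole_def f qexp_add)
    also have "(\<lambda>n. row_coeff v n * qexp ?h (z + of_int j) ^ n) = (\<lambda>n. row_coeff v n * qexp ?h (of_int j) ^ n * qexp ?h z ^ n)"
      by (simp add: qexp_add power_mult_distrib mult_ac)
    finally show "(\<lambda>n. row_coeff v n * qexp ?h (of_int j) ^ n * qexp ?h z ^ n) sums (row_fun ?v z - row_pole ?v z)" .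
  qed
  hence "row_coeff ?v = (\<lambda>n. row_coeff v n * qexp ?h (of_int j) ^ n)"
    using row_coeff[OF v'] h unfolding w by (intro q_series_unique[of ?h]) auto
  moreover have "qexp ?h (of_int j) ^ (l * ?h) = 1"
    using qexp_period[of 1 j] h by (simp add: qexp_pow_width)
  ultimately show ?thesis by simp
qed

text \<open>A and -A induce the same Moebius transformation.\<close>

lemma row_coeff_neg:
  assumes v: "v \<in> bottom_rows N" shows "row_coeff (row_neg N v) = row_coeff v"
proof -
  let ?A = "row_rep N v"
  have A: "?A \<in> SL2" "bottom_row N ?A = v" using row_rep[OF v] by auto
  have nv: "row_neg N v = bottom_row N (- ?A)" by (simp add: bottom_row_uminus A)
  have v': "row_neg N v \<in> bottom_rows N" unfolding nv by (intro bottom_row_mem SL2_uminus A)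
  have g: "gcd (fst (row_neg N v)) (int N) = gcd (fst v) (int N)"
    by (simp add: row_neg_def gcd_mod_left_int)
  hence w: "row_width N (row_neg N v) = row_width N v" by (simp add: row_width_def)
  have f: "fst (row_neg N v) = 0 \<longleftrightarrow> fst v = 0"
    using bottom_rows_mod(1)[OF v] by (auto simp: row_neg_def dvd_eq_mod_eq_0[symmetric] dvd_minus_iff)
  have "row_fun (row_neg N v) z = row_fun v z" if "Im z > 0" for z
    unfolding nv using slash_eq_row_fun[OF SL2_uminus[OF A(1)] that]
    by (simp add: slash_def moebius_uminus row_fun_def)
  hence "q_series (row_width N v) (row_coeff (row_neg N v)) (\<lambda>z. row_fun v z - row_pole v z)"
    using row_coeff[OF v'] unfolding w q_series_def by (simp add: row_pole_def f)
  thus ?thesis using row_coeff[OF v] row_width(1)[OF N] by (intro q_series_unique[of "row_width N v"]) auto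
qed

lemma row_coeff_cusp_rows:
  assumes A: "A \<in> SL2" and v: "v \<in> cusp_rows N A"
  shows "row_coeff v (l * cusp_h N A) = row_coeff (bottom_row N A) (l * cusp_h N A)"
proof -
  have u: "bottom_row N A \<in> bottom_rows N" by (rule bottom_row_mem[OF A])
  have h: "cusp_h N A = row_width N (bottom_row N A)"
    using row_width_class[OF bottom_row_class[OF A]] by (simp add: cusp_h_def)
  have *: "row_coeff (bottom_row N (A ** translation j)) (l * cusp_h N A) = row_coeff (bottom_row N A) (l * cusp_h N A)" for j
    unfolding h bottom_row_mult by (rule row_coeff_translation[OF u])
  from v show ?thesis
    using * row_coeff_neg[OF bottom_row_mem[OF SL2_mult[OF A SL2_translation]]]
    by (auto simp: cusp_rows_def bottom_row_uminus)
qed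

lemma cusp_expansion_nth:
  assumes A: "A \<in> SL2"
  shows "fls_nth (cusp_expansion N f A) (int n) = row_coeff (bottom_row N A) n"
proof -
  let ?u = "bottom_row N A" and ?h = "cusp_h N A"
  have u: "?u \<in> bottom_rows N" by (rule bottom_row_mem[OF A])
  have hw: "?h = row_width N ?u"
    using row_width_class[OF bottom_row_class[OF A]] by (simp add: cusp_h_def)
  have h: "?h > 0" unfolding hw by (rule row_width(1)[OF N])
  \<comment> \<open>A pole occurs only for first entry 0, where h = 1 and the polar part is 1/q. One
    factor q^(1/h) therefore always suffices to clear it and turns it into the constant p.\<close>
  define p where "p = (if fst ?u = 0 then 1 else 0 :: complex)"
  have p: "row_pole ?u z * qexp ?h z = p" for z
    using N unfolding hw by (auto simp: p_def row_width_def row_pole_def)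
  have "q_series ?h (\<lambda>n. if n = 0 then p else row_coeff ?u (n - 1)) (\<lambda>z. slash f A z * qexp ?h z ^ 1)"
  proof (rule q_seriesI)
    fix z :: complex assume t: "Im z > 0"
    have "(\<lambda>n. row_coeff ?u n * qexp ?h z ^ n) sums (row_fun ?u z - row_pole ?u z)"
      using row_coeff[OF u] t unfolding hw q_series_def by simp
    hence "(\<lambda>n. row_coeff ?u n * qexp ?h z ^ n * qexp ?h z) sums ((row_fun ?u z - row_pole ?u z) * qexp ?h z)"
      by (rule sums_mult2)
    also have "(row_fun ?u z - row_pole ?u z) * qexp ?h z = slash f A z * qexp ?h z ^ 1 - p"
      using p[of z] slash_eq_row_fun[OF A t] by (simp add: left_diff_distrib)
    also have "(\<lambda>n. row_coeff ?u n * qexp ?h z ^ n * qexp ?h z) = (\<lambda>n. (if Suc n = 0 then p else row_coeff ?u (Suc n - 1)) * qexp ?h z ^ Suc n)"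
      by (simp add: mult_ac)
    finally show "(\<lambda>n. (if n = 0 then p else row_coeff ?u (n - 1)) * qexp ?h z ^ n) sums (slash f A z * qexp ?h z ^ 1)"
      by (subst (asm) sums_Suc_iff) simp
  qed
  from q_expansion_nth[OF h this, of "int n"] show ?thesis
    by (simp add: cusp_expansion_def nat_add_distrib)
qed

text \<open>The rows with gcd e split into the orbits of the cusps with m_s = e, and the coefficient
  of index l h is constant on each orbit. The orbit length over h then has to equal 2 /
  \<open>lambda2 N\<close> at regular cusps and 2 / h at irregular ones, which is
  \<open>card_cusp_rows\<close>.\<close>

lemma exponent_eq_product_exponent:
  assumes C: "cusp_representatives (Gamma1 N) C" and M: "\<And>s. s \<in> C \<Longrightarrow> cusp_matrix (M s) s"
    and e: "e dvd N" and l: "l > 0"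
  shows "exponent N f C M (int l) e = product_exponent l e"
proof -
  have Ms: "M s \<in> SL2" if "s \<in> C" for s using M[OF that] by (simp add: cusp_matrix_def)
  have uniq: "\<exists>!s. s \<in> C \<and> v \<in> cusp_rows N (M s)" if v: "v \<in> bottom_rows N" for v
  proof -
    have "\<exists>!s. s \<in> C \<and> equivalent_pts (Gamma1 N) (Some (of_rat s)) (moebius_pt (row_rep N v) None)"
      using C moebius_pt_cusps unfolding cusp_representatives_def by blast
    thus ?thesis using equivalent_cusp_iff[OF M v] by metis
  qed
  have self: "bottom_row N A \<in> cusp_rows N A" for A
  proof -
    have "bottom_row N A = bottom_row N (A ** translation 0)" by (simp add: translation_0)
    thus ?thesis unfolding cusp_rows_def by blast
  qed
  \<comment> \<open>Finiteness follows from \<open>cusp_representatives\<close>: different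
    representatives own disjoint nonempty sets of rows, and there are finitely many rows.\<close>
  have finC: "finite C"
  proof (rule inj_on_finite[of "\<lambda>s. bottom_row N (M s)" C "bottom_rows N"])
    show "inj_on (\<lambda>s. bottom_row N (M s)) C"
    proof (rule inj_onI)
      fix s s' assume "s \<in> C" "s' \<in> C" "bottom_row N (M s) = bottom_row N (M s')"
      thus "s = s'" using uniq[OF bottom_row_mem[OF Ms]] self by metis
    qed
    show "(\<lambda>s. bottom_row N (M s)) ` C \<subseteq> bottom_rows N" using Ms bottom_row_mem by auto
  qed (rule finite_bottom_rows[OF N])
  define h where "h = N div e"
  have h0: "h > 0" unfolding h_def by (rule quotient_pos[OF e])
  define D where "D = {s \<in> C. cusp_m N (M s) = e}"
  define a where "a s = row_coeff (bottom_row N (M s)) (l * h)" for s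
  have hD: "cusp_h N (M s) = h" if "s \<in> D" for s using that by (simp add: D_def cusp_h_def h_def)
  have gcd_row: "gcd (fst v) (int N) = gcd (M s $2$1) (int N)" if "v \<in> cusp_rows N (M s)" for v s
    using that by (auto simp: cusp_rows_def bottom_row_def translation_eq gcd_mod_left_int)
  have union: "class_rows e = (\<Union>s\<in>D. cusp_rows N (M s))"
  proof (intro equalityI subsetI)
    fix v assume v: "v \<in> class_rows e"
    then obtain s where s: "s \<in> C" "v \<in> cusp_rows N (M s)" using uniq[of v] by (auto simp: class_rows_def)
    have "cusp_m N (M s) = e" using gcd_row[OF s(2)] v by (simp add: cusp_m_def class_rows_def)
    thus "v \<in> (\<Union>s\<in>D. cusp_rows N (M s))" using s by (auto simp: D_def)
  next
    fix v assume "v \<in> (\<Union>s\<in>D. cusp_rows N (M s))"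
    then obtain s where s: "s \<in> C" "cusp_m N (M s) = e" "v \<in> cusp_rows N (M s)" by (auto simp: D_def)
    have "int (cusp_m N (M s)) = gcd (M s $2$1) (int N)" by (simp add: cusp_m_def)
    thus "v \<in> class_rows e" using s gcd_row[OF s(3)] cusp_rows_subset[OF Ms[OF s(1)]] by (auto simp: class_rows_def)
  qed
  have finD: "finite D" using finC by (simp add: D_def)
  have "class_coeff e l = (\<Sum>v\<in>class_rows e. row_coeff v (l * h))"
    unfolding h_def by (rule class_coeff_eq_sum[OF e])
  also have "\<dots> = (\<Sum>s\<in>D. \<Sum>v\<in>cusp_rows N (M s). row_coeff v (l * h))"
    unfolding union
  proof (rule sum.UNION_disjoint[OF finD])
    show "\<forall>s\<in>D. finite (cusp_rows N (M s))"
      using finite_subset[OF cusp_rows_subset[OF Ms] finite_bottom_rows[OF N]] by (auto simp: D_def)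
    show "\<forall>s\<in>D. \<forall>s'\<in>D. s \<noteq> s' \<longrightarrow> cusp_rows N (M s) \<inter> cusp_rows N (M s') = {}"
    proof (intro ballI impI, rule ccontr)
      fix s s' assume s: "s \<in> D" "s' \<in> D" "s \<noteq> s'" and "cusp_rows N (M s) \<inter> cusp_rows N (M s') \<noteq> {}"
      then obtain v where v: "v \<in> cusp_rows N (M s)" "v \<in> cusp_rows N (M s')" by blast
      have "v \<in> bottom_rows N" using v(1) cusp_rows_subset[OF Ms] s(1) by (auto simp: D_def)
      from uniq[OF this] v s show False by (auto simp: D_def)
    qed
  qed
  also have "\<dots> = (\<Sum>s\<in>D. of_nat (card (cusp_rows N (M s))) * a s)"
  proof (intro sum.cong refl)
    fix s assume s: "s \<in> D"
    hence "M s \<in> SL2" using Ms by (simp add: D_def)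
    hence "(\<Sum>v\<in>cusp_rows N (M s). row_coeff v (l * h)) = (\<Sum>v\<in>cusp_rows N (M s). a s)"
      using row_coeff_cusp_rows[of "M s" _ l] hD[OF s] by (intro sum.cong) (simp_all add: a_def)
    thus "(\<Sum>v\<in>cusp_rows N (M s). row_coeff v (l * h)) = of_nat (card (cusp_rows N (M s))) * a s" by simp
  qed
  finally have cc: "class_coeff e l = (\<Sum>s\<in>D. of_nat (card (cusp_rows N (M s))) * a s)" .
  let ?reg = "\<lambda>s. regular_cusp (Gamma1 N) (M s)"
  have nth: "fls_nth (cusp_expansion N f (M s)) (int l * int h) = a s" if "s \<in> C" for s
    using cusp_expansion_nth[OF Ms[OF that], of "l * h"] by (simp add: a_def)
  have lh: "int l * int h \<noteq> 0" using l h0 by simp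
  have D1: "{s. s \<in> C \<and> ?reg s \<and> cusp_m N (M s) = e} = {s \<in> D. ?reg s}"
    "{s. s \<in> C \<and> \<not> ?reg s \<and> cusp_m N (M s) = e} = {s \<in> D. \<not> ?reg s}" by (auto simp: D_def)
  have "exponent N f C M (int l) e = 2 / (of_nat (lambda2 N) * \<phi>) *
     ((\<Sum>s\<in>{s \<in> D. ?reg s}. a s) + (\<Sum>s\<in>{s \<in> D. \<not> ?reg s}. a s / of_nat h))"
  proof -
    have r: "fls_nth (progression_part (cusp_h N (M s)) 0 (cusp_expansion N f (M s)) - fls_const (fls_nth (cusp_expansion N f (M s)) 0)) (int l * int h) = a s"
      if "s \<in> {s \<in> D. ?reg s}" for s
      using that lh nth[of s] hD[of s] by (simp add: progression_part_nth D_def)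
    have i: "1 / of_nat (cusp_h N (M s)) * fls_nth (cusp_expansion N f (M s) - fls_const (fls_nth (cusp_expansion N f (M s)) 0)) (int l * int h) = a s / of_nat h"
      if "s \<in> {s \<in> D. \<not> ?reg s}" for s
      using that lh nth[of s] hD[of s] by (simp add: D_def)
    show ?thesis unfolding exponent_def exponent_series_def D1 h_def[symmetric] fls_mult_const_nth fls_plus_nth fls_nth_sum
      by (intro arg_cong2[of _ _ _ _ "(*)"] arg_cong2[of _ _ _ _ "(+)"] sum.cong refl r i)
  qed
  also have "\<dots> = 2 / (of_nat (lambda2 N) * \<phi>) * (\<Sum>s\<in>D. if ?reg s then a s else a s / of_nat h)"
    using finD by (simp add: sum.If_cases Int_def)
  also have "\<dots> = (\<Sum>s\<in>D. of_nat (card (cusp_rows N (M s))) * a s / (\<phi> * of_nat h))"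
    unfolding sum_distrib_left
  proof (intro sum.cong refl)
    fix s assume s: "s \<in> D"
    have phi: "\<phi> \<noteq> 0" using Gamma_index_pos[OF N] by simp
    have lam: "of_nat (lambda2 N) \<noteq> (0::complex)" by (simp add: lambda2_def)
    have card: "if ?reg s then card (cusp_rows N (M s)) * lambda2 N = 2 * h
         else card (cusp_rows N (M s)) = 2 \<and> h = 2 \<and> lambda2 N = 1"
    proof -
      have "M s \<in> SL2" using s Ms by (simp add: D_def)
      from card_cusp_rows[OF this] show ?thesis unfolding hD[OF s] .
    qed
    show "2 / (of_nat (lambda2 N) * \<phi>) * (if ?reg s then a s else a s / of_nat h) =
       of_nat (card (cusp_rows N (M s))) * a s / (\<phi> * of_nat h)"
    proof (cases "?reg s")
      case True
      hence "of_nat (card (cusp_rows N (M s)) * lambda2 N) = (of_nat (2 * h) :: complex)" using card by simp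
      hence eq: "of_nat (card (cusp_rows N (M s))) * of_nat (lambda2 N) = (2 * of_nat h :: complex)" by simp
      have "2 / (of_nat (lambda2 N) * \<phi>) * a s = (2 * of_nat h) * a s / (of_nat (lambda2 N) * \<phi> * of_nat h)"
        using h0 by simp
      also have "\<dots> = of_nat (card (cusp_rows N (M s))) * a s / (\<phi> * of_nat h)"
        unfolding eq[symmetric] using lam by simp
      finally show ?thesis using True by simp
    next
      case False
      thus ?thesis using card by simp
    qed
  qed
  also have "\<dots> = class_coeff e l / (\<phi> * of_nat h)" unfolding cc by (simp add: sum_divide_distrib)
  finally show ?thesis by (simp add: product_exponent_def h_def)
qed

end

lemma has_abs_prod_cong:
  assumes "\<And>x. x \<in> A \<Longrightarrow> f x = g x" shows "has_abs_prod f P A \<longleftrightarrow> has_abs_prod g P A"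
proof -
  have 1: "(\<lambda>x. norm (f x - 1)) summable_on A \<longleftrightarrow> (\<lambda>x. norm (g x - 1)) summable_on A"
    using assms by (intro summable_on_cong) simp
  have "\<forall>\<^sub>F F in finite_subsets_at_top A. (\<Prod>x\<in>F. f x) = (\<Prod>x\<in>F. g x)"
    using assms by (intro eventually_finite_subsets_at_top_weakI prod.cong) auto
  hence "((\<lambda>F. \<Prod>x\<in>F. f x) \<longlongrightarrow> P) (finite_subsets_at_top A) \<longleftrightarrow> ((\<lambda>F. \<Prod>x\<in>F. g x) \<longlongrightarrow> P) (finite_subsets_at_top A)"
    by (rule tendsto_cong)
  thus ?thesis unfolding has_abs_prod_def 1 by simp
qed

theorem corollary1p5:
  fixes N :: nat and \<pi>N :: "complex \<Rightarrow> complex" and C :: "rat set" and M :: "rat \<Rightarrow> int^2^2"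
  assumes "N \<ge> 2"
    and "surface_has_genus (modular_curve (Gamma0 N)) 0"
    and "Hauptmodul N \<pi>N"
    and "cusp_representatives (Gamma1 N) C"
    and "\<And>s. s \<in> C \<Longrightarrow> cusp_matrix (M s) s"
  shows "\<exists>Y>0. \<forall>z1 z2. Im z1 > Y \<longrightarrow> Im z2 > Y \<longrightarrow>
    (let q1 = exp (2 * of_real pi * \<i> * z1); q2 = exp (2 * of_real pi * \<i> * z2)
     in \<exists>P. has_abs_prod (\<lambda>(m, n). \<Prod>d | d dvd N.
               (1 - (q1 ^ m * q2 ^ n) ^ (N div d)) powr exponent N \<pi>N C M (int (m * n)) d)
             P ({0<..} \<times> {0<..}) \<and>
           \<pi>N z1 - \<pi>N z2 = (inverse q1 - inverse q2) * P)"
proof -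
  interpret hauptmodul N \<pi>N using assms(1,3) by unfold_locales
  \<comment> \<open>The number \<open>radius\<close> = exp(-6 pi) is the modulus of q at height
    3.\<close>
  have small: "norm (qexp 1 z) < radius" "Im z > 0" if "Im z > 3" for z
    using that by (simp_all add: norm_qexp radius_def exp_of_nat_mult[symmetric])
  have q: "exp (2 * of_real pi * \<i> * z) = qexp 1 z" for z by (simp add: qexp_def)
  have "has_abs_prod (\<lambda>(m, n). \<Prod>d | d dvd N.
               (1 - (qexp 1 z1 ^ m * qexp 1 z2 ^ n) ^ (N div d)) powr exponent N \<pi>N C M (int (m * n)) d)
             (exp (infsum (log_factor (qexp 1 z1) (qexp 1 z2)) (Npos \<times> Npos))) (Npos \<times> Npos)"
    if z: "Im z1 > 3" "Im z2 > 3" for z1 z2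
  proof -
    have eq: "exp (log_factor (qexp 1 z1) (qexp 1 z2) x) = (case x of (m, n) \<Rightarrow> \<Prod>d | d dvd N.
               (1 - (qexp 1 z1 ^ m * qexp 1 z2 ^ n) ^ (N div d)) powr exponent N \<pi>N C M (int (m * n)) d)"
      if pos: "x \<in> Npos \<times> Npos" for x
    proof -
      obtain m n where x: "x = (m, n)" "m > 0" "n > 0" using pos by auto
      hence "exponent N \<pi>N C M (int (m * n)) d = product_exponent (m * n) d" if "d dvd N" for d
        using that by (intro exponent_eq_product_exponent assms(4,5)) auto
      thus ?thesis using x exp_log_factor[OF small(1)[OF z(1)] small(1)[OF z(2)] x(2), of n] by simp
    qed
    have "has_abs_prod (\<lambda>x. exp (log_factor (qexp 1 z1) (qexp 1 z2) x))
       (exp (infsum (log_factor (qexp 1 z1) (qexp 1 z2)) (Npos \<times> Npos))) (Npos \<times> Npos)"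
      by (intro has_abs_prod_exp log_factor_abs_summable small z)
    thus ?thesis by (rule has_abs_prod_cong[THEN iffD1, rotated]) (rule eq)
  qed
  hence "\<exists>P. has_abs_prod (\<lambda>(m, n). \<Prod>d | d dvd N.
               (1 - (qexp 1 z1 ^ m * qexp 1 z2 ^ n) ^ (N div d)) powr exponent N \<pi>N C M (int (m * n)) d)
             P (Npos \<times> Npos) \<and> \<pi>N z1 - \<pi>N z2 = (inverse (qexp 1 z1) - inverse (qexp 1 z2)) * P"
    if "Im z1 > 3" "Im z2 > 3" for z1 z2
    using product_formula[OF small(2,1)[OF that(1)] small(2,1)[OF that(2)]] that by blast
  thus ?thesis unfolding Let_def q by (intro exI[of _ 3]) simp
qed

end
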